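(* Let $\mathcal{F}$ be a finite class of graphs that is leaf-reducible. If $\mathcal{F}$ has property $( * )$, then $\mathcal{F}$ is generalized nice.
   Context: All graphs are finite and simple; $|G|$ is the number of vertices of $G$, $\overline{G}$ is the complement of $G$, and $[\ell]=\{1,\ldots,\ell\}$. A clique (stable set) is a set of pairwise adjacent (nonadjacent) vertices. For a set of graphs $\mathcal{F}$, $\overline{\mathcal{F}}=\{\overline{F}:F\in\mathcal{F}\}$, and $G$ is $\mathcal{F}$-free if no induced subgraph of $G$ is isomorphic to a member of $\mathcal{F}$. A nonempty set $\mathcal{H}$ of graphs has the Erdős–Hajnal property if there is $c>0$ such that every $n$-vertex $\mathcal{H}$-free graph has a clique or stable set of size at least $n^c$. For disjoint $X,Y\subseteq V(G)$, $X$ is complete (anti-complete) to $Y$ if every vertex of $X$ is adjacent (nonadjacent) to every vertex of $Y$; $X$ is pure to $Y$ if it is complete or anti-complete to $Y$. A set $X$ (or the induced subgraph on $X$) is $c$-sparse if every vertex in $X$ has at most $c|X|$ neighbors in $X$; it is $c$-restricted if it or its complement is $c$-sparse. Disjoint sets $X,Y$ are weakly $c$-sparse if the number of edges between them is at most $c|X||Y|$. An $(\ell,w)$-blockade in $G$ (where $\ell,w$ are nonnegative reals, not necessarily integers) is a sequence $(B_1,\ldots,B_k)$ of disjoint subsets (blocks) of $V(G)$ with $k\ge \ell$ and $|B_i|\ge w$ for all $i$. It is complete (anti-complete, pure) if its blocks are pairwise complete (anti-complete, pure). For a positive integer $\ell$ and real $w\ge0$, an $(\ell,w)$-comb in $G$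 is a sequence of pairs $((a_i,B_i),i\in[\ell])$ such that $(B_1,\ldots,B_\ell)$ is an $(\ell,w)$-blockade; $a_1,\ldots,a_\ell$ are distinct vertices; $\{a_1,\ldots,a_\ell\},B_1,\ldots,B_\ell$ are disjoint subsets of $V(G)$; and for all distinct $i,j\in[\ell]$, $a_i$ is complete to $B_i$ and anti-complete to $B_j$. Leaf-reducible: a finite class $\mathcal{F}$ is leaf-reducible if there is $H\in\mathcal{F}$ with a vertex $v$ of degree 1 such that $(\mathcal{F}\setminus\{H\})\cup\{H-v\}$ has the Erdős–Hajnal property. Property $( * )$: a finite class $\mathcal{F}$ has property $( * )$ if there exist $c_1,c_2,c_3>0$ such that for every $\overline{\mathcal{F}}$-free graph $G$ the following holds. If there is an $(\ell,w)$-comb $((a_i,B_i),i\in[\ell])$ in $G$ with $\ell,w\ge4$, and there is a vertex $v\in V(G)\setminus(\{a_i:i\in[\ell]\}\cup\bigcup_{i\in[\ell]}B_i)$ that is complete to $\bigcup_{i\in[\ell]}B_i$ and anti-complete to $\{a_i:i\in[\ell]\}$, then one of the following holds: (i) $G$ has a clique or stable set of size at least $w^{c_1}$; (ii) $G$ has a complete or anti-complete $(k,w/k^{c_2})$-blockade for some $k\ge\ell^{c_3}$; (iii) $G$ has a pure $(\ell,w/\ell^2)$-blockade. Generalized nice: a finite class $\mathcal{F}$ is generalized nice if there exist $c_1\ge 3$, $c_2\ge 8$, $c_3,c_4,c_5,c_8>0$, $c_6\ge 1$ and $c_7\ge 4$ such that for every $\overline{\mathcal{F}}$-free graph $G$ and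 every $0<\epsilon<\frac12$, one of the following holds: (i) $G$ has an $(\epsilon^{-1},\epsilon^{c_1}|G|)$-blockade whose blocks are pairwise complete or weakly $\epsilon^{c_2}$-sparse (each pair of blocks is complete or weakly $\epsilon^{c_2}$-sparse); (ii) $G$ has a clique or stable set of size at least $(\epsilon^{c_3}|G|)^{c_4}$; (iii) $G$ has a complete or anti-complete $(k,|G|/k^{c_5})$-blockade for some $k\ge\epsilon^{-c_6}$; (iv) $G$ has an $\epsilon^{c_7}$-restricted induced subgraph of size at least $\epsilon^{c_8}|G|$. *)

theory Defs
  imports Complex_Main "HOL-Library.Ramsey"
begin

text \<open>
  Cliques and stable sets are \<^const>\<open>clique\<close> and \<^const>\<open>indep\<close> from the library. Every finite
  graph is isomorphic to one whose vertices are natural numbers, so quantifying over graphs with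
  vertices in \<^typ>\<open>nat\<close> covers all finite graphs.
\<close>

datatype graph = Graph (verts: "nat set") (edges: "nat set set")

definition simple_graph :: "graph \<Rightarrow> bool" where
  "simple_graph G \<longleftrightarrow> finite (verts G) \<and> edges G \<subseteq> nsets (verts G) 2"

definition complement :: "graph \<Rightarrow> graph" where
  "complement G = Graph (verts G) (nsets (verts G) 2 - edges G)"

definition induced :: "graph \<Rightarrow> nat set \<Rightarrow> graph" where
  "induced G X = Graph (verts G \<inter> X) {e \<in> edges G. e \<subseteq> X}"

definition delete_vertex :: "graph \<Rightarrow> nat \<Rightarrow> graph" where
  "delete_vertex G v = induced G (verts G - {v})"

definition neighbours :: "graph \<Rightarrow> nat \<Rightarrow> nat set" where
  "neighbours G v = {u \<in> verts G. {v, u} \<in> edges G}"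

definition degree :: "graph \<Rightarrow> nat \<Rightarrow> nat" where
  "degree G v = card (neighbours G v)"

definition isomorphic :: "graph \<Rightarrow> graph \<Rightarrow> bool" where
  "isomorphic G H \<longleftrightarrow> (\<exists>f. bij_betw f (verts G) (verts H) \<and>
     (\<forall>u\<in>verts G. \<forall>v\<in>verts G. {u, v} \<in> edges G \<longleftrightarrow> {f u, f v} \<in> edges H))"

definition free :: "graph set \<Rightarrow> graph \<Rightarrow> bool" where
  "free \<F> G \<longleftrightarrow> \<not> (\<exists>X\<subseteq>verts G. \<exists>F\<in>\<F>. isomorphic (induced G X) F)"

definition has_clique_or_stable :: "graph \<Rightarrow> real \<Rightarrow> bool" where
  "has_clique_or_stable G s \<longleftrightarrow>
     (\<exists>X\<subseteq>verts G. (clique X (edges G) \<or> indep X (edges G)) \<and> s \<le> real (card X))"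

definition erdos_hajnal :: "graph set \<Rightarrow> bool" where
  "erdos_hajnal \<H> \<longleftrightarrow> \<H> \<noteq> {} \<and>
     (\<exists>c>0. \<forall>G. simple_graph G \<and> free \<H> G \<longrightarrow>
        has_clique_or_stable G (real (card (verts G)) powr c))"

definition complete_to :: "graph \<Rightarrow> nat set \<Rightarrow> nat set \<Rightarrow> bool" where
  "complete_to G X Y \<longleftrightarrow> (\<forall>x\<in>X. \<forall>y\<in>Y. {x, y} \<in> edges G)"

definition anticomplete_to :: "graph \<Rightarrow> nat set \<Rightarrow> nat set \<Rightarrow> bool" where
  "anticomplete_to G X Y \<longleftrightarrow> (\<forall>x\<in>X. \<forall>y\<in>Y. {x, y} \<notin> edges G)"

definition pure_to :: "graph \<Rightarrow> nat set \<Rightarrow> nat set \<Rightarrow> bool" where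
  "pure_to G X Y \<longleftrightarrow> complete_to G X Y \<or> anticomplete_to G X Y"

definition sparse :: "graph \<Rightarrow> real \<Rightarrow> nat set \<Rightarrow> bool" where
  "sparse G c X \<longleftrightarrow> (\<forall>x\<in>X. real (card (neighbours G x \<inter> X)) \<le> c * real (card X))"

definition restricted :: "graph \<Rightarrow> real \<Rightarrow> nat set \<Rightarrow> bool" where
  "restricted G c X \<longleftrightarrow> sparse G c X \<or> sparse (complement G) c X"

definition weakly_sparse :: "graph \<Rightarrow> real \<Rightarrow> nat set \<Rightarrow> nat set \<Rightarrow> bool" where
  "weakly_sparse G c X Y \<longleftrightarrow>
     real (card {e \<in> edges G. \<exists>x\<in>X. \<exists>y\<in>Y. e = {x, y}}) \<le> c * real (card X) * real (card Y)"

definition pairwise_blocks :: "(nat set \<Rightarrow> nat set \<Rightarrow> bool) \<Rightarrow> nat set list \<Rightarrow> bool" where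
  "pairwise_blocks R Bs \<longleftrightarrow>
     (\<forall>i<length Bs. \<forall>j<length Bs. i \<noteq> j \<longrightarrow> R (Bs ! i) (Bs ! j))"

definition blockade :: "graph \<Rightarrow> real \<Rightarrow> real \<Rightarrow> nat set list \<Rightarrow> bool" where
  "blockade G l w Bs \<longleftrightarrow>
     (\<forall>B\<in>set Bs. B \<subseteq> verts G \<and> w \<le> real (card B)) \<and>
     pairwise_blocks disjnt Bs \<and> l \<le> real (length Bs)"

definition has_complete_or_anticomplete_blockade :: "graph \<Rightarrow> real \<Rightarrow> real \<Rightarrow> bool" where
  "has_complete_or_anticomplete_blockade G l w \<longleftrightarrow>
     (\<exists>Bs. blockade G l w Bs \<and>
        (pairwise_blocks (complete_to G) Bs \<or> pairwise_blocks (anticomplete_to G) Bs))"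

definition has_pure_blockade :: "graph \<Rightarrow> real \<Rightarrow> real \<Rightarrow> bool" where
  "has_pure_blockade G l w \<longleftrightarrow> (\<exists>Bs. blockade G l w Bs \<and> pairwise_blocks (pure_to G) Bs)"

text \<open>
  The comb \<open>((a\<^sub>i, B\<^sub>i), i \<in> [l])\<close> is the list \<open>zip as Bs\<close>, with indices running over \<open>{0..<l}\<close>.
\<close>

definition comb :: "graph \<Rightarrow> nat \<Rightarrow> real \<Rightarrow> nat list \<Rightarrow> nat set list \<Rightarrow> bool" where
  "comb G l w as Bs \<longleftrightarrow>
     0 < l \<and> length as = l \<and> length Bs = l \<and>
     blockade G (real l) w Bs \<and>
     distinct as \<and> set as \<subseteq> verts G \<and> disjnt (set as) (\<Union>(set Bs)) \<and>
     (\<forall>i<l. complete_to G {as ! i} (Bs ! i)) \<and>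
     (\<forall>i<l. \<forall>j<l. i \<noteq> j \<longrightarrow> anticomplete_to G {as ! i} (Bs ! j))"

definition leaf_reducible :: "graph set \<Rightarrow> bool" where
  "leaf_reducible \<F> \<longleftrightarrow>
     (\<exists>H\<in>\<F>. \<exists>v\<in>verts H. degree H v = 1 \<and>
        erdos_hajnal ((\<F> - {H}) \<union> {delete_vertex H v}))"

definition property_star :: "graph set \<Rightarrow> bool" where
  "property_star \<F> \<longleftrightarrow>
     (\<exists>c1>0. \<exists>c2>0. \<exists>c3>0. \<forall>G. simple_graph G \<and> free (complement ` \<F>) G \<longrightarrow>
        (\<forall>l w as Bs v.
           comb G l w as Bs \<and> 4 \<le> l \<and> 4 \<le> w \<and>
           v \<in> verts G - (set as \<union> \<Union>(set Bs)) \<and>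
           complete_to G {v} (\<Union>(set Bs)) \<and> anticomplete_to G {v} (set as) \<longrightarrow>
             has_clique_or_stable G (w powr c1) \<or>
             (\<exists>k\<ge>real l powr c3. has_complete_or_anticomplete_blockade G k (w / k powr c2)) \<or>
             has_pure_blockade G (real l) (w / (real l)^2)))"

definition generalized_nice :: "graph set \<Rightarrow> bool" where
  "generalized_nice \<F> \<longleftrightarrow>
     (\<exists>c1\<ge>3. \<exists>c2\<ge>8. \<exists>c3>0. \<exists>c4>0. \<exists>c5>0. \<exists>c6\<ge>1. \<exists>c7\<ge>4. \<exists>c8>0.
        \<forall>G (\<epsilon>::real). simple_graph G \<and> free (complement ` \<F>) G \<and> 0 < \<epsilon> \<and> \<epsilon> < 1/2 \<longrightarrow>
          (let n = real (card (verts G)) in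
             (\<exists>Bs. blockade G (1/\<epsilon>) (\<epsilon> powr c1 * n) Bs \<and>
                pairwise_blocks
                  (\<lambda>X Y. complete_to G X Y \<or> weakly_sparse G (\<epsilon> powr c2) X Y) Bs) \<or>
             has_clique_or_stable G ((\<epsilon> powr c3 * n) powr c4) \<or>
             (\<exists>k\<ge>\<epsilon> powr (-c6). has_complete_or_anticomplete_blockade G k (n / k powr c5)) \<or>
             (\<exists>X\<subseteq>verts G. restricted G (\<epsilon> powr c7) X \<and> \<epsilon> powr c8 * n \<le> real (card X))))"

end

theory Submission
  imports Defs "HOL-Real_Asymp.Real_Asymp"
begin

text \<open>
  Let \<open>J\<close> be the complement of \<open>H - v\<close>, where \<open>v\<close> is a leaf of \<open>H\<close> with neighbour \<open>u\<close>. If a set \<open>W\<close> has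
  no large \<open>\<lambda>\<^sup>2\<close>-restricted subset, then by the Kleitman--Winston method a random subset of \<open>W\<close> of
  size polynomial in \<open>1/\<lambda>\<close> contains no clique or stable set of the size guaranteed by the
  Erdos--Hajnal property, so it contains a copy of \<open>J\<close> (the other members of the class being
  excluded); hence some copy of \<open>J - u\<close> extends to \<open>J\<close> for a proportion of choices of
  \<open>u\<close> that is polynomial in \<open>\<lambda>\<close>.

  Start from a restricted set given by Roedl's theorem and pass from a \<open>\<lambda>\<close>-restricted set to a large
  \<open>\<lambda>\<^sup>2\<close>-restricted subset as long as one exists. At a set \<open>W\<close> where this stops before \<open>\<lambda>\<close> is small
  enough, there are two cases. If the complement of \<open>W\<close> is sparse, then the set of possible
  choices of \<open>u\<close> is complete to all common neighbours of the copy of \<open>J - u\<close>, since the complement of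
  \<open>H\<close> is excluded; peeling off such sets gives a blockade whose blocks are complete to each
  other. If \<open>W\<close> is sparse, then the neighbourhood of a vertex of relatively high degree is sparse to
  almost all of \<open>W\<close> and can be peeled off, unless there is a comb to which the comb property of
  the class applies. A blockade that is too short is refined by recursion inside its blocks.
\<close>

subsection \<open>Counting stable sets\<close>

text \<open>The two cases differ because of the leaf. In the complement of \<open>H\<close> it is
  adjacent to all vertices but one, so in a set with sparse complement almost every vertex can play
  it, while in a sparse set almost none can; only there is the comb property called for. The main
  obstacle is that the scale \<open>z\<close> at which the descent stops is not under control: it
  may be a constant, far below the scale \<open>Z\<close> that is wanted, and then only about
  \<open>z\<close> to \<open>z^2\<close> blocks are found. So the loss at such a set has to be
  polynomial in the number of blocks obtained, not in \<open>Z\<close>; only then do the losses of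
  nested subdivisions multiply to a polynomial in \<open>Z\<close>. The sparsity between the blocks
  must nevertheless be that of the final scale from the start, and it has to survive the passage to
  small subsets. This is why it is kept one-sided, as a degree condition on the vertices of the
  later block, and why the earlier block is cleaned before it is subdivided.\<close>

definition nbhd :: "('a \<Rightarrow> 'a \<Rightarrow> bool) \<Rightarrow> 'a \<Rightarrow> 'a set \<Rightarrow> 'a set" where
  "nbhd E x W = {y \<in> W. E x y}"

definition co :: "('a \<Rightarrow> 'a \<Rightarrow> bool) \<Rightarrow> 'a \<Rightarrow> 'a \<Rightarrow> bool" where
  "co E x y \<longleftrightarrow> x \<noteq> y \<and> \<not> E x y"

definition low_degree :: "('a \<Rightarrow> 'a \<Rightarrow> bool) \<Rightarrow> real \<Rightarrow> 'a set \<Rightarrow> bool" where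
  "low_degree E c W \<longleftrightarrow> (\<forall>x\<in>W. real (card (nbhd E x W)) \<le> c * real (card W))"

definition edgeless :: "('a \<Rightarrow> 'a \<Rightarrow> bool) \<Rightarrow> 'a set \<Rightarrow> bool" where
  "edgeless E S \<longleftrightarrow> (\<forall>x\<in>S. \<forall>y\<in>S. \<not> E x y)"

definition homogeneous :: "('a \<Rightarrow> 'a \<Rightarrow> bool) \<Rightarrow> 'a set \<Rightarrow> bool" where
  "homogeneous E S \<longleftrightarrow> edgeless E S \<or> edgeless (co E) S"

lemma nbhd_subset: "nbhd E x W \<subseteq> W"
  by (auto simp: nbhd_def)

lemma finite_nbhd: "finite W \<Longrightarrow> finite (nbhd E x W)"
  by (auto simp: nbhd_def)

lemma edgeless_mono: "edgeless E S \<Longrightarrow> T \<subseteq> S \<Longrightarrow> edgeless E T"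
  by (auto simp: edgeless_def)

lemma homogeneous_mono: "homogeneous E S \<Longrightarrow> T \<subseteq> S \<Longrightarrow> homogeneous E T"
  by (auto simp: homogeneous_def edgeless_mono)

lemma irreflp_co: "irreflp (co E)"
  by (auto simp: co_def irreflp_def)

lemma symp_co: "symp E \<Longrightarrow> symp (co E)"
  by (auto simp: co_def symp_def)

lemma co_co: "irreflp E \<Longrightarrow> co (co E) = E"
  by (auto simp: co_def irreflp_def fun_eq_iff)

definition stable_sets :: "('a \<Rightarrow> 'a \<Rightarrow> bool) \<Rightarrow> nat \<Rightarrow> 'a set \<Rightarrow> 'a set set" where
  "stable_sets E k W = {S. S \<subseteq> W \<and> card S = k \<and> edgeless E S}"

lemma finite_stable_sets: "finite W \<Longrightarrow> finite (stable_sets E k W)"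
  unfolding stable_sets_def by (rule finite_subset[of _ "Pow W"]) auto

lemma card_stable_sets_le: "finite W \<Longrightarrow> card (stable_sets E k W) \<le> card W choose k"
  unfolding stable_sets_def
  by (subst n_subsets[symmetric]) (auto intro!: card_mono)

text \<open>A stable set either avoids \<open>x\<close>, or it consists of \<open>x\<close> and a
  stable set with one vertex fewer outside the neighbourhood of \<open>x\<close>.\<close>

lemma card_stable_sets_rec:
  assumes "finite W" "x \<in> W"
  shows "card (stable_sets E (Suc k) W)
    \<le> card (stable_sets E (Suc k) (W - {x})) + card (stable_sets E k (W - {x} - nbhd E x W))"
proof -
  let ?A = "stable_sets E (Suc k) (W - {x})" and ?B = "stable_sets E k (W - {x} - nbhd E x W)"
  have fin: "finite ?A" "finite ?B"
    using assms by (auto intro: finite_stable_sets)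
  have "stable_sets E (Suc k) W \<subseteq> ?A \<union> insert x ` ?B"
  proof
    fix S assume S: "S \<in> stable_sets E (Suc k) W"
    show "S \<in> ?A \<union> insert x ` ?B"
    proof (cases "x \<in> S")
      case False
      then show ?thesis using S by (auto simp: stable_sets_def)
    next
      case True
      have "finite S" using S assms(1) by (auto simp: stable_sets_def intro: finite_subset)
      then have "S - {x} \<in> ?B"
        using S True by (auto simp: stable_sets_def edgeless_def nbhd_def)
      moreover have "S = insert x (S - {x})" using True by auto
      ultimately show ?thesis by blast
    qed
  qed
  then have "card (stable_sets E (Suc k) W) \<le> card (?A \<union> insert x ` ?B)"
    using fin by (intro card_mono) auto
  also have "\<dots> \<le> card ?A + card (insert x ` ?B)" by (rule card_Un_le)
  also have "\<dots> \<le> card ?A + card ?B" using card_image_le[OF fin(2), of "insert x"] by simp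
  finally show ?thesis .
qed

text \<open>The Kleitman--Winston bound: repeatedly branching on a vertex of large degree,
  a stable set uses at most \<open>q\<close> branching vertices before at most \<open>R\<close> candidates are left.\<close>

lemma card_stable_sets_container:
  assumes "finite X" and irr: "irreflp E" and b: "0 \<le> b" "b \<le> 1"
    and deg: "\<And>W. W \<subseteq> X \<Longrightarrow> R < card W \<Longrightarrow> \<exists>x\<in>W. b * real (card W) \<le> real (card (nbhd E x W))"
  shows "W \<subseteq> X \<Longrightarrow> (1 - b) ^ q * real (card W) \<le> real R \<Longrightarrow>
    card (stable_sets E k W) \<le> (\<Sum>j\<le>q. (card W choose j) * (R choose (k - j)))"
proof (induction "card W" arbitrary: W q k rule: less_induct)
  case less
  have finW: "finite W" using less.prems(1) assms(1) finite_subset by blast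
  consider "card W \<le> R" | "R < card W" "k = 0" | k' where "R < card W" "k = Suc k'"
    by (metis not_le nat.exhaust)
  then show ?case
  proof cases
    case 1
    have "card (stable_sets E k W) \<le> R choose k"
      using card_stable_sets_le[OF finW, of E k] binomial_right_mono[OF 1, of k] by linarith
    also have "\<dots> = (\<Sum>j\<in>{0}. (card W choose j) * (R choose (k - j)))" by simp
    also have "\<dots> \<le> (\<Sum>j\<le>q. (card W choose j) * (R choose (k - j)))"
      by (rule sum_mono2) auto
    finally show ?thesis .
  next
    case 2
    have "card (stable_sets E k W) \<le> 1"
      using card_stable_sets_le[OF finW, of E k] 2 by simp
    also have "1 = (\<Sum>j\<in>{0}. (card W choose j) * (R choose (k - j)))" using 2 by simp
    also have "\<dots> \<le> (\<Sum>j\<le>q. (card W choose j) * (R choose (k - j)))"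
      by (rule sum_mono2) auto
    finally show ?thesis .
  next
    case (3 k')
    obtain x where x: "x \<in> W" "b * real (card W) \<le> real (card (nbhd E x W))"
      using deg[OF less.prems(1) 3(1)] by blast
    \<comment> \<open>For \<open>q = 0\<close> the size hypothesis would say
      \<open>card W \<le> R\<close>.\<close>
    obtain q' where q': "q = Suc q'"
      using less.prems(2) 3(1) by (cases q) auto
    let ?W1 = "W - {x}" and ?W2 = "W - {x} - nbhd E x W"
    have xn: "x \<notin> nbhd E x W" using irr by (auto simp: nbhd_def irreflp_def)
    have c1: "card ?W1 = card W - 1" using x finW by simp
    have c1': "card ?W1 < card W" using x finW by (meson card_Diff1_less)
    have "card ?W2 = card W - 1 - card (nbhd E x W)"
      using xn nbhd_subset[of E x W] finW c1
      by (subst card_Diff_subset) (auto simp: finite_nbhd)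
    moreover have "card (insert x (nbhd E x W)) \<le> card W"
      using x(1) nbhd_subset[of E x W] finW by (intro card_mono) auto
    ultimately have c2: "real (card ?W2) \<le> real (card W) - real (card (nbhd E x W))"
      using xn finW by (simp add: finite_nbhd)
    have c2': "card ?W2 \<le> card W - 1"
      using \<open>card ?W2 = _\<close> by simp
    have c2'': "card ?W2 < card W" using c2' c1 c1' by simp
    have r2: "real (card ?W2) \<le> (1 - b) * real (card W)" using c2 x(2) by (simp add: algebra_simps)
    have "(1 - b) ^ q * real (card ?W1) \<le> (1 - b) ^ q * real (card W)"
      using c1' b by (intro mult_left_mono) auto
    then have i1: "card (stable_sets E k ?W1)
        \<le> (\<Sum>j\<le>q. (card ?W1 choose j) * (R choose (k - j)))"
      using less.hyps[OF c1', of q k] less.prems by auto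
    have "(1 - b) ^ q' * real (card ?W2) \<le> (1 - b) ^ q' * ((1 - b) * real (card W))"
      using r2 b by (intro mult_left_mono) auto
    also have "\<dots> \<le> real R" using less.prems(2) q' by (simp add: mult_ac)
    finally have i2: "card (stable_sets E k' ?W2)
        \<le> (\<Sum>j\<le>q'. (card ?W2 choose j) * (R choose (k' - j)))"
      using less.hyps[OF c2'', of q' k'] less.prems by auto
    \<comment> \<open>Both branches live on at most \<open>card W - 1\<close> vertices, so both
      bounds can be written with the same \<open>?n\<close>. Shifting the index in one of the sums
      lets Pascal's rule combine them into the bound for \<open>card W\<close>.\<close>
    let ?n = "card W - 1"
    have "card (stable_sets E k W) \<le> card (stable_sets E k ?W1) + card (stable_sets E k' ?W2)"
      using card_stable_sets_rec[OF finW x(1)] 3(2) by simp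
    also have "\<dots> \<le> (\<Sum>j\<le>q. (?n choose j) * (R choose (k - j)))
        + (\<Sum>j\<le>q'. (?n choose j) * (R choose (k' - j)))"
    proof (rule add_mono)
      show "card (stable_sets E k ?W1) \<le> (\<Sum>j\<le>q. (?n choose j) * (R choose (k - j)))"
        using i1 c1 by simp
      show "card (stable_sets E k' ?W2) \<le> (\<Sum>j\<le>q'. (?n choose j) * (R choose (k' - j)))"
        using i2 by (rule order_trans)
          (intro sum_mono mult_le_mono binomial_right_mono[OF c2'], auto)
    qed
    also have "(\<Sum>j\<le>q. (?n choose j) * (R choose (k - j)))
        = (R choose k) + (\<Sum>j\<le>q'. (?n choose Suc j) * (R choose (k' - j)))"
      by (simp add: q' 3(2) sum.atMost_Suc_shift del: binomial_Suc_Suc sum.atMost_Suc)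
    also have "(R choose k) + (\<Sum>j\<le>q'. (?n choose Suc j) * (R choose (k' - j)))
        + (\<Sum>j\<le>q'. (?n choose j) * (R choose (k' - j)))
        = (R choose k) + (\<Sum>j\<le>q'. (Suc ?n choose Suc j) * (R choose (k' - j)))"
      by (simp add: sum.distrib[symmetric] algebra_simps)
    also have "\<dots> = (\<Sum>j\<le>q. (Suc ?n choose j) * (R choose (k - j)))"
      by (simp add: q' 3(2) sum.atMost_Suc_shift del: binomial_Suc_Suc sum.atMost_Suc)
    also have "Suc ?n = card W" using 3(1) by simp
    finally show ?thesis .
  qed
qed

text \<open>Multiplied by \<open>fact s\<close>, a term of the container bound is at most
  \<open>s choose j\<close> times n^j * R^(s - j). Since \<open>R \<le> n\<close>, replacing the
  exponent \<open>j\<close> of \<open>n\<close> by \<open>q\<close> only increases this, so that the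
  sum over \<open>j\<close> merely contributes a factor 2^s.\<close>

lemma binomial_product_bound:
  assumes "j \<le> q" "q \<le> s" "R \<le> n"
  shows "real ((n choose j) * (R choose (s - j))) * fact s
    \<le> real (s choose j) * (real n ^ q * real R ^ (s - q))"
proof -
  have "real (n choose j) * fact j \<le> real n ^ j"
    using binomial_fact_pow[of n j] by (metis of_nat_fact of_nat_le_iff of_nat_mult of_nat_power)
  moreover have "real (R choose (s - j)) * fact (s - j) \<le> real R ^ (s - j)"
    using binomial_fact_pow[of R "s - j"] by (metis of_nat_fact of_nat_le_iff of_nat_mult of_nat_power)
  ultimately have *: "(real (n choose j) * fact j) * (real (R choose (s - j)) * fact (s - j))
      \<le> real n ^ j * real R ^ (s - j)"
    by (intro mult_mono) auto
  have fs: "(fact s :: real) = real (s choose j) * fact j * fact (s - j)"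
    using binomial_fact_lemma[of j s] assms
    by (metis (no_types, opaque_lifting) mult.assoc mult.commute of_nat_fact of_nat_mult order_trans)
  have "real ((n choose j) * (R choose (s - j))) * fact s
      = real (s choose j) * ((real (n choose j) * fact j) * (real (R choose (s - j)) * fact (s - j)))"
    by (simp add: fs mult_ac)
  also have "\<dots> \<le> real (s choose j) * (real n ^ j * real R ^ (s - j))"
    using * by (intro mult_left_mono) auto
  also have "real n ^ j * real R ^ (s - j) = real n ^ j * (real R ^ (q - j) * real R ^ (s - q))"
    using assms by (simp flip: power_add)
  also have "\<dots> \<le> real n ^ j * (real n ^ (q - j) * real R ^ (s - q))"
    using assms by (intro mult_left_mono mult_right_mono power_mono) auto
  also have "\<dots> = real n ^ q * real R ^ (s - q)"
    using assms by (simp flip: power_add mult.assoc)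
  finally show ?thesis by (simp add: mult_left_mono)
qed

lemma card_stable_sets_bound:
  assumes "finite X" "irreflp E" "0 \<le> b" "b \<le> 1"
    and "\<And>W. W \<subseteq> X \<Longrightarrow> R < card W \<Longrightarrow> \<exists>x\<in>W. b * real (card W) \<le> real (card (nbhd E x W))"
    and "(1 - b) ^ q * real (card X) \<le> real R" and "q \<le> s" "R \<le> card X"
  shows "real (card (stable_sets E s X)) * fact s
    \<le> 2 ^ s * (real (card X) ^ q * real R ^ (s - q))"
proof -
  let ?n = "card X"
  have "real (card (stable_sets E s X)) * fact s
      \<le> real (\<Sum>j\<le>q. (?n choose j) * (R choose (s - j))) * fact s"
    using card_stable_sets_container[OF assms(1-5) subset_refl assms(6), of s]
    by (intro mult_right_mono) (auto simp del: of_nat_sum)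
  also have "\<dots> = (\<Sum>j\<le>q. real ((?n choose j) * (R choose (s - j))) * fact s)"
    by (simp add: sum_distrib_right)
  also have "\<dots> \<le> (\<Sum>j\<le>q. real (s choose j) * (real ?n ^ q * real R ^ (s - q)))"
    using assms by (intro sum_mono binomial_product_bound) auto
  also have "\<dots> \<le> (\<Sum>j\<le>s. real (s choose j) * (real ?n ^ q * real R ^ (s - q)))"
    using assms by (intro sum_mono2) auto
  also have "\<dots> = real (\<Sum>j\<le>s. s choose j) * (real ?n ^ q * real R ^ (s - q))"
    by (simp add: sum_distrib_right)
  also have "\<dots> = 2 ^ s * (real ?n ^ q * real R ^ (s - q))"
    by (subst choose_row_sum) simp
  finally show ?thesis .
qed

subsection \<open>Sampling without large homogeneous sets\<close>

definition restricted_rel :: "('a \<Rightarrow> 'a \<Rightarrow> bool) \<Rightarrow> real \<Rightarrow> 'a set \<Rightarrow> bool" where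
  "restricted_rel E c W \<longleftrightarrow> low_degree E c W \<or> low_degree (co E) c W"

lemma card_supersets_le:
  assumes "finite X" "S \<subseteq> X"
  shows "card {M. M \<subseteq> X \<and> card M = m \<and> S \<subseteq> M} \<le> (card X - card S) choose (m - card S)"
proof -
  have finS: "finite S" using assms finite_subset by blast
  have "card {M. M \<subseteq> X \<and> card M = m \<and> S \<subseteq> M} \<le> card {T. T \<subseteq> X - S \<and> card T = m - card S}"
  proof (rule card_inj_on_le[where f = "\<lambda>M. M - S"])
    show "inj_on (\<lambda>M. M - S) {M. M \<subseteq> X \<and> card M = m \<and> S \<subseteq> M}"
    proof (rule inj_onI)
      fix M M' assume *: "M \<in> {M. M \<subseteq> X \<and> card M = m \<and> S \<subseteq> M}"
        "M' \<in> {M. M \<subseteq> X \<and> card M = m \<and> S \<subseteq> M}" "M - S = M' - S"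
      then have "M = (M - S) \<union> S" "M' = (M' - S) \<union> S" by auto
      with *(3) show "M = M'" by simp
    qed
    show "(\<lambda>M. M - S) ` {M. M \<subseteq> X \<and> card M = m \<and> S \<subseteq> M} \<subseteq> {T. T \<subseteq> X - S \<and> card T = m - card S}"
      using finS by (auto simp: card_Diff_subset)
    show "finite {T. T \<subseteq> X - S \<and> card T = m - card S}"
      using assms(1) by - (rule finite_subset[of _ "Pow X"], auto)
  qed
  also have "\<dots> = card (X - S) choose (m - card S)"
    using assms(1) by (intro n_subsets) auto
  also have "card (X - S) = card X - card S"
    using assms finS by (simp add: card_Diff_subset)
  finally show ?thesis .
qed

text \<open>Union bound: each member of \<open>H\<close> lies in at most (n - s choose m - s) sets
  of size \<open>m\<close>, and (n choose m) * (m choose s) = (n choose s) * (n - s choose m - s)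
  turns \<open>few\<close> into a proportion below one half.\<close>

lemma card_containing_le:
  assumes "finite X" "\<And>S. S \<in> H \<Longrightarrow> S \<subseteq> X \<and> card S = s" "s \<le> m" "m \<le> card X"
    and few: "2 * card H * (m choose s) < (card X choose s)"
  shows "2 * card {M. M \<subseteq> X \<and> card M = m \<and> (\<exists>S\<in>H. S \<subseteq> M)} < (card X choose m)"
proof -
  let ?n = "card X"
  have finH: "finite H" using assms(1,2) by - (rule finite_subset[of H "Pow X"], auto)
  have "{M. M \<subseteq> X \<and> card M = m \<and> (\<exists>S\<in>H. S \<subseteq> M)}
      = (\<Union>S\<in>H. {M. M \<subseteq> X \<and> card M = m \<and> S \<subseteq> M})" by auto
  then have "card {M. M \<subseteq> X \<and> card M = m \<and> (\<exists>S\<in>H. S \<subseteq> M)}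
      \<le> (\<Sum>S\<in>H. card {M. M \<subseteq> X \<and> card M = m \<and> S \<subseteq> M})"
    using card_UN_le[OF finH] by simp
  also have "\<dots> \<le> (\<Sum>S\<in>H. (?n - s) choose (m - s))"
  proof (rule sum_mono)
    fix S assume "S \<in> H"
    then show "card {M. M \<subseteq> X \<and> card M = m \<and> S \<subseteq> M} \<le> (?n - s) choose (m - s)"
      using card_supersets_le[OF assms(1), of S m] assms(2)[of S] by simp
  qed
  also have "\<dots> = card H * ((?n - s) choose (m - s))" by simp
  finally have 1: "card {M. M \<subseteq> X \<and> card M = m \<and> (\<exists>S\<in>H. S \<subseteq> M)}
      \<le> card H * ((?n - s) choose (m - s))" .
  have pos: "0 < ?n choose s" "0 < ?n choose m" using assms by auto
  have "(2 * card H * ((?n - s) choose (m - s))) * (?n choose s)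
      = 2 * card H * (m choose s) * (?n choose m)"
    using choose_mult[OF assms(3,4)] by (simp add: mult_ac)
  also have "\<dots> < (?n choose s) * (?n choose m)"
    using few pos by simp
  finally have "2 * card H * ((?n - s) choose (m - s)) < ?n choose m"
    using pos by (simp add: mult.commute)
  with 1 show ?thesis by simp
qed

lemma exists_subset_avoiding:
  assumes "finite X" "m \<le> card X"
    and "\<And>S. S \<in> H \<Longrightarrow> S \<subseteq> X \<and> card S = s" "s \<le> m"
    and "2 * card H * (m choose s) < (card X choose s)"
    and "\<And>S. S \<in> B \<Longrightarrow> S \<subseteq> X \<and> card S = h" "h \<le> m"
    and "2 * card B * (m choose h) < (card X choose h)"
  shows "\<exists>M\<subseteq>X. card M = m \<and> (\<forall>S\<in>H. \<not> S \<subseteq> M) \<and> (\<forall>S\<in>B. \<not> S \<subseteq> M)"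
proof (rule ccontr)
  let ?A = "\<lambda>H. {M. M \<subseteq> X \<and> card M = m \<and> (\<exists>S\<in>H. S \<subseteq> M)}"
  assume "\<not> ?thesis"
  then have "{M. M \<subseteq> X \<and> card M = m} \<subseteq> ?A H \<union> ?A B" by auto
  moreover have "finite (?A H \<union> ?A B)" using assms(1) by - (rule finite_subset[of _ "Pow X"], auto)
  ultimately have "card {M. M \<subseteq> X \<and> card M = m} \<le> card (?A H) + card (?A B)"
    using card_mono card_Un_le order_trans by meson
  then have "card X choose m \<le> card (?A H) + card (?A B)"
    using n_subsets[OF assms(1)] by simp
  moreover have "2 * card (?A H) < (card X choose m)"
    using assms by (intro card_containing_le[where s = s]) auto
  moreover have "2 * card (?A B) < (card X choose m)"
    using assms by (intro card_containing_le[where s = h]) auto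
  ultimately show False by linarith
qed

text \<open>Each of the \<open>s\<close> factors of the falling factorial is at least
  \<open>n - d\<close>; keeping \<open>d\<close> apart from \<open>s\<close> fixes the base of the
  power during the induction.\<close>

lemma binomial_fact_ge: "s \<le> d \<Longrightarrow> (n - d) ^ s \<le> (n choose s) * fact s"
proof (induction s)
  case (Suc s)
  have "(n - d) ^ Suc s = (n - d) ^ s * (n - d)" by simp
  also have "\<dots> \<le> ((n choose s) * fact s) * (n - s)"
    using Suc by (intro mult_le_mono) auto
  also have "\<dots> = (n choose Suc s) * fact (Suc s)"
  proof -
    have "Suc s * (n choose Suc s) = (n - s) * (n choose s)"
      by (simp only: binomial_absorption binomial_absorb_comp)
    then show ?thesis unfolding fact_Suc by (metis mult.assoc mult.commute of_nat_id)
  qed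
  finally show ?case .
qed simp

lemma half_power_le_binomial:
  assumes "2 * s \<le> n"
  shows "(real n / 2) ^ s \<le> real (n choose s) * fact s"
proof -
  have "(real n / 2) ^ s \<le> real (n - s) ^ s"
    using assms by (intro power_mono) auto
  also have "\<dots> \<le> real ((n choose s) * fact s)"
    using binomial_fact_ge[of s s n] by (metis le_refl of_nat_le_iff of_nat_power)
  finally show ?thesis by simp
qed

lemma binomial_le_power_fact: "real (m choose s) * fact s \<le> real m ^ s"
  using binomial_fact_pow[of m s] by (metis of_nat_fact of_nat_le_iff of_nat_mult of_nat_power)

text \<open>If no large subset is \<open>b\<close>-restricted, then in \<open>E\<close> as well as
  in its complement every large subset has a vertex adjacent to a proportion \<open>b\<close> of it,
  which is what the container bound asks for. It leaves so few homogeneous sets of size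
  \<open>s\<close> that fewer than half of the \<open>m\<close>-subsets contain one. The family
  \<open>B\<close> stands for the copies of a pattern, to be avoided at the same time.\<close>

theorem sample_without_homogeneous:
  fixes E :: "'a \<Rightarrow> 'a \<Rightarrow> bool" and b :: real
  assumes fin: "finite X" and irr: "irreflp E" and m: "32 \<le> m" and b: "0 < b" "b \<le> 1"
    and s: "12 * ln (real m) / b + 2 \<le> real s" "s \<le> m"
    and n: "2 * real m ^ 5 \<le> real (card X)"
    and nores: "\<And>W. W \<subseteq> X \<Longrightarrow> real (card X) / real m ^ 5 \<le> real (card W) \<Longrightarrow> \<not> restricted_rel E b W"
    and B: "\<And>S. S \<in> B \<Longrightarrow> S \<subseteq> X \<and> card S = h" "h \<le> m"
    and few: "2 * real (card B) * real m ^ h < (real (card X) / 2) ^ h"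
  shows "\<exists>M\<subseteq>X. card M = m \<and> (\<forall>S\<subseteq>M. card S = s \<longrightarrow> \<not> homogeneous E S) \<and> (\<forall>S\<in>B. \<not> S \<subseteq> M)"
proof -
  define n where "n = card X"
  \<comment> \<open>\<open>R\<close> is about n / m^5, the size below which nothing is known about
    degrees. With this \<open>q\<close> the factor (1 - b)^q is at most m^(-6); the spare power of
    \<open>m\<close> pays for rounding \<open>R\<close> down. The hypothesis on \<open>s\<close>
    gives \<open>q \<le> s / 2\<close>, so at least half of each stable set is chosen among the last
    \<open>R\<close> candidates.\<close>
  define R where "R = nat \<lfloor>real n / real m ^ 5\<rfloor>"
  define q where "q = nat \<lceil>6 * ln (real m) / b\<rceil>"
  have m0: "0 < real m" using m by simp
  have m5: "real m ^ 5 \<ge> real m" using m by (simp add: power_increasing[of 1 5 "real m", simplified])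
  have n2m: "2 * real m ^ 5 \<le> real n" using n n_def by simp
  have mn: "2 * m \<le> n" using m5 n2m by linarith
  have lnm: "0 \<le> ln (real m)" using m by simp
  have R1: "real n / real m ^ 5 - 1 \<le> real R" "real R \<le> real n / real m ^ 5"
    unfolding R_def using m0 by (auto)
  have Rn: "R \<le> n"
  proof -
    have "real n / real m ^ 5 \<le> real n" using m m5 by (simp add: divide_le_eq mult_le_cancel_left1)
    then show ?thesis using R1 by linarith
  qed
  have q1: "6 * ln (real m) / b \<le> real q" "real q \<le> 6 * ln (real m) / b + 1"
    unfolding q_def using lnm b by auto
  have qs: "2 * q \<le> s" 
  proof -
    have "2 * real q \<le> real s" 
    proof -
      have "12 * ln (real m) / b = 2 * (6 * ln (real m) / b)" by simp
      then show ?thesis using q1(2) s(1) by linarith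
    qed
    then show ?thesis by (metis of_nat_le_iff of_nat_mult of_nat_numeral)
  qed
  have s1: "1 \<le> s"
  proof -
    have "0 \<le> 12 * ln (real m) / b" using lnm b by simp
    then show ?thesis using s(1) by linarith
  qed
  have decay: "(1 - b) ^ q * real n \<le> real R"
  proof -
    have "(1 - b) ^ q \<le> exp (- b) ^ q"
      using b exp_ge_add_one_self[of "- b"] by (intro power_mono) auto
    also have "\<dots> = exp (- (b * real q))" by (simp flip: exp_of_nat_mult add: mult.commute)
    also have "\<dots> \<le> exp (- (6 * ln (real m)))"
      using q1(1) b by (simp add: field_simps)
    also have "\<dots> = inverse (exp (ln (real m)) ^ 6)"
      by (simp add: exp_minus flip: exp_of_nat_mult)
    also have "\<dots> = 1 / real m ^ 6" using m0 by (simp add: inverse_eq_divide)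
    finally have "(1 - b) ^ q * real n \<le> 1 / real m ^ 6 * real n" by (rule mult_right_mono) simp
    also have "\<dots> = (real n / real m ^ 5) * (1 / real m)" by (simp add: power_numeral_reduce)
    also have "\<dots> \<le> (real n / real m ^ 5) * (1 / 2)"
      using m by (intro mult_left_mono) auto
    also have "\<dots> \<le> real n / real m ^ 5 - 1"
    proof -
      have "2 \<le> real n / real m ^ 5" using n2m m0 by (simp add: field_simps)
      then show ?thesis by simp
    qed
    finally show ?thesis using R1 by linarith
  qed
  have nolow: "\<not> low_degree E b W" "\<not> low_degree (co E) b W" if "W \<subseteq> X" "R < card W" for W
  proof -
    have "real n / real m ^ 5 \<le> real (card W)" using R1(1) that(2) by linarith
    then have "\<not> restricted_rel E b W" using nores that(1) n_def by simp
    then show "\<not> low_degree E b W" "\<not> low_degree (co E) b W" by (auto simp: restricted_rel_def)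
  qed
  have count: "real (card (stable_sets E' s X)) * fact s \<le> 2 ^ s * (real n ^ q * real R ^ (s - q))"
    if "E' = E \<or> E' = co E" for E'
  proof -
    have irr': "irreflp E'" using that irr irreflp_co by blast
    have "\<exists>x\<in>W. b * real (card W) \<le> real (card (nbhd E' x W))" if W: "W \<subseteq> X" "R < card W" for W
    proof -
      have "\<not> low_degree E' b W" using nolow[OF W] \<open>E' = E \<or> E' = co E\<close> by blast
      then show ?thesis unfolding low_degree_def by (meson less_imp_le not_le)
    qed
    then have hi: "\<And>W. W \<subseteq> X \<Longrightarrow> R < card W \<Longrightarrow> \<exists>x\<in>W. b * real (card W) \<le> real (card (nbhd E' x W))"
      by blast
    have qs': "q \<le> s" using qs by simp
    show ?thesis
      using card_stable_sets_bound[OF fin irr' less_imp_le[OF b(1)] b(2) hi decay[unfolded n_def] qs' Rn[unfolded n_def]]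
      by (simp only: n_def)
  qed
  define H where "H = stable_sets E s X \<union> stable_sets (co E) s X"
  \<comment> \<open>As \<open>s - q\<close> is at least s / 2, the exponent 5 saves more than m^(2 *
    s): a factor m^s is needed against \<open>m choose s\<close>, the other is the gain.\<close>
  have main: "real n ^ q * real R ^ (s - q) \<le> (real n / real m ^ 2) ^ s"
  proof -
    have "real n ^ q * real R ^ (s - q) \<le> real n ^ q * (real n / real m ^ 5) ^ (s - q)"
      using R1 by (intro mult_left_mono power_mono) auto
    also have "\<dots> = real n ^ s / real m ^ (5 * (s - q))"
      using qs by (simp add: power_divide power_mult flip: power_add)
    also have "\<dots> \<le> real n ^ s / real m ^ (2 * s)"
      using qs m by (intro divide_left_mono power_increasing) auto
    also have "\<dots> = (real n / real m ^ 2) ^ s" by (simp add: power_divide power_mult)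
    finally show ?thesis .
  qed
  have cH: "real (card H) * fact s \<le> 2 * (2 ^ s * (real n / real m ^ 2) ^ s)"
  proof -
    have "real (card H) \<le> real (card (stable_sets E s X)) + real (card (stable_sets (co E) s X))"
      unfolding H_def using card_Un_le of_nat_add of_nat_le_iff by metis
    then have "real (card H) * fact s
        \<le> (real (card (stable_sets E s X)) + real (card (stable_sets (co E) s X))) * fact s"
      by (rule mult_right_mono) simp
    also have "\<dots> \<le> 2 * (2 ^ s * (real n ^ q * real R ^ (s - q)))"
      using count[of E] count[of "co E"] by (simp add: algebra_simps)
    also have "\<dots> \<le> 2 * (2 ^ s * (real n / real m ^ 2) ^ s)" using main by simp
    finally show ?thesis .
  qed
  have fewH: "2 * card H * (m choose s) < (n choose s)"
  proof -
    \<comment> \<open>\<open>card H\<close> and \<open>m choose s\<close> are both estimated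
      together with a factor \<open>fact s\<close>, whereas \<open>n choose s\<close> supplies only
      one; the surplus factor is at least 1 and is given away.\<close>
    have f1: "(1::real) \<le> fact s" by (rule fact_ge_1)
    have "real (2 * card H * (m choose s)) * fact s * 1 \<le> real (2 * card H * (m choose s)) * fact s * fact s"
      using f1 by (intro mult_left_mono) simp_all
    then have "(real (2 * card H * (m choose s)) * fact s) \<le> real (2 * card H * (m choose s)) * fact s * fact s"
      by simp
    also have "\<dots> = (2 * (real (card H) * fact s)) * (real (m choose s) * fact s)" by (simp add: mult_ac)
    also have "\<dots> \<le> (2 * (2 * (2 ^ s * (real n / real m ^ 2) ^ s))) * real m ^ s"
      using cH binomial_le_power_fact[of m s] by (intro mult_mono[OF mult_left_mono]) simp_all
    also have "\<dots> = 4 * (2 * (real n / real m ^ 2) * real m) ^ s" unfolding power_mult_distrib by simp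
    also have "2 * (real n / real m ^ 2) * real m = 2 * real n / real m" using m0 by (simp add: power2_eq_square)
    \<comment> \<open>\<open>32 \<le> m\<close> leaves a factor 1/8 per element, which beats the
      constant 4 because \<open>s\<close> is at least 1.\<close>
    also have "4 * (2 * real n / real m) ^ s < (real n / 2) ^ s"
    proof -
      have "4 * (2 * real n / real m) ^ s \<le> 4 * (real n / 16) ^ s"
      proof (intro mult_left_mono power_mono)
        have "2 * real n / real m \<le> 2 * real n / 32" using m by (intro divide_left_mono) auto
        then show "2 * real n / real m \<le> real n / 16" by simp
      qed (use m0 in auto)
      also have "(real n / 16) ^ s = (real n / 2) ^ s * (1 / 8) ^ s"
        by (simp flip: power_mult_distrib)
      also have "4 * ((real n / 2) ^ s * (1 / 8) ^ s) \<le> 4 * ((real n / 2) ^ s * (1 / 8))"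
        using s1 power_decreasing[of 1 s "1/8 :: real"] by (intro mult_left_mono) auto
      also have "\<dots> < (real n / 2) ^ s" using mn m by simp
      finally show ?thesis .
    qed
    also have "(real n / 2) ^ s \<le> real (n choose s) * fact s"
      using mn s by (intro half_power_le_binomial) auto
    finally have "real (2 * card H * (m choose s)) < real (n choose s)" by simp
    then show ?thesis by (simp only: of_nat_less_iff)
  qed
  have fewB: "2 * card B * (m choose h) < (n choose h)"
  proof -
    have "real (2 * card B * (m choose h)) * fact h = 2 * real (card B) * (real (m choose h) * fact h)"
      by simp
    also have "\<dots> \<le> 2 * real (card B) * real m ^ h"
      using binomial_le_power_fact by (intro mult_left_mono) auto
    also have "\<dots> < (real n / 2) ^ h" using few n_def by simp
    also have "\<dots> \<le> real (n choose h) * fact h"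
      using mn B(2) by (intro half_power_le_binomial) auto
    finally have "real (2 * card B * (m choose h)) < real (n choose h)" by simp
    then show ?thesis by (simp only: of_nat_less_iff)
  qed
  have "\<exists>M\<subseteq>X. card M = m \<and> (\<forall>S\<in>H. \<not> S \<subseteq> M) \<and> (\<forall>S\<in>B. \<not> S \<subseteq> M)"
    using fin B s(2) fewH fewB mn unfolding n_def
    by (intro exists_subset_avoiding[where s = s and h = h]) (auto simp: H_def stable_sets_def)
  then obtain M where M: "M \<subseteq> X" "card M = m" "\<forall>S\<in>H. \<not> S \<subseteq> M" "\<forall>S\<in>B. \<not> S \<subseteq> M" by blast
  have "\<not> homogeneous E S" if "S \<subseteq> M" "card S = s" for S
    using M(1,3) that by (auto simp: H_def stable_sets_def homogeneous_def)
  with M show ?thesis by blast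
qed

subsection \<open>Greedy embedding and the theorem of Roedl\<close>

text \<open>Agreement is demanded at distinct vertices only, so the pattern \<open>P\<close> may be
  a plainly negated adjacency, which is true on the diagonal.\<close>

definition embeds :: "('a \<Rightarrow> 'a \<Rightarrow> bool) \<Rightarrow> ('b \<Rightarrow> 'b \<Rightarrow> bool) \<Rightarrow> 'b set \<Rightarrow> 'a set \<Rightarrow> bool" where
  "embeds E P V X \<longleftrightarrow> (\<exists>f. inj_on f V \<and> f ` V \<subseteq> X \<and>
     (\<forall>i\<in>V. \<forall>j\<in>V. i \<noteq> j \<longrightarrow> (E (f i) (f j) \<longleftrightarrow> P i j)))"

lemma embeds_mono: "embeds E P V Y \<Longrightarrow> Y \<subseteq> X \<Longrightarrow> embeds E P V X"
proof -
  assume "embeds E P V Y" and YX: "Y \<subseteq> X"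
  then obtain f where f: "inj_on f V" "f ` V \<subseteq> Y" "\<forall>i\<in>V. \<forall>j\<in>V. i \<noteq> j \<longrightarrow> (E (f i) (f j) \<longleftrightarrow> P i j)"
    unfolding embeds_def by auto
  show ?thesis
    unfolding embeds_def by (rule exI[of _ f], intro conjI f(1) f(3) subset_trans[OF f(2) YX])
qed

definition extreme_pair :: "('a \<Rightarrow> 'a \<Rightarrow> bool) \<Rightarrow> real \<Rightarrow> 'a set \<Rightarrow> 'a set \<Rightarrow> bool" where
  "extreme_pair E d A B \<longleftrightarrow>
     (\<forall>x\<in>A. real (card (nbhd E x B)) \<le> d * real (card B)) \<or>
     (\<forall>x\<in>A. real (card (nbhd (co E) x B)) \<le> d * real (card B))"

text \<open>The guard \<open>f i \<noteq> f j\<close> replaces injectivity: the candidate sets are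
  made disjoint only when the greedy embedding is applied, and the guard then always holds.\<close>

definition partial_embedding ::
  "('a \<Rightarrow> 'a \<Rightarrow> bool) \<Rightarrow> (nat \<Rightarrow> nat \<Rightarrow> bool) \<Rightarrow> nat \<Rightarrow> nat \<Rightarrow> (nat \<Rightarrow> 'a set) \<Rightarrow> (nat \<Rightarrow> 'a) \<Rightarrow> bool" where
  "partial_embedding E P a t C f \<longleftrightarrow> (\<forall>i\<in>{a..<t}. f i \<in> C i) \<and>
     (\<forall>i\<in>{a..<t}. \<forall>j\<in>{a..<t}. i < j \<longrightarrow> f i \<noteq> f j \<longrightarrow> (E (f i) (f j) \<longleftrightarrow> P i j))"

text \<open>The factor \<open>t\<close> on the side of \<open>A\<close> is the price of a pigeonhole
  argument: \<open>A\<close> consists of the vertices of one candidate set that are spoilt by one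
  and the same later index.\<close>

definition large_extreme_pair ::
  "('a \<Rightarrow> 'a \<Rightarrow> bool) \<Rightarrow> real \<Rightarrow> real \<Rightarrow> nat \<Rightarrow> nat \<Rightarrow> (nat \<Rightarrow> 'a set) \<Rightarrow> bool" where
  "large_extreme_pair E d L a t C \<longleftrightarrow> (\<exists>i j A B. i \<in> {a..<t} \<and> j \<in> {a..<t} \<and> i \<noteq> j \<and>
     A \<subseteq> C i \<and> B \<subseteq> C j \<and> L \<le> real t * real (card A) \<and> L \<le> real (card B) \<and> extreme_pair E d A B)"

text \<open>Embed greedily, keeping for every later vertex a candidate set; the embedding
  can only get stuck at a pair of large sets of extreme density.\<close>

lemma greedy_embedding:
  fixes C :: "nat \<Rightarrow> 'a set" and d L :: real
  assumes d: "0 < d" "d \<le> 1" and L: "0 < L"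
  shows "a + n = t \<Longrightarrow> \<forall>i\<in>{a..<t}. finite (C i) \<and> L \<le> d ^ n * real (card (C i)) \<Longrightarrow>
    (\<exists>f. partial_embedding E P a t C f) \<or> large_extreme_pair E d L a t C"
proof (induction n arbitrary: a C)
  case 0
  then show ?case by (auto simp: partial_embedding_def)
next
  case (Suc n)
  define Q where "Q x j = (if P a j then nbhd E x (C j) else nbhd (co E) x (C j))" for x j
  have at: "a \<in> {a..<t}" using Suc.prems(1) by auto
  have sub: "Q x j \<subseteq> C j" for x j by (auto simp: Q_def nbhd_def)
  have low: "L \<le> real (card (C i))" if "i \<in> {a..<t}" for i
  proof -
    have "L \<le> d ^ Suc n * real (card (C i))" using Suc.prems(2) that by blast
    also have "\<dots> \<le> 1 * real (card (C i))"
      using d power_le_one[of d "Suc n"] by (intro mult_right_mono) auto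
    finally show ?thesis by simp
  qed
  show ?case
  proof (cases "\<exists>x\<in>C a. \<forall>j\<in>{Suc a..<t}. d * real (card (C j)) \<le> real (card (Q x j))")
    case True
    then obtain x where x: "x \<in> C a" "\<forall>j\<in>{Suc a..<t}. d * real (card (C j)) \<le> real (card (Q x j))"
      by blast
    have prem: "\<forall>i\<in>{Suc a..<t}. finite (Q x i) \<and> L \<le> d ^ n * real (card (Q x i))"
    proof (intro ballI conjI)
      fix i assume i: "i \<in> {Suc a..<t}"
      then have i': "i \<in> {a..<t}" by auto
      then show "finite (Q x i)" using Suc.prems(2) sub[of x i] finite_subset by blast
      have "L \<le> d ^ Suc n * real (card (C i))" using Suc.prems(2) i' by blast
      then have "L \<le> d ^ n * (d * real (card (C i)))" by (simp add: mult_ac)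
      also have "\<dots> \<le> d ^ n * real (card (Q x i))" using x(2) i d by (intro mult_left_mono) auto
      finally show "L \<le> d ^ n * real (card (Q x i))" .
    qed
    have "Suc a + n = t" using Suc.prems(1) by simp
    note IH = Suc.IH[OF this prem]
    show ?thesis
    proof (cases "large_extreme_pair E d L (Suc a) t (Q x)")
      case True
      then obtain i j A B where ij: "i \<in> {Suc a..<t}" "j \<in> {Suc a..<t}" "i \<noteq> j" "A \<subseteq> Q x i" "B \<subseteq> Q x j"
        "L \<le> real t * real (card A)" "L \<le> real (card B)" "extreme_pair E d A B"
        unfolding large_extreme_pair_def by blast
      moreover have "i \<in> {a..<t}" "j \<in> {a..<t}" using ij(1,2) by simp_all
      moreover have "A \<subseteq> C i" by (rule subset_trans[OF ij(4) sub])
      moreover have "B \<subseteq> C j" by (rule subset_trans[OF ij(5) sub])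
      ultimately have "large_extreme_pair E d L a t C"
        unfolding large_extreme_pair_def by blast
      then show ?thesis ..
    next
      case False
      then obtain f where F: "partial_embedding E P (Suc a) t (Q x) f" using IH by blast
      define g where "g = f(a := x)"
      have ga: "g a = x" and gi: "\<And>i. i \<in> {Suc a..<t} \<Longrightarrow> g i = f i" by (auto simp: g_def)
      have split: "i = a \<or> i \<in> {Suc a..<t}" if "i \<in> {a..<t}" for i using that by auto
      have fQ: "f i \<in> Q x i" if "i \<in> {Suc a..<t}" for i
        using F that unfolding partial_embedding_def by blast
      have "partial_embedding E P a t C g"
        unfolding partial_embedding_def
      proof (intro conjI ballI impI)
        fix i assume "i \<in> {a..<t}"
        then show "g i \<in> C i" using split[of i] ga gi[of i] fQ[of i] sub[of x i] x(1) by auto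
      next
        fix i j assume i: "i \<in> {a..<t}" and j: "j \<in> {a..<t}" and ij: "i < j" and ne: "g i \<noteq> g j"
        have j': "j \<in> {Suc a..<t}" using i j ij by auto
        show "E (g i) (g j) \<longleftrightarrow> P i j"
        proof (cases "i = a")
          case True
          have "f j \<in> Q x j" by (rule fQ[OF j'])
          then show ?thesis using True ga gi[OF j'] ne
            by (cases "P a j") (simp_all add: Q_def nbhd_def co_def)
        next
          case False
          then have i': "i \<in> {Suc a..<t}" using i by auto
          then have "f i \<noteq> f j" using ne gi[OF i'] gi[OF j'] by simp
          then show ?thesis
            using F i' j' ij gi[OF i'] gi[OF j'] unfolding partial_embedding_def by simp
        qed
      qed
      then show ?thesis by blast
    qed
  next
    case False
    \<comment> \<open>No vertex of \<open>C a\<close> suits all later candidate sets, so the sets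
      \<open>A j\<close> cover \<open>C a\<close>; a largest one, together with the whole of
      \<open>C j\<close>, is the extreme pair.\<close>
    define A where "A j = {x \<in> C a. real (card (Q x j)) < d * real (card (C j))}" for j
    have Ca: "C a \<subseteq> (\<Union>j\<in>{Suc a..<t}. A j)"
    proof
      fix x assume "x \<in> C a"
      with False obtain j where "j \<in> {Suc a..<t}" "\<not> d * real (card (C j)) \<le> real (card (Q x j))" by blast
      then show "x \<in> (\<Union>j\<in>{Suc a..<t}. A j)" using \<open>x \<in> C a\<close> by (auto simp: A_def not_le)
    qed
    have finC: "finite (C a)" using Suc.prems(2) at by blast
    have finA: "finite (A j)" for j unfolding A_def using finC by simp
    have "\<exists>j\<in>{Suc a..<t}. L \<le> real t * real (card (A j))"
    proof (rule ccontr)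
      assume "\<not> ?thesis"
      then have lt: "real t * real (card (A j)) \<le> L" if "j \<in> {Suc a..<t}" for j
        using that by (meson less_imp_le not_le)
      have "card (C a) \<le> card (\<Union>j\<in>{Suc a..<t}. A j)"
        using Ca finA by (intro card_mono) auto
      also have "\<dots> \<le> (\<Sum>j\<in>{Suc a..<t}. card (A j))" by (rule card_UN_le) simp
      finally have "real t * real (card (C a)) \<le> real t * (\<Sum>j\<in>{Suc a..<t}. real (card (A j)))"
        by (intro mult_left_mono) (simp_all flip: of_nat_sum)
      also have "\<dots> = (\<Sum>j\<in>{Suc a..<t}. real t * real (card (A j)))" by (simp add: sum_distrib_left)
      also have "\<dots> \<le> (\<Sum>j\<in>{Suc a..<t}. L)" using lt by (rule sum_mono)
      also have "\<dots> = real (t - Suc a) * L" by simp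
      also have "\<dots> < real t * L" using L Suc.prems(1) by (intro mult_strict_right_mono) auto
      finally have "real (card (C a)) < L" by (simp add: mult_less_cancel_left)
      then show False using low[OF at] by linarith
    qed
    then obtain j where j: "j \<in> {Suc a..<t}" "L \<le> real t * real (card (A j))" by blast
    then have jt: "j \<in> {a..<t}" "a \<noteq> j" by auto
    have "extreme_pair E d (A j) (C j)"
      unfolding extreme_pair_def by (cases "P a j") (auto simp: A_def Q_def)
    moreover have "A j \<subseteq> C a" by (auto simp: A_def)
    ultimately have "large_extreme_pair E d L a t C"
      unfolding large_extreme_pair_def using at jt j(2) low[OF jt(1)] by blast
    then show ?thesis ..
  qed
qed

lemma disjoint_equal_parts:
  fixes X :: "'a set"
  assumes "finite X" "p * t \<le> card X"
  shows "\<exists>C. (\<forall>i<t. C i \<subseteq> X \<and> card (C i) = p) \<and> (\<forall>i<t. \<forall>j<t. i \<noteq> j \<longrightarrow> C i \<inter> C j = {})"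
proof -
  obtain g where g: "bij_betw g {0..<card X} X" using ex_bij_betw_nat_finite[OF assms(1)] by blast
  define I where "I i = {i * p..<i * p + p}" for i
  have I: "I i \<subseteq> {0..<card X}" if "i < t" for i
  proof -
    have "i * p + p \<le> p * t" using that by (metis Suc_leI add.commute mult.commute mult_Suc mult_le_mono1)
    then show ?thesis using assms(2) by (auto simp: I_def)
  qed
  have "I i \<inter> I j = {}" if "i < j" for i j
  proof -
    have "i * p + p \<le> j * p" using that by (metis Suc_leI add.commute mult_Suc mult_le_mono1)
    then show ?thesis by (auto simp: I_def)
  qed
  then have dis: "I i \<inter> I j = {}" if "i \<noteq> j" for i j using that by (metis Int_commute nat_neq_iff)
  have inj: "inj_on g {0..<card X}" and im: "g ` {0..<card X} = X" using g by (auto simp: bij_betw_def)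
  have "g ` I i \<subseteq> X \<and> card (g ` I i) = p" if "i < t" for i
    using I[OF that] inj im by (auto simp: card_image inj_on_subset I_def)
  moreover have "g ` I i \<inter> g ` I j = {}" if "i < t" "j < t" "i \<noteq> j" for i j
    using inj_on_image_Int[OF inj I[OF that(1)] I[OF that(2)]] dis[OF that(3)] by simp
  ultimately show ?thesis by (intro exI[of _ "\<lambda>i. g ` I i"]) blast
qed

text \<open>The greedy embedding is run with \<open>t\<close> disjoint candidate sets of equal size,
  which makes it injective. The factors 2 are due to rounding: as \<open>t \<le> card X\<close>,
  parts of size \<open>card X div t\<close> cover at least half of \<open>X\<close>.\<close>

lemma embedding_or_extreme_pair:
  fixes X :: "'a set" and d :: real
  assumes "finite X" "symp E" and P: "\<And>i j. P i j \<longleftrightarrow> P j i" and "\<not> embeds E P {..<t} X"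
    and d: "0 < d" "d \<le> 1" and t: "1 \<le> t" "t \<le> card X"
  shows "\<exists>A\<subseteq>X. \<exists>B\<subseteq>X. A \<inter> B = {} \<and>
    d ^ t * real (card X) \<le> 2 * real t ^ 2 * real (card A) \<and> d ^ t * real (card X) \<le> 2 * real t * real (card B) \<and>
    extreme_pair E d A B"
proof -
  define p where "p = card X div t"
  have "p * t \<le> card X" by (simp add: p_def)
  then obtain C where C: "\<And>i. i < t \<Longrightarrow> C i \<subseteq> X \<and> card (C i) = p"
    "\<And>i j. i < t \<Longrightarrow> j < t \<Longrightarrow> i \<noteq> j \<Longrightarrow> C i \<inter> C j = {}"
    using disjoint_equal_parts[OF assms(1)] by metis
  have "card X = p * t + card X mod t" by (simp add: p_def)
  moreover have "card X mod t < t" using t by simp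
  moreover have "1 * t \<le> p * t"
    unfolding p_def using t by (intro mult_le_mono1) (simp add: div_greater_zero_iff Suc_leI)
  ultimately have "card X \<le> 2 * (p * t)" by linarith
  then have "real (card X) \<le> real (2 * (p * t))" by (rule of_nat_mono)
  then have cX: "real (card X) \<le> 2 * real t * real p" by (simp add: mult_ac)
  define L where "L = d ^ t * real (card X) / (2 * real t)"
  have L0: "0 < L" using d t by (simp add: L_def)
  have Lp: "L \<le> d ^ t * real p"
    unfolding L_def using cX t d by (simp add: field_simps)
  have prem: "\<forall>i\<in>{0..<t}. finite (C i) \<and> L \<le> d ^ t * real (card (C i))"
    using C(1) Lp assms(1) finite_subset by (metis atLeastLessThan_iff)
  have cases: "(\<exists>f. partial_embedding E P 0 t C f) \<or> large_extreme_pair E d L 0 t C"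
    by (rule greedy_embedding[OF d L0 _ prem]) simp
  show ?thesis
  proof (cases "large_extreme_pair E d L 0 t C")
    case False
    then obtain f where F: "partial_embedding E P 0 t C f" using cases by blast
    have f1: "f i \<in> C i" if "i < t" for i
      using F that by (simp add: partial_embedding_def)
    have inj: "inj_on f {..<t}"
    proof (rule inj_onI)
      fix i j assume ij: "i \<in> {..<t}" "j \<in> {..<t}" "f i = f j"
      then have "f i \<in> C i \<inter> C j" using f1[of i] f1[of j] by simp
      then show "i = j" using C(2)[of i j] ij by auto
    qed
    have "E (f i) (f j) \<longleftrightarrow> P i j" if "i < t" "j < t" "i \<noteq> j" for i j
    proof -
      have ne: "f i \<noteq> f j" using inj that by (auto dest: inj_onD)
      show ?thesis
      proof (cases "i < j")
        case True then show ?thesis using F that ne by (simp add: partial_embedding_def)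
      next
        case False
        then have "E (f j) (f i) \<longleftrightarrow> P j i" using F that ne[symmetric] by (simp add: partial_embedding_def)
        then show ?thesis using P assms(2) by (meson sympD)
      qed
    qed
    moreover have "f ` {..<t} \<subseteq> X"
    proof
      fix y assume "y \<in> f ` {..<t}"
      then obtain i where "i < t" "y = f i" by auto
      then show "y \<in> X" using f1[of i] C(1)[of i] by blast
    qed
    ultimately have "embeds E P {..<t} X" unfolding embeds_def using inj by auto
    with assms(4) show ?thesis by blast
  next
    case True
    then obtain i j A B where ij: "i < t" "j < t" "i \<noteq> j" "A \<subseteq> C i" "B \<subseteq> C j"
      and AB: "L \<le> real t * real (card A)" "L \<le> real (card B)" "extreme_pair E d A B"
      unfolding large_extreme_pair_def by auto
    have "A \<subseteq> X" "B \<subseteq> X" "A \<inter> B = {}"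
      using ij C(1)[of i] C(1)[of j] C(2)[of i j] by auto
    moreover have "d ^ t * real (card X) \<le> 2 * real t ^ 2 * real (card A)"
      using AB(1) t unfolding L_def by (simp add: field_simps power2_eq_square)
    moreover have "d ^ t * real (card X) \<le> 2 * real t * real (card B)"
      using AB(2) t unfolding L_def by (simp add: field_simps)
    ultimately show ?thesis using AB(3) by blast
  qed
qed

section \<open>Homogeneous sets of size exp (c * sqrt (ln n)) when a pattern is excluded\<close>

definition weakEH_bound :: "nat \<Rightarrow> nat \<Rightarrow> nat" where
  "weakEH_bound t d = 2 ^ (4 * t * (d + 2) ^ 2)"

text \<open>This recursion dictates the formula for \<open>weakEH_bound\<close>: the logarithm of
  the factor lost in a step is linear in \<open>d\<close>, so the exponent has to be quadratic in
  \<open>d\<close>.\<close>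

lemma weakEH_bound_Suc:
  assumes "1 \<le> t"
  shows "4 * real t ^ 2 * 2 ^ ((d + 2) * t) * real (weakEH_bound t d) \<le> real (weakEH_bound t (Suc d))"
proof -
  have "real t \<le> 2 ^ t" by (simp add: of_nat_less_two_power less_imp_le)
  then have "real t ^ 2 \<le> (2 ^ t) ^ 2" by (intro power_mono) auto
  then have "4 * real t ^ 2 * 2 ^ ((d + 2) * t) * real (weakEH_bound t d)
      \<le> 2 ^ 2 * (2 ^ t) ^ 2 * 2 ^ ((d + 2) * t) * 2 ^ (4 * t * (d + 2) ^ 2)"
    unfolding weakEH_bound_def by (intro mult_mono) auto
  also have "\<dots> = 2 ^ (2 + t * 2 + (d + 2) * t + 4 * t * (d + 2) ^ 2)"
    by (simp only: power_add power_mult)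
  also have "\<dots> \<le> 2 ^ (4 * t * (Suc d + 2) ^ 2)"
  proof (rule power_increasing)
    have "2 + t * 2 + (d + 2) * t \<le> 4 * t * (2 * d + 5)" using assms by (simp add: algebra_simps)
    then show "2 + t * 2 + (d + 2) * t + 4 * t * (d + 2) ^ 2 \<le> 4 * t * (Suc d + 2) ^ 2"
      by (simp add: algebra_simps power2_eq_square)
  qed simp
  finally show ?thesis by (simp add: weakEH_bound_def)
qed

lemma card_UN_nbhd_le:
  fixes D B :: "'a set"
  assumes "finite D" "finite B" "\<And>x. x \<in> D \<Longrightarrow> real (card (nbhd E x B)) \<le> c"
  shows "real (card (\<Union>x\<in>D. nbhd E x B)) \<le> real (card D) * c"
proof -
  have "real (card (\<Union>x\<in>D. nbhd E x B)) \<le> (\<Sum>x\<in>D. real (card (nbhd E x B)))"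
    using card_UN_le[OF assms(1), of "\<lambda>x. nbhd E x B"] by (simp flip: of_nat_sum)
  also have "\<dots> \<le> (\<Sum>x\<in>D. c)" using assms(3) by (rule sum_mono)
  finally show ?thesis by simp
qed

text \<open>The product of a clique number and a stability number doubles at each stage, as it does
  for the disjoint union or the join of two cographs.\<close>

lemma clique_stable_product:
  fixes X :: "'a set"
  assumes "finite X" "symp E" "irreflp E" and P: "\<And>i j. P i j \<longleftrightarrow> P j i" and t: "1 \<le> t"
    and "\<not> embeds E P {..<t} X" "weakEH_bound t d \<le> card X"
  shows "\<exists>Q\<subseteq>X. \<exists>S\<subseteq>X. edgeless (co E) Q \<and> edgeless E S \<and> 2 ^ d \<le> card Q * card S \<and> card Q \<le> 2 ^ d \<and> card S \<le> 2 ^ d"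
  using assms(1,6,7)
proof (induction d arbitrary: X)
  case 0
  then have "X \<noteq> {}" by (auto simp: weakEH_bound_def)
  then obtain x where "x \<in> X" by blast
  then show ?case
    using assms(3) by (intro exI[of _ "{x}"]) (auto simp: edgeless_def co_def irreflp_def)
next
  case (Suc d)
  \<comment> \<open>The set \<open>D\<close> below has at most 2 * 2^d vertices, and with this
    \<open>c\<close> their neighbourhoods cover at most half of \<open>B\<close>. To bound the size
    of \<open>D\<close>, the induction carries upper bounds on both \<open>card Q\<close> and
    \<open>card S\<close>.\<close>
  define c :: real where "c = 1 / 2 ^ (d + 2)"
  have "(1::real) \<le> 2 ^ (d + 2)" by (rule one_le_power) simp
  then have c: "0 < c" "c \<le> 1" unfolding c_def by (simp_all add: divide_le_eq_1)
  have ct: "c ^ t = 1 / 2 ^ ((d + 2) * t)" by (simp only: c_def power_divide power_one power_mult)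
  have big: "4 * real t ^ 2 * 2 ^ ((d + 2) * t) * real (weakEH_bound t d) \<le> real (card X)"
    using weakEH_bound_Suc[OF t, of d] Suc.prems(3) by linarith
  then have big': "4 * real t ^ 2 * real (weakEH_bound t d) \<le> c ^ t * real (card X)"
    by (simp add: ct field_simps)
  have tX: "t \<le> card X"
  proof -
    have "real t * 1 \<le> real t * real t" using t by (intro mult_left_mono) auto
    then have a: "real t \<le> 4 * real t ^ 2" by (simp add: power2_eq_square)
    have w: "1 \<le> real (weakEH_bound t d)" by (simp add: weakEH_bound_def)
    have p: "(1::real) \<le> 2 ^ ((d + 2) * t)" by (rule one_le_power) simp
    have "1 * 1 \<le> 2 ^ ((d + 2) * t) * real (weakEH_bound t d)"
      using p w by (rule mult_mono) simp_all
    then have "real t * 1 \<le> (4 * real t ^ 2) * (2 ^ ((d + 2) * t) * real (weakEH_bound t d))"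
      using a by (intro mult_mono) simp_all
    then have "real t \<le> 4 * real t ^ 2 * 2 ^ ((d + 2) * t) * real (weakEH_bound t d)"
      by (simp add: mult.assoc)
    then show ?thesis using big by linarith
  qed
  obtain A B where AB: "A \<subseteq> X" "B \<subseteq> X" "A \<inter> B = {}"
    "c ^ t * real (card X) \<le> 2 * real t ^ 2 * real (card A)" "c ^ t * real (card X) \<le> 2 * real t * real (card B)"
    "extreme_pair E c A B"
    using embedding_or_extreme_pair[OF Suc.prems(1) assms(2) P Suc.prems(2) c t tX] by blast
  have t2: "0 < real t ^ 2" using t by simp
  have fin: "finite A" "finite B"
    by (rule finite_subset[OF AB(1) Suc.prems(1)], rule finite_subset[OF AB(2) Suc.prems(1)])
  have "(2 * real t ^ 2) * (2 * real (weakEH_bound t d)) \<le> (2 * real t ^ 2) * real (card A)"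
    using order_trans[OF big' AB(4)] by (simp only: mult_ac)
  then have "2 * real (weakEH_bound t d) \<le> real (card A)"
    using t2 by (subst (asm) mult_le_cancel_left_pos) auto
  then have cA: "weakEH_bound t d \<le> card A" by linarith
  have "(2 * real t) * (2 * real t * real (weakEH_bound t d)) \<le> (2 * real t) * real (card B)"
    using big' AB(5) by (simp add: power2_eq_square mult_ac)
  then have "2 * real t * real (weakEH_bound t d) \<le> real (card B)"
    using t by (subst (asm) mult_le_cancel_left_pos) auto
  moreover have "2 * 1 * real (weakEH_bound t d) \<le> 2 * real t * real (weakEH_bound t d)"
    using t by (intro mult_right_mono) auto
  ultimately have cB: "2 * real (weakEH_bound t d) \<le> real (card B)" by linarith
  have emb: "\<not> embeds E P {..<t} Y" if "Y \<subseteq> X" for Y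
    using Suc.prems(2) embeds_mono[OF _ that] by blast
  obtain Q1 S1 where 1: "Q1 \<subseteq> A" "S1 \<subseteq> A" "edgeless (co E) Q1" "edgeless E S1"
    "2 ^ d \<le> card Q1 * card S1" "card Q1 \<le> 2 ^ d" "card S1 \<le> 2 ^ d"
    using Suc.IH[OF fin(1) emb[OF AB(1)] cA] by blast
  define D where "D = Q1 \<union> S1"
  have D: "D \<subseteq> A" "finite D"
    using 1(1,2) finite_subset[OF 1(1) fin(1)] finite_subset[OF 1(2) fin(1)] by (simp_all add: D_def)
  have "card D \<le> 2 ^ d + 2 ^ d" unfolding D_def using card_Un_le[of Q1 S1] 1(6,7) by linarith
  then have "real (card D) \<le> real (2 ^ d + 2 ^ d)" by (rule of_nat_mono)
  then have cD: "real (card D) \<le> 2 * 2 ^ d" by simp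
  have key: "\<exists>E'\<in>{E, co E}. \<exists>Q2\<subseteq>B. \<exists>S2\<subseteq>B. edgeless (co E) Q2 \<and> edgeless E S2 \<and> 2 ^ d \<le> card Q2 * card S2 \<and>
      card Q2 \<le> 2 ^ d \<and> card S2 \<le> 2 ^ d \<and> (\<forall>x\<in>D. \<forall>y\<in>Q2 \<union> S2. \<not> E' x y)"
  proof -
    obtain E' where E': "E' \<in> {E, co E}" "\<forall>x\<in>A. real (card (nbhd E' x B)) \<le> c * real (card B)"
      using AB(6) unfolding extreme_pair_def by blast
    \<comment> \<open>The sets in \<open>B\<close> are sought only after those in \<open>A\<close>
      are known, among the vertices of \<open>B\<close> that have no \<open>E'\<close>-neighbour in
      \<open>D\<close>. An extreme pair bounds degrees from \<open>A\<close> to \<open>B\<close>,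
      and this order needs no more than that.\<close>
    define B' where "B' = B - (\<Union>x\<in>D. nbhd E' x B)"
    have sub: "(\<Union>x\<in>D. nbhd E' x B) \<subseteq> B" by (auto simp: nbhd_def)
    have "real (card (\<Union>x\<in>D. nbhd E' x B)) \<le> real (card D) * (c * real (card B))"
      using E'(2) D fin by (intro card_UN_nbhd_le) auto
    also have "\<dots> \<le> (2 * 2 ^ d) * (c * real (card B))"
      using cD c by (intro mult_right_mono) auto
    also have "\<dots> = real (card B) / 2" by (simp add: c_def)
    finally have "real (card B) / 2 \<le> real (card B')"
      unfolding B'_def using sub fin card_mono[OF fin(2) sub]
      by (subst card_Diff_subset) (auto intro: finite_subset)
    then have "weakEH_bound t d \<le> card B'" using cB by linarith
    moreover have "finite B'" "B' \<subseteq> B" using fin by (auto simp: B'_def)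
    ultimately obtain Q2 S2 where 2: "Q2 \<subseteq> B'" "S2 \<subseteq> B'" "edgeless (co E) Q2" "edgeless E S2"
      "2 ^ d \<le> card Q2 * card S2" "card Q2 \<le> 2 ^ d" "card S2 \<le> 2 ^ d"
      using Suc.IH[OF _ emb[of B']] AB(2) by (meson subset_trans)
    have "\<forall>x\<in>D. \<forall>y\<in>Q2 \<union> S2. \<not> E' x y"
      using 2(1,2) by (auto simp: B'_def nbhd_def)
    moreover have "Q2 \<subseteq> B" "S2 \<subseteq> B" using 2(1,2) \<open>B' \<subseteq> B\<close> by simp_all
    ultimately show ?thesis using 2(3-7) E'(1) by blast
  qed
  then obtain E' Q2 S2 where E': "E' = E \<or> E' = co E" and 2: "Q2 \<subseteq> B" "S2 \<subseteq> B"
    "edgeless (co E) Q2" "edgeless E S2" "2 ^ d \<le> card Q2 * card S2" "card Q2 \<le> 2 ^ d" "card S2 \<le> 2 ^ d"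
    and no: "\<And>x y. x \<in> D \<Longrightarrow> y \<in> Q2 \<union> S2 \<Longrightarrow> \<not> E' x y"
    by blast
  have finQS: "finite Q1" "finite S1" "finite Q2" "finite S2"
    using finite_subset[OF 1(1) fin(1)] finite_subset[OF 1(2) fin(1)]
      finite_subset[OF 2(1) fin(2)] finite_subset[OF 2(2) fin(2)] by simp_all
  have prod: "2 ^ Suc d \<le> max a1 a2 * (b1 + b2)" "max a1 a2 \<le> 2 ^ Suc d" "b1 + b2 \<le> 2 ^ Suc d"
    if "2 ^ d \<le> a1 * b1" "2 ^ d \<le> a2 * b2" "a1 \<le> 2 ^ d" "a2 \<le> 2 ^ d" "b1 \<le> 2 ^ d" "b2 \<le> 2 ^ d"
    for a1 a2 b1 b2 :: nat
  proof -
    have "a1 * b1 \<le> max a1 a2 * b1" "a2 * b2 \<le> max a1 a2 * b2" by (rule mult_le_mono1, simp)+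
    then have "2 ^ d + 2 ^ d \<le> max a1 a2 * b1 + max a1 a2 * b2" using that(1,2) by linarith
    then show "2 ^ Suc d \<le> max a1 a2 * (b1 + b2)" by (simp only: distrib_left power_Suc mult_2)
  qed (use that in auto)
  have disj: "Q1 \<inter> Q2 = {}" "S1 \<inter> S2 = {}" using 1 2 AB(3) by blast+
  have symE': "symp E'" using E' assms(2) symp_co by blast
  have un: "edgeless E' (T1 \<union> T2)" if "edgeless E' T1" "edgeless E' T2" "T1 \<subseteq> D" "T2 \<subseteq> Q2 \<union> S2" for T1 T2
    using that no symE' unfolding edgeless_def by (blast dest: sympD)
  show ?case
  proof (cases "E' = E")
    case True
    define Q where "Q = (if card Q2 \<le> card Q1 then Q1 else Q2)"
    have cQ: "card Q = max (card Q1) (card Q2)" by (auto simp: Q_def)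
    have cS: "card (S1 \<union> S2) = card S1 + card S2" using finQS disj by (intro card_Un_disjoint) auto
    have "edgeless E (S1 \<union> S2)" using un[of S1 S2] True 1 2 by (auto simp: D_def)
    moreover have "edgeless (co E) Q" using 1 2 by (auto simp: Q_def)
    moreover have "Q \<subseteq> X" "S1 \<union> S2 \<subseteq> X" using 1 2 AB by (auto simp: Q_def)
    ultimately show ?thesis
      using prod[OF 1(5) 2(5) 1(6) 2(6) 1(7) 2(7)] cQ cS by metis
  next
    case False
    then have Eco: "E' = co E" using E' by blast
    define S where "S = (if card S2 \<le> card S1 then S1 else S2)"
    have cS: "card S = max (card S1) (card S2)" by (auto simp: S_def)
    have cQ: "card (Q1 \<union> Q2) = card Q1 + card Q2" using finQS disj by (intro card_Un_disjoint) auto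
    have "edgeless (co E) (Q1 \<union> Q2)" using un[of Q1 Q2] Eco 1 2 by (auto simp: D_def)
    moreover have "edgeless E S" using 1 2 by (auto simp: S_def)
    moreover have "S \<subseteq> X" "Q1 \<union> Q2 \<subseteq> X" using 1 2 AB by (auto simp: S_def)
    moreover have "2 ^ d \<le> card S1 * card Q1" "2 ^ d \<le> card S2 * card Q2" using 1(5) 2(5) by (auto simp: mult.commute)
    ultimately show ?thesis
      using prod[of "card S1" "card Q1" "card S2" "card Q2"] 1(6,7) 2(6,7) cQ cS by (metis mult.commute)
  qed
qed

lemma weak_Erdos_Hajnal:
  fixes X :: "'a set"
  assumes "finite X" "symp E" "irreflp E" and P: "\<And>i j. P i j \<longleftrightarrow> P j i" and t: "1 \<le> t"
    and "\<not> embeds E P {..<t} X" "weakEH_bound t (2 * e) \<le> card X"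
  shows "\<exists>S\<subseteq>X. card S = 2 ^ e \<and> homogeneous E S"
proof -
  obtain Q S where QS: "Q \<subseteq> X" "S \<subseteq> X" "edgeless (co E) Q" "edgeless E S" "2 ^ (2 * e) \<le> card Q * card S"
    using clique_stable_product[OF assms] by blast
  have "2 ^ e \<le> card Q \<or> 2 ^ e \<le> card S"
  proof (rule ccontr)
    assume "\<not> ?thesis"
    then have "card Q * card S < 2 ^ e * 2 ^ e" by (intro mult_strict_mono) auto
    then show False using QS(5) by (simp add: power_mult power2_eq_square mult_2 power_add)
  qed
  then obtain T where T: "T \<subseteq> X" "homogeneous E T" "2 ^ e \<le> card T"
    using QS unfolding homogeneous_def by blast
  obtain T' where "T' \<subseteq> T" "card T' = 2 ^ e" using obtain_subset_with_card_n[OF T(3)] by metis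
  then show ?thesis using T homogeneous_mono by blast
qed

text \<open>If no large subset is restricted, a random subset of constant size \<open>m\<close> has
  no homogeneous subset of size \<open>s\<close>, where \<open>s\<close> need only exceed a multiple
  of ln m / b. But the pattern is excluded there as well, and the weak Erdos-Hajnal bound gives a
  homogeneous set of size exp (c * sqrt (ln m)), which is larger for large \<open>m\<close>. All
  constants depend on \<open>b\<close> and \<open>t\<close> only.\<close>

theorem Roedl:
  fixes b :: real and P :: "nat \<Rightarrow> nat \<Rightarrow> bool"
  assumes b: "0 < b" "b \<le> 1" and P: "\<And>i j. P i j \<longleftrightarrow> P j i" and t: "1 \<le> t"
  shows "\<exists>c>0. \<exists>N. \<forall>E (X :: 'a set). finite X \<and> symp E \<and> irreflp E \<and> \<not> embeds E P {..<t} X \<and> N \<le> real (card X)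
    \<longrightarrow> (\<exists>W\<subseteq>X. c * real (card X) \<le> real (card W) \<and> restricted_rel E b W)"
proof -
  \<comment> \<open>Chosen such that \<open>K * (2 * real e + 2) ^ 2\<close> equals
    \<open>12 * ln m / b\<close> for the \<open>m\<close> below: quadratic in \<open>e\<close>, to
    be beaten by \<open>s = 2 ^ e\<close>.\<close>
  define K where "K = 12 * ln 2 * 4 * real t / b"
  have "eventually (\<lambda>e::nat. K * (2 * real e + 2) ^ 2 + 2 \<le> 2 ^ e) at_top"
    by real_asymp
  then obtain e where e: "K * (2 * real e + 2) ^ 2 + 2 \<le> 2 ^ e"
    by (meson eventually_at_top_linorder order_refl)
  define m where "m = weakEH_bound t (2 * e)"
  define s :: nat where "s = 2 ^ e"
  have lnm: "ln (real m) = 4 * real t * (2 * real e + 2) ^ 2 * ln 2"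
    by (simp add: m_def weakEH_bound_def ln_realpow algebra_simps)
  have s1: "12 * ln (real m) / b + 2 \<le> real s"
    using e unfolding lnm K_def s_def by (simp add: mult_ac)
  have m32: "32 \<le> m"
  proof -
    have "(2::nat) ^ 5 \<le> 2 ^ (4 * t * (2 * e + 2) ^ 2)"
    proof (rule power_increasing)
      have "4 * 1 * 2 ^ 2 \<le> 4 * t * (2 * e + 2) ^ 2" using t by (intro mult_le_mono power_mono) auto
      then show "5 \<le> 4 * t * (2 * e + 2) ^ 2" by simp
    qed simp
    then show ?thesis by (simp add: m_def weakEH_bound_def)
  qed
  have sm: "s \<le> m"
  proof -
    have "e \<le> 1 * (2 * e + 2) ^ 2" by (simp add: power2_eq_square)
    also have "\<dots> \<le> 4 * t * (2 * e + 2) ^ 2" using t by (intro mult_le_mono) auto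
    finally show ?thesis by (auto simp: s_def m_def weakEH_bound_def intro: power_increasing)
  qed
  have "0 < 1 / real m ^ 5" using m32 by simp
  moreover have "\<forall>E (X :: 'a set). finite X \<and> symp E \<and> irreflp E \<and> \<not> embeds E P {..<t} X \<and> 2 * real m ^ 5 \<le> real (card X)
    \<longrightarrow> (\<exists>W\<subseteq>X. 1 / real m ^ 5 * real (card X) \<le> real (card W) \<and> restricted_rel E b W)"
  proof (intro allI impI)
    fix E :: "'a \<Rightarrow> 'a \<Rightarrow> bool" and X
    assume *: "finite X \<and> symp E \<and> irreflp E \<and> \<not> embeds E P {..<t} X \<and> 2 * real m ^ 5 \<le> real (card X)"
    show "\<exists>W\<subseteq>X. 1 / real m ^ 5 * real (card X) \<le> real (card W) \<and> restricted_rel E b W"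
    proof (rule ccontr)
      assume "\<not> ?thesis"
      then have no: "\<And>W. W \<subseteq> X \<Longrightarrow> real (card X) / real m ^ 5 \<le> real (card W) \<Longrightarrow> \<not> restricted_rel E b W"
        by auto
      have "0 < 2 * real m ^ 5" using m32 by simp
      then have X0: "0 < real (card X)" using * by linarith
      have "\<exists>M\<subseteq>X. card M = m \<and> (\<forall>S\<subseteq>M. card S = s \<longrightarrow> \<not> homogeneous E S) \<and> (\<forall>S\<in>{}. \<not> S \<subseteq> M)"
        by (rule sample_without_homogeneous[where B = "{}" and h = 1 and b = b])
          (use * m32 b s1 sm no X0 in auto)
      then obtain M where M: "M \<subseteq> X" "card M = m" "\<And>S. S \<subseteq> M \<Longrightarrow> card S = s \<Longrightarrow> \<not> homogeneous E S"
        by blast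
      have finM: "finite M" using * M(1) finite_subset by blast
      have "\<not> embeds E P {..<t} M" using * M(1) embeds_mono by blast
      then have "\<exists>S\<subseteq>M. card S = 2 ^ e \<and> homogeneous E S"
        using weak_Erdos_Hajnal[where X = M and E = E and P = P and t = t and e = e, OF _ _ _ P t] * M finM by (auto simp: m_def)
      then show False using M(3) by (auto simp: s_def)
    qed
  qed
  ultimately show ?thesis by blast
qed

subsection \<open>Combs in bipartite graphs\<close>

lemma double_count:
  assumes "finite A" "finite B"
  shows "(\<Sum>a\<in>A. card (nbhd E a B)) = (\<Sum>b\<in>B. card {a \<in> A. E a b})"
proof -
  have 1: "card (nbhd E a B) = (\<Sum>b\<in>B. if E a b then 1 else 0)" for a
    unfolding nbhd_def using assms(2) by (simp add: sum.If_cases Int_def)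
  have 2: "card {a \<in> A. E a b} = (\<Sum>a\<in>A. if E a b then 1 else 0)" for b
    using assms(1) by (simp add: sum.If_cases Int_def)
  show ?thesis unfolding 1 2 by (rule sum.swap)
qed

lemma averaging_colours:
  fixes w :: "nat \<Rightarrow> real"
  assumes "finite I" "\<And>i. i \<in> I \<Longrightarrow> col i < R" "0 < R"
  shows "\<exists>c<R. real R * (\<Sum>i | i \<in> I \<and> col i = c. w i) \<le> (\<Sum>i\<in>I. w i)"
    and "\<exists>c<R. (\<Sum>i\<in>I. w i) \<le> real R * (\<Sum>i | i \<in> I \<and> col i = c. w i)"
proof -
  have tot: "(\<Sum>c<R. \<Sum>i | i \<in> I \<and> col i = c. w i) = (\<Sum>i\<in>I. w i)"
    using assms by (intro sum.group) auto
  show "\<exists>c<R. real R * (\<Sum>i | i \<in> I \<and> col i = c. w i) \<le> (\<Sum>i\<in>I. w i)"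
  proof (rule ccontr)
    assume "\<not> ?thesis"
    then have "(\<Sum>c<R. (\<Sum>i\<in>I. w i)) < (\<Sum>c<R. real R * (\<Sum>i | i \<in> I \<and> col i = c. w i))"
      using assms(3) by (intro sum_strict_mono) (auto simp: not_le)
    then show False by (simp add: tot flip: sum_distrib_left)
  qed
  show "\<exists>c<R. (\<Sum>i\<in>I. w i) \<le> real R * (\<Sum>i | i \<in> I \<and> col i = c. w i)"
  proof (rule ccontr)
    assume "\<not> ?thesis"
    then have "(\<Sum>c<R. real R * (\<Sum>i | i \<in> I \<and> col i = c. w i)) < (\<Sum>c<R. (\<Sum>i\<in>I. w i))"
      using assms(3) by (intro sum_strict_mono) (auto simp: not_le)
    then show False by (simp add: tot flip: sum_distrib_left)
  qed
qed

text \<open>Indices are coloured in increasing order, each with a colour whose earlier members carry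
  the least weight \<open>x j\<close>, at most a share 1/R. The condition on \<open>j\<close>
  mentions only earlier indices, so later choices do not disturb it.\<close>

lemma greedy_colouring:
  fixes x :: "nat \<Rightarrow> nat \<Rightarrow> real"
  assumes R: "0 < R"
  shows "\<exists>col. (\<forall>i. col i < R) \<and>
    (\<forall>j<n. real R * (\<Sum>i | i \<in> {a..<j} \<and> col i = col j. x j i) \<le> (\<Sum>i\<in>{a..<j}. x j i))"
proof (induction n)
  case 0
  show ?case using R by (intro exI[of _ "\<lambda>_. 0"]) auto
next
  case (Suc n)
  then obtain col where col: "\<forall>i. col i < R"
    "\<forall>j<n. real R * (\<Sum>i | i \<in> {a..<j} \<and> col i = col j. x j i) \<le> (\<Sum>i\<in>{a..<j}. x j i)" by blast
  obtain c where c: "c < R" "real R * (\<Sum>i | i \<in> {a..<n} \<and> col i = c. x n i) \<le> (\<Sum>i\<in>{a..<n}. x n i)"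
    using averaging_colours(1)[of "{a..<n}" col R "x n"] col(1) R by auto
  define col' where "col' = col(n := c)"
  have "real R * (\<Sum>i | i \<in> {a..<j} \<and> col' i = col' j. x j i) \<le> (\<Sum>i\<in>{a..<j}. x j i)"
    if "j < Suc n" for j
  proof (cases "j = n")
    case True
    have "{i. i \<in> {a..<n} \<and> col' i = col' n} = {i. i \<in> {a..<n} \<and> col i = c}"
      by (auto simp: col'_def)
    then show ?thesis using c(2) True by (simp only:)
  next
    case False
    then have "j < n" using that by simp
    then have "{i. i \<in> {a..<j} \<and> col' i = col' j} = {i. i \<in> {a..<j} \<and> col i = col j}"
      by (auto simp: col'_def)
    then show ?thesis using col(2) \<open>j < n\<close> by (simp only:)
  qed
  moreover have "\<forall>i. col' i < R" using col(1) c(1) by (simp add: col'_def)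
  ultimately show ?case by blast
qed

lemma inverse_square_sum_le_2: "(\<Sum>i<n. 1 / (real i + 1) ^ 2) \<le> 2 - 1 / real n" if "1 \<le> n"
  using that
proof (induction n rule: dec_induct)
  case (step n)
  have n: "0 < real n" using step by simp
  have "1 / (real n + 1) ^ 2 \<le> 1 / (real n * (real n + 1))"
    using n by (intro divide_left_mono) (auto simp: power2_eq_square)
  also have "\<dots> = 1 / real n - 1 / real (Suc n)" using n by (simp add: field_simps)
  finally show ?case using step by simp
qed simp

text \<open>Pick vertices of \<open>A\<close> greedily by the number of new neighbours in \<open>B\<close> until half of \<open>B\<close> is
  covered. If \<open>p\<close> maximises \<open>p\<^sup>2\<close> times the number of new neighbours of the \<open>p\<close>-th choice, then the
  choices with index between \<open>p/2\<close> and \<open>p\<close> have comparably many new neighbours, and a bounded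
  colouring makes the overlaps inside a colour class negligible.\<close>

lemma comb_exists:
  fixes A B :: "'a set" and r \<rho> :: real
  assumes finA: "finite A" and finB: "finite B" and A0: "A \<noteq> {}" and B0: "B \<noteq> {}"
    and rho: "0 < \<rho>"
    and degA: "\<forall>a\<in>A. r * real (card (nbhd E a B)) \<le> real (card B)"
    and degB: "\<forall>b\<in>B. \<rho> * real (card A) \<le> real (card {a \<in> A. E a b})"
  shows "\<exists>S a T w. finite (S :: nat set) \<and> inj_on a S \<and> a ` S \<subseteq> A \<and>
    (\<forall>i\<in>S. T i \<subseteq> B \<and> w \<le> real (card (T i)) \<and> (\<forall>b\<in>T i. E (a i) b)) \<and>
    (\<forall>i\<in>S. \<forall>j\<in>S. i \<noteq> j \<longrightarrow> T i \<inter> T j = {} \<and> (\<forall>b\<in>T j. \<not> E (a i) b)) \<and>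
    r \<le> 30000 * real (card S) ^ 2 \<and> \<rho> * real (card B) \<le> 4 * w \<and>
    real (card B) \<le> 60000 * real (card S) ^ 2 * w"
proof -
  have "\<exists>a\<in>A. \<forall>a'\<in>A. card (nbhd E a' U) \<le> card (nbhd E a U)" for U
  proof -
    have fin: "finite ((\<lambda>a. card (nbhd E a U)) ` A)" and ne: "(\<lambda>a. card (nbhd E a U)) ` A \<noteq> {}"
      using finA A0 by auto
    obtain a where "a \<in> A" "card (nbhd E a U) = Max ((\<lambda>a. card (nbhd E a U)) ` A)"
      using Max_in[OF fin ne] by auto
    moreover have "card (nbhd E a' U) \<le> Max ((\<lambda>a. card (nbhd E a U)) ` A)" if "a' \<in> A" for a'
      using that by (intro Max_ge[OF fin]) simp
    ultimately show ?thesis by (intro bexI[of _ a]) simp_all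
  qed
  then obtain sel where sel: "\<And>U. sel U \<in> A" "\<And>U a'. a' \<in> A \<Longrightarrow> card (nbhd E a' U) \<le> card (nbhd E (sel U) U)"
    by metis
  define rem where "rem = rec_nat B (\<lambda>_ U. U - nbhd E (sel U) U)"
  have rem0: "rem 0 = B" and remS: "\<And>n. rem (Suc n) = rem n - nbhd E (sel (rem n)) (rem n)"
    by (simp_all add: rem_def)
  define a where "a n = sel (rem n)" for n
  define D where "D n = nbhd E (a n) (rem n)" for n
  define d where "d n = card (D n)" for n
  have remS': "rem (Suc n) = rem n - D n" for n by (simp add: remS D_def a_def)
  have aA: "a n \<in> A" for n by (simp add: a_def sel)
  have rem_anti: "rem n \<subseteq> rem m" if "m \<le> n" for m n
    using that by (induction n rule: dec_induct) (auto simp: remS')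
  have rem_sub: "rem n \<subseteq> B" for n using rem_anti[of 0 n] rem0 by simp
  have finrem: "finite (rem n)" for n using rem_sub finB finite_subset by blast
  have Drem: "D n \<subseteq> rem n" for n by (simp add: D_def nbhd_subset)
  have finD: "finite (D n)" for n using Drem finrem finite_subset by blast
  have Dlater: "D i \<inter> rem j = {}" if "i < j" for i j
    using rem_anti[of "Suc i" j] that by (auto simp: remS')
  have dmax: "card (nbhd E a' (rem n)) \<le> d n" if "a' \<in> A" for a' n
    using sel(2)[OF that, of "rem n"] by (simp add: d_def D_def a_def)
  have nb_mono: "card (nbhd E x U) \<le> card (nbhd E x V)" if "U \<subseteq> V" "finite V" for x U V
    using that by (intro card_mono) (auto simp: nbhd_def)
  have d_anti: "d n \<le> d m" if "m \<le> n" for m n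
  proof -
    have "d n \<le> card (nbhd E (a n) (rem m))"
      unfolding d_def D_def by (rule nb_mono[OF rem_anti[OF that] finrem])
    also have "\<dots> \<le> d m" by (rule dmax[OF aA])
    finally show ?thesis .
  qed
  \<comment> \<open>Averaging: each uncovered vertex is adjacent to a proportion \<rho> of
    \<open>A\<close>, so the best vertex of \<open>A\<close> covers a proportion \<rho> of what is
    left.\<close>
  have d_low: "\<rho> * real (card (rem n)) \<le> real (d n)" for n
  proof -
    have "real (card A) * (\<rho> * real (card (rem n))) = (\<Sum>b\<in>rem n. \<rho> * real (card A))" by simp
    also have "\<dots> \<le> (\<Sum>b\<in>rem n. real (card {a \<in> A. E a b}))"
      using degB rem_sub by (intro sum_mono) blast
    also have "\<dots> = real (\<Sum>a'\<in>A. card (nbhd E a' (rem n)))"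
      by (simp add: double_count[OF finA finrem])
    also have "\<dots> \<le> real (\<Sum>a'\<in>A. d n)" using dmax by (intro of_nat_mono sum_mono)
    also have "\<dots> = real (card A) * real (d n)" by simp
    finally show ?thesis using finA A0 by (simp add: mult_le_cancel_left card_gt_0_iff)
  qed
  have tot: "card (rem n) + (\<Sum>i<n. d i) = card B" for n
  proof (induction n)
    case (Suc n)
    have "card (rem (Suc n)) = card (rem n) - d n"
      unfolding remS' d_def using Drem finD by (intro card_Diff_subset)
    moreover have "d n \<le> card (rem n)" unfolding d_def by (rule card_mono[OF finrem Drem])
    ultimately show ?case using Suc by simp
  qed (simp add: rem0)
  have cB: "0 < card B" using finB B0 by (simp add: card_gt_0_iff)
  have "\<exists>n. 2 * card (rem n) < card B"
  proof (rule ccontr)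
    assume *: "\<not> ?thesis"
    have "0 < d i" for i
    proof -
      have "card B \<le> 2 * card (rem i)" using * by (meson not_le)
      then have "0 < real (card (rem i))" using cB by linarith
      then have "0 < real (d i)" using d_low[of i] rho by (smt (verit) mult_pos_pos)
      then show ?thesis by simp
    qed
    then have "(\<Sum>i<Suc (card B). 1) \<le> (\<Sum>i<Suc (card B). d i)"
      by (intro sum_mono) (simp add: Suc_leI)
    then show False using tot[of "Suc (card B)"] by simp
  qed
  define N where "N = (LEAST n. 2 * card (rem n) < card B)"
  have N: "2 * card (rem N) < card B"
    unfolding N_def using \<open>\<exists>n. 2 * card (rem n) < card B\<close> by (rule LeastI_ex)
  have Nmin: "card B \<le> 2 * card (rem n)" if "n < N" for n
    using not_less_Least[of n "\<lambda>n. 2 * card (rem n) < card B"] that unfolding N_def by (meson not_le)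
  have N1: "1 \<le> N" using N rem0 by (cases N) auto
  \<comment> \<open>The weights are squares because inverse squares have a bounded sum: the numbers
    \<open>d i\<close> with \<open>i < N\<close> add up to at least half of \<open>B\<close> and at
    most \<open>2 * F k\<close>, so \<open>F k\<close> is at least a quarter of
    \<open>card B\<close>.\<close>
  define F where "F i = (real i + 1) ^ 2 * real (d i)" for i
  obtain k where k: "k < N" "\<And>i. i < N \<Longrightarrow> F i \<le> F k"
  proof -
    have fin: "finite (F ` {..<N})" and ne: "F ` {..<N} \<noteq> {}"
      using N1 by (simp_all add: lessThan_empty_iff)
    obtain k where "k \<in> {..<N}" "F k = Max (F ` {..<N})" using Max_in[OF fin ne] by auto
    moreover have "F i \<le> Max (F ` {..<N})" if "i < N" for i
      using that by (intro Max_ge[OF fin]) simp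
    ultimately show ?thesis by (intro that[of k]) simp_all
  qed
  define p where "p = k + 1"
  have Fk: "F k = real p ^ 2 * real (d k)" by (simp add: F_def p_def add.commute)
  have half: "real (card B) \<le> 2 * (\<Sum>i<N. real (d i))"
  proof -
    have "card B \<le> 2 * (\<Sum>i<N. d i)" using tot[of N] N by linarith
    then have "real (card B) \<le> real (2 * (\<Sum>i<N. d i))" by (rule of_nat_mono)
    then show ?thesis by simp
  qed
  have F0: "0 \<le> F k" by (simp add: F_def)
  have "(\<Sum>i<N. real (d i)) \<le> (\<Sum>i<N. F k * (1 / (real i + 1) ^ 2))"
  proof (rule sum_mono)
    fix i assume "i \<in> {..<N}"
    then have "(real i + 1) ^ 2 * real (d i) \<le> F k" using k(2)[of i] by (simp add: F_def)
    moreover have "0 < (real i + 1) ^ 2" by (simp add: zero_less_power2 add_pos_nonneg pos_add_strict)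
    ultimately show "real (d i) \<le> F k * (1 / (real i + 1) ^ 2)" by (simp add: field_simps)
  qed
  also have "\<dots> = F k * (\<Sum>i<N. 1 / (real i + 1) ^ 2)" by (simp add: sum_distrib_left)
  also have "\<dots> \<le> F k * 2"
    using inverse_square_sum_le_2[OF N1] F0 by (intro mult_left_mono) (auto intro: order_trans)
  finally have B4: "real (card B) \<le> 4 * real p ^ 2 * real (d k)" using half Fk by simp
  have dk0: "0 < real (d k)"
  proof -
    have "0 < 4 * real p ^ 2 * real (d k)" using B4 cB by linarith
    then show ?thesis by (simp add: zero_less_mult_iff)
  qed
  have rp: "r \<le> 4 * real p ^ 2"
  proof -
    have "nbhd E (a k) (rem k) \<subseteq> nbhd E (a k) B" using rem_sub by (auto simp: nbhd_def)
    then have "real (d k) \<le> real (card (nbhd E (a k) B))"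
      unfolding d_def D_def using finB finite_nbhd by (intro of_nat_mono card_mono)
    moreover have "r * real (card (nbhd E (a k) B)) \<le> real (card B)" by (rule degA[rule_format, OF aA])
    ultimately have "r * real (d k) \<le> 4 * real p ^ 2 * real (d k)"
      using B4 dk0 by (cases "0 \<le> r")
        (smt (verit) mult_left_mono, smt (verit) mult_nonneg_nonneg mult_nonpos_nonneg zero_le_power2)
    then show ?thesis using dk0 by simp
  qed
  have rhoB: "\<rho> * real (card B) \<le> 2 * real (d k)"
  proof -
    have "real (card B) \<le> real (2 * card (rem k))" using Nmin[OF k(1)] by (rule of_nat_mono)
    then have "\<rho> * real (card B) \<le> \<rho> * (2 * real (card (rem k)))"
      using rho by (intro mult_left_mono) simp_all
    then show ?thesis using d_low[of k] by simp
  qed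
  \<comment> \<open>The window \<open>{i0..<p}\<close> keeps at least half of the indices below
    \<open>p\<close>, while \<open>i0 + 1\<close> is still at least p / 2; by the choice of
    \<open>k\<close> this gives \<open>d i0 \<le> 4 * d k\<close>.\<close>
  define i0 where "i0 = (p - 1) div 2"
  have i0: "p \<le> 2 * (i0 + 1)" "2 * i0 + 1 \<le> p" "i0 \<le> k" by (auto simp: i0_def p_def)
  have dwin: "real (d i0) \<le> 4 * real (d k)"
  proof -
    have "(real p / 2) ^ 2 * real (d i0) \<le> (real i0 + 1) ^ 2 * real (d i0)"
      using i0(1) by (intro mult_right_mono power_mono) auto
    also have "\<dots> = F i0" by (simp add: F_def)
    also have "\<dots> \<le> F k" using i0(3) k by auto
    finally have "real p ^ 2 * real (d i0) \<le> real p ^ 2 * (4 * real (d k))"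
      by (simp add: Fk power_divide)
    moreover have "0 < real p ^ 2" by (simp add: p_def)
    ultimately show ?thesis by simp
  qed
  \<comment> \<open>The overlap of the choice \<open>j\<close> with the earlier piece
    \<open>D i\<close>. For fixed \<open>j\<close> these pieces are disjoint and lie in
    \<open>rem i0\<close>, where no vertex of \<open>A\<close> has more than \<open>d i0\<close>
    neighbours.\<close>
  define x where "x j i = real (card (nbhd E (a j) (D i)))" for j i
  have xsum: "(\<Sum>i\<in>{i0..<j}. x j i) \<le> 4 * real (d k)" for j
  proof -
    have "(\<Sum>i\<in>{i0..<j}. card (nbhd E (a j) (D i))) = card (\<Union>i\<in>{i0..<j}. nbhd E (a j) (D i))"
    proof (rule card_UN_disjoint[symmetric])
      show "\<forall>i\<in>{i0..<j}. \<forall>i'\<in>{i0..<j}. i \<noteq> i' \<longrightarrow> nbhd E (a j) (D i) \<inter> nbhd E (a j) (D i') = {}"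
      proof (intro ballI impI)
        fix i i' :: nat assume "i \<noteq> i'"
        then have "D i \<inter> D i' = {}"
          using Dlater[of i i'] Dlater[of i' i] Drem[of i] Drem[of i'] by (cases "i < i'") auto
        then show "nbhd E (a j) (D i) \<inter> nbhd E (a j) (D i') = {}" by (auto simp: nbhd_def)
      qed
    qed (auto simp: finite_nbhd finD)
    also have "\<dots> \<le> card (nbhd E (a j) (rem i0))"
    proof (rule card_mono)
      show "(\<Union>i\<in>{i0..<j}. nbhd E (a j) (D i)) \<subseteq> nbhd E (a j) (rem i0)"
      proof
        fix y assume "y \<in> (\<Union>i\<in>{i0..<j}. nbhd E (a j) (D i))"
        then obtain i where i: "i0 \<le> i" "y \<in> nbhd E (a j) (D i)" by auto
        then show "y \<in> nbhd E (a j) (rem i0)" using Drem[of i] rem_anti[OF i(1)] by (auto simp: nbhd_def)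
      qed
    qed (simp add: finite_nbhd finrem)
    also have "\<dots> \<le> d i0" by (rule dmax[OF aA])
    finally have "real (\<Sum>i\<in>{i0..<j}. card (nbhd E (a j) (D i))) \<le> real (d i0)" by (rule of_nat_mono)
    then show ?thesis using dwin by (simp add: x_def)
  qed
  \<comment> \<open>With 32 colours the overlap of each \<open>j\<close> with the earlier members of
    its class is at most 4 * d k / 32 = d k / 8. Summed the other way, \<open>y i\<close> counts
    what \<open>D i\<close> loses to later members of its class; its average is at most d k / 8, so
    at least three quarters of the indices lose at most half of d k.\<close>
  obtain col :: "nat \<Rightarrow> nat" where col: "\<forall>i. col i < 32"
    "\<forall>j<p. real 32 * (\<Sum>i | i \<in> {i0..<j} \<and> col i = col j. x j i) \<le> (\<Sum>i\<in>{i0..<j}. x j i)"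
    using greedy_colouring[where R = 32 and n = p and a = i0 and x = x] by auto
  define I where "I = {i0..<p}"
  define y where "y i = (\<Sum>j | j \<in> I \<and> i < j \<and> col i = col j. x j i)" for i
  have cI: "real p \<le> 2 * real (card I)" using i0 by (auto simp: I_def)
  have "(\<Sum>i\<in>I. y i) = (\<Sum>i\<in>I. \<Sum>j\<in>I. if i < j \<and> col i = col j then x j i else 0)"
    unfolding y_def by (intro sum.cong[OF refl] sum.inter_filter) (simp add: I_def)
  also have "\<dots> = (\<Sum>j\<in>I. \<Sum>i\<in>I. if i < j \<and> col i = col j then x j i else 0)" by (rule sum.swap)
  also have "\<dots> = (\<Sum>j\<in>I. \<Sum>i | i \<in> {i0..<j} \<and> col i = col j. x j i)"
  proof (rule sum.cong[OF refl])
    fix j assume j: "j \<in> I"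
    have "(\<Sum>i\<in>I. if i < j \<and> col i = col j then x j i else 0) = (\<Sum>i\<in>{i\<in>I. i < j \<and> col i = col j}. x j i)"
      by (simp add: I_def sum.If_cases Int_def)
    also have "{i\<in>I. i < j \<and> col i = col j} = {i. i \<in> {i0..<j} \<and> col i = col j}"
      using j by (auto simp: I_def)
    finally show "(\<Sum>i\<in>I. if i < j \<and> col i = col j then x j i else 0)
        = (\<Sum>i | i \<in> {i0..<j} \<and> col i = col j. x j i)" .
  qed
  also have "\<dots> \<le> (\<Sum>j\<in>I. real (d k) / 8)"
  proof (rule sum_mono)
    fix j assume "j \<in> I"
    then have "32 * (\<Sum>i | i \<in> {i0..<j} \<and> col i = col j. x j i) \<le> (\<Sum>i\<in>{i0..<j}. x j i)"
      using col(2) by (auto simp: I_def)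
    then show "(\<Sum>i | i \<in> {i0..<j} \<and> col i = col j. x j i) \<le> real (d k) / 8"
      using xsum[of j] by linarith
  qed
  finally have ysum: "(\<Sum>i\<in>I. y i) \<le> real (card I) * (real (d k) / 8)" by simp
  have y0: "0 \<le> y i" for i unfolding y_def x_def by (intro sum_nonneg) simp
  define G where "G = {i \<in> I. 2 * y i \<le> real (d k)}"
  have finI: "finite I" by (simp add: I_def)
  have cG: "3 * real (card I) \<le> 4 * real (card G)"
  proof -
    have "real (card (I - G)) * (real (d k) / 2) = (\<Sum>i\<in>I - G. real (d k) / 2)" by simp
    also have "\<dots> \<le> (\<Sum>i\<in>I - G. y i)" by (rule sum_mono) (auto simp: G_def)
    also have "\<dots> \<le> (\<Sum>i\<in>I. y i)" using y0 finI by (intro sum_mono2) auto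
    also note ysum
    finally have "(4 * real (card (I - G))) * real (d k) \<le> real (card I) * real (d k)" by (simp add: algebra_simps)
    then have "4 * real (card (I - G)) \<le> real (card I)" using dk0 by (simp only: mult_le_cancel_right_pos)
    moreover have "real (card (I - G)) = real (card I) - real (card G)"
    proof -
      have "G \<subseteq> I" by (auto simp: G_def)
      then show ?thesis using finI card_mono[OF finI] finite_subset by (subst card_Diff_subset) auto
    qed
    ultimately show ?thesis by simp
  qed
  obtain c where c: "c < 32" "(\<Sum>i\<in>G. 1) \<le> real 32 * (\<Sum>i | i \<in> G \<and> col i = c. 1)"
    using averaging_colours(2)[of G col 32 "\<lambda>_. 1"] col(1) finI by (auto simp: G_def)
  define S where "S = {i. i \<in> G \<and> col i = c}"
  have SI: "S \<subseteq> I" by (auto simp: S_def G_def)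
  have finS: "finite S" using SI finI finite_subset by blast
  have cS: "real (card G) \<le> 32 * real (card S)" using c(2) by (simp add: S_def)
  \<comment> \<open>The losses are 2 for the window, 4/3 for the discarded indices and 32 for the
    colour; their product is below 86. Four times the square of 86 stays below 30000.\<close>
  have pS: "real p \<le> 86 * real (card S)" using cI cG cS by linarith
  \<comment> \<open>Only the neighbours of later choices have to be removed: those of the earlier
    choices had already left \<open>rem\<close> when \<open>D i\<close> was formed.\<close>
  define T where "T i = D i - (\<Union>j\<in>{j\<in>S. i < j}. nbhd E (a j) (D i))" for i
  have TD: "T i \<subseteq> D i" for i by (auto simp: T_def)
  have cT: "real (d k) / 2 \<le> real (card (T i))" if i: "i \<in> S" for i
  proof -
    let ?U = "\<Union>j\<in>{j\<in>S. i < j}. nbhd E (a j) (D i)"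
    have U: "?U \<subseteq> D i" by (auto simp: nbhd_def)
    moreover have "finite ?U" using finite_subset[OF U finD] .
    moreover have "card ?U \<le> card (D i)" using card_mono[OF finD U] .
    ultimately have "real (card (T i)) = real (d i) - real (card ?U)"
      unfolding T_def d_def by (subst card_Diff_subset) simp_all
    moreover have "real (card ?U) \<le> y i"
    proof -
      have "card ?U \<le> (\<Sum>j\<in>{j\<in>S. i < j}. card (nbhd E (a j) (D i)))"
        using finS by (intro card_UN_le) auto
      then have "real (card ?U) \<le> (\<Sum>j\<in>{j\<in>S. i < j}. x j i)"
        unfolding x_def by (simp flip: of_nat_sum)
      also have "\<dots> \<le> y i"
        unfolding y_def using i finI SI by (intro sum_mono2) (auto simp: S_def x_def)
      finally show ?thesis .
    qed
    moreover have "2 * y i \<le> real (d k)" using i by (auto simp: S_def G_def)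
    moreover have "d k \<le> d i" using i SI by (intro d_anti) (auto simp: I_def p_def)
    ultimately show ?thesis by simp
  qed
  have sep: "T i \<inter> T j = {} \<and> (\<forall>b\<in>T j. \<not> E (a i) b)" if "i \<in> S" "j \<in> S" "i \<noteq> j" for i j
  proof
    show "T i \<inter> T j = {}"
    proof (cases "i < j")
      case True
      then have "D i \<inter> rem j = {}" by (rule Dlater)
      then show ?thesis using TD[of i] TD[of j] Drem[of j] by blast
    next
      case False
      then have "D j \<inter> rem i = {}" using that(3) by (intro Dlater) simp
      then show ?thesis using TD[of i] TD[of j] Drem[of i] by blast
    qed
    show "\<forall>b\<in>T j. \<not> E (a i) b"
    proof
      fix b assume b: "b \<in> T j"
      show "\<not> E (a i) b"
      proof (cases "i < j")
        case True
        have "b \<in> rem j" using b TD Drem by blast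
        then have "b \<in> rem i - D i" using rem_anti[of "Suc i" j] True by (auto simp: remS')
        then show ?thesis by (auto simp: D_def nbhd_def)
      next
        case False
        then have "j < i" using that by simp
        then show ?thesis using b that(1) TD[of j] by (auto simp: T_def nbhd_def)
      qed
    qed
  qed
  have comp: "E (a i) b" if "b \<in> T i" for i b
    using that TD[of i] by (auto simp: D_def nbhd_def)
  have inj: "inj_on a S"
  proof (rule inj_onI, rule ccontr)
    fix i j assume ij: "i \<in> S" "j \<in> S" "a i = a j" "i \<noteq> j"
    have "0 < real (card (T j))" using cT[OF ij(2)] dk0 by linarith
    then obtain b where "b \<in> T j" by (metis card.empty equals0I less_irrefl of_nat_0)
    then show False using comp[of b j] sep[OF ij(1,2,4)] ij(3) by auto
  qed
  have p2: "real p ^ 2 \<le> 7396 * real (card S) ^ 2"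
    using power_mono[OF pS, of 2] by (simp add: power_mult_distrib)
  show ?thesis
  proof (intro exI[of _ S] exI[of _ a] exI[of _ T] exI[of _ "real (d k) / 2"] conjI)
    show "finite S" "inj_on a S" by (fact finS, fact inj)
    show "a ` S \<subseteq> A" using aA by auto
    show "\<forall>i\<in>S. T i \<subseteq> B \<and> real (d k) / 2 \<le> real (card (T i)) \<and> (\<forall>b\<in>T i. E (a i) b)"
      using TD Drem rem_sub cT comp by (meson subset_trans)
    show "\<forall>i\<in>S. \<forall>j\<in>S. i \<noteq> j \<longrightarrow> T i \<inter> T j = {} \<and> (\<forall>b\<in>T j. \<not> E (a i) b)" using sep by blast
    show "r \<le> 30000 * real (card S) ^ 2" using rp p2 zero_le_power2[of "real (card S)"] by linarith
    show "\<rho> * real (card B) \<le> 4 * (real (d k) / 2)" using rhoB by simp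
    have "real p ^ 2 * real (d k) \<le> 7396 * real (card S) ^ 2 * real (d k)"
      using p2 by (rule mult_right_mono) simp
    then have "4 * (real p ^ 2 * real (d k)) \<le> 29584 * (real (card S) ^ 2 * real (d k))"
      by (simp only: mult.assoc)
    moreover have "0 \<le> real (card S) ^ 2 * real (d k)" by simp
    moreover have "real (card B) \<le> 4 * (real p ^ 2 * real (d k))" using B4 by (simp only: mult.assoc)
    ultimately have "real (card B) \<le> 30000 * (real (card S) ^ 2 * real (d k))" by linarith
    then show "real (card B) \<le> 60000 * real (card S) ^ 2 * (real (d k) / 2)" by (simp add: mult_ac)
  qed
qed

subsection \<open>Peeling off blocks\<close>

text \<open>The greedy embedding runs through an initial segment of the natural numbers; this
  transfers the exclusion of a pattern on an arbitrary finite vertex set to such a segment.\<close>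

lemma embeds_reindex:
  assumes "bij_betw f V' V" "embeds E (\<lambda>i j. P (f i) (f j)) V' X"
  shows "embeds E P V X"
proof -
  obtain g where g: "inj_on g V'" "g ` V' \<subseteq> X"
    "\<forall>i\<in>V'. \<forall>j\<in>V'. i \<noteq> j \<longrightarrow> (E (g i) (g j) \<longleftrightarrow> P (f i) (f j))"
    using assms(2) unfolding embeds_def by auto
  define f' where "f' = the_inv_into V' f"
  have inj: "inj_on f V'" and im: "f ` V' = V" using assms(1) by (auto simp: bij_betw_def)
  have f': "f' v \<in> V'" "f (f' v) = v" if "v \<in> V" for v
    using that inj im by (auto simp: f'_def the_inv_into_into f_the_inv_into_f)
  have "inj_on (\<lambda>v. g (f' v)) V"
    by (rule inj_onI) (metis f' g(1) inj_onD)
  moreover have "(\<lambda>v. g (f' v)) ` V \<subseteq> X" using f' g(2) by blast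
  moreover have "E (g (f' i)) (g (f' j)) \<longleftrightarrow> P i j" if "i \<in> V" "j \<in> V" "i \<noteq> j" for i j
    using g(3) f'[OF that(1)] f'[OF that(2)] that(3) by metis
  ultimately show ?thesis unfolding embeds_def by (intro exI[of _ "\<lambda>v. g (f' v)"]) simp
qed

text \<open>All later blocks lie inside the \<open>Q\<close> of the current round, so heredity of
  \<open>R\<close> in its second argument suffices. The size hypothesis says that after
  \<open>j\<close> losses of \<tau> at least half of \<open>W\<close> is left, which keeps
  \<open>step\<close> applicable.\<close>

lemma peeling:
  fixes R :: "'a set \<Rightarrow> 'a set \<Rightarrow> bool"
  assumes her: "\<And>P Q Q'. R P Q \<Longrightarrow> Q' \<subseteq> Q \<Longrightarrow> R P Q'" and tau: "0 \<le> \<tau>"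
    and step: "\<And>Y. Y \<subseteq> W \<Longrightarrow> real (card W) \<le> 2 * real (card Y) \<Longrightarrow>
      \<exists>P\<subseteq>Y. \<exists>Q\<subseteq>Y. P \<inter> Q = {} \<and> p \<le> real (card P) \<and> real (card Y) - \<tau> \<le> real (card Q) \<and> R P Q"
  shows "Y \<subseteq> W \<Longrightarrow> real (card W) / 2 \<le> real (card Y) - real j * \<tau> \<Longrightarrow>
    \<exists>Ps. length Ps = j \<and> (\<forall>P\<in>set Ps. P \<subseteq> Y \<and> p \<le> real (card P)) \<and>
      sorted_wrt (\<lambda>P Q. P \<inter> Q = {} \<and> R P Q) Ps"
proof (induction j arbitrary: Y)
  case (Suc j)
  have "0 \<le> real (Suc j) * \<tau>" using tau by simp
  then have "real (card W) \<le> 2 * real (card Y)" using Suc.prems(2) by linarith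
  from step[OF Suc.prems(1) this] obtain P Q where PQ: "P \<subseteq> Y" "Q \<subseteq> Y" "P \<inter> Q = {}"
    "p \<le> real (card P)" "real (card Y) - \<tau> \<le> real (card Q)" "R P Q" by blast
  have "real (card W) / 2 \<le> real (card Q) - real j * \<tau>"
    using Suc.prems(2) PQ(5) by (simp add: algebra_simps)
  from Suc.IH[OF _ this] obtain Ps where Ps: "length Ps = j" "\<forall>P\<in>set Ps. P \<subseteq> Q \<and> p \<le> real (card P)"
    "sorted_wrt (\<lambda>P Q. P \<inter> Q = {} \<and> R P Q) Ps"
    using PQ(2) Suc.prems(1) by blast
  have "\<forall>P'\<in>set Ps. P \<inter> P' = {} \<and> R P P'" using Ps(2) PQ(3) her[OF PQ(6)] by blast
  with Ps PQ show ?case by (intro exI[of _ "P # Ps"]) auto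
qed simp

section \<open>Relations between blocks, and combs with an apex\<close>

definition complete_pair :: "('a \<Rightarrow> 'a \<Rightarrow> bool) \<Rightarrow> 'a set \<Rightarrow> 'a set \<Rightarrow> bool" where
  "complete_pair E P Q \<longleftrightarrow> (\<forall>x\<in>P. \<forall>y\<in>Q. E x y)"

definition anticomplete_pair :: "('a \<Rightarrow> 'a \<Rightarrow> bool) \<Rightarrow> 'a set \<Rightarrow> 'a set \<Rightarrow> bool" where
  "anticomplete_pair E P Q \<longleftrightarrow> (\<forall>x\<in>P. \<forall>y\<in>Q. \<not> E x y)"

text \<open>A condition on the single vertices of \<open>Q\<close>: it passes to all subsets of
  \<open>Q\<close>, but not to subsets of \<open>P\<close>.\<close>

definition sparse_from :: "('a \<Rightarrow> 'a \<Rightarrow> bool) \<Rightarrow> real \<Rightarrow> 'a set \<Rightarrow> 'a set \<Rightarrow> bool" where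
  "sparse_from E \<sigma> P Q \<longleftrightarrow> (\<forall>y\<in>Q. real (card (nbhd E y P)) \<le> \<sigma> * real (card P))"

text \<open>The configuration in the hypothesis of the comb property. The teeth are indexed by a
  finite set of numbers instead of a list because they arise as a selection from a longer sequence
  of choices.\<close>

definition apex_comb ::
  "('a \<Rightarrow> 'a \<Rightarrow> bool) \<Rightarrow> 'a set \<Rightarrow> nat set \<Rightarrow> real \<Rightarrow> (nat \<Rightarrow> 'a) \<Rightarrow> (nat \<Rightarrow> 'a set) \<Rightarrow> 'a \<Rightarrow> bool" where
  "apex_comb E V S w a T v \<longleftrightarrow> finite S \<and> inj_on a S \<and> a ` S \<subseteq> V \<and> v \<in> V \<and>
     (\<forall>i\<in>S. T i \<subseteq> V \<and> w \<le> real (card (T i)) \<and> v \<notin> T i \<and> v \<noteq> a i \<and> \<not> E v (a i) \<and>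
       (\<forall>b\<in>T i. E (a i) b \<and> E v b)) \<and>
     (\<forall>i\<in>S. \<forall>j\<in>S. a i \<notin> T j \<and> (i \<noteq> j \<longrightarrow> T i \<inter> T j = {} \<and> (\<forall>b\<in>T j. \<not> E (a i) b)))"

lemma markov_count:
  fixes f :: "'a \<Rightarrow> real"
  assumes "finite A" "\<And>a. a \<in> A \<Longrightarrow> 0 \<le> f a" "0 \<le> c"
  shows "c * real (card {a \<in> A. \<not> f a \<le> c}) \<le> (\<Sum>a\<in>A. f a)"
proof -
  have "c * real (card {a \<in> A. \<not> f a \<le> c}) = (\<Sum>a | a \<in> A \<and> \<not> f a \<le> c. c)" by simp
  also have "\<dots> \<le> (\<Sum>a | a \<in> A \<and> \<not> f a \<le> c. f a)" by (intro sum_mono) auto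
  also have "\<dots> \<le> (\<Sum>a\<in>A. f a)" using assms by (intro sum_mono2) auto
  finally show ?thesis .
qed

lemma card_filter_split:
  "finite A \<Longrightarrow> real (card A) = real (card {a \<in> A. P a}) + real (card {a \<in> A. \<not> P a})"
proof -
  assume f: "finite A"
  have "card A = card ({a \<in> A. P a} \<union> {a \<in> A. \<not> P a})" by (rule arg_cong[of _ _ card]) auto
  also have "\<dots> = card {a \<in> A. P a} + card {a \<in> A. \<not> P a}" using f by (intro card_Un_disjoint) auto
  finally show ?thesis by simp
qed

text \<open>In a sparse set, the neighbourhood of a vertex \<open>v\<close> of relatively high degree is seen sparsely
  by almost all non-neighbours of \<open>v\<close>, unless they form a comb with apex \<open>v\<close>.\<close>

lemma sparse_step:
  fixes E :: "'a \<Rightarrow> 'a \<Rightarrow> bool"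
  assumes finW: "finite W" and sym: "symp E" and irr: "irreflp E" and q: "0 < q" "q \<le> 1/10"
    and low: "low_degree E (q ^ 2) W" and YW: "Y \<subseteq> W" and half: "real (card W) \<le> 2 * real (card Y)"
    and high: "\<not> low_degree E (q ^ 4) Y" and big: "1 \<le> q * real (card W)"
    and sr: "0 < \<sigma>" "0 < \<rho>" "\<rho> \<le> \<sigma> * q"
  shows "(\<exists>P\<subseteq>Y. \<exists>Q\<subseteq>Y. P \<inter> Q = {} \<and> q ^ 4 / 4 * real (card W) \<le> real (card P) \<and>
      real (card Y) - 4 * q * real (card W) \<le> real (card Q) \<and> sparse_from E \<sigma> P Q) \<or>
    (\<exists>S w a T v. apex_comb E W S w a T v \<and> 1 / (2 * q) \<le> 30000 * real (card S) ^ 2 \<and>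
      \<rho> * q ^ 4 * real (card W) \<le> 16 * w \<and> q ^ 4 * real (card W) \<le> 240000 * real (card S) ^ 2 * w)"
proof -
  let ?w = "real (card W)"
  have finY: "finite Y" using finW YW finite_subset by blast
  obtain v where v: "v \<in> Y" "q ^ 4 * real (card Y) < real (card (nbhd E v Y))"
    using high unfolding low_degree_def by (auto simp: not_le)
  define B where "B = nbhd E v Y"
  define A where "A = Y - B - {v}"
  \<comment> \<open>Each vertex of \<open>B\<close> has at most \<open>q ^ 2 * card W\<close>
    neighbours, so double counting shows that at most \<open>q * card W\<close> vertices of
    \<open>A\<close> are thrown away here. The degree bound for the rest is what makes the comb
    long.\<close>
  define Al where "Al = {a \<in> A. real (card (nbhd E a B)) \<le> q * real (card B)}"
  have fin: "finite B" "finite A" "finite Al" using finY by (auto simp: B_def A_def Al_def finite_nbhd)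
  have w0: "0 < ?w" using big q by (smt (verit) mult_nonneg_nonpos of_nat_0_le_iff)
  have Bbig: "q ^ 4 * ?w \<le> 2 * real (card B)"
  proof -
    have "q ^ 4 * ?w \<le> q ^ 4 * (2 * real (card Y))" using half q by (intro mult_left_mono) auto
    then show ?thesis using v(2) by (simp add: B_def)
  qed
  have B0: "0 < real (card B)" using v(2) q by (smt (verit) B_def of_nat_0_le_iff zero_le_mult_iff zero_le_power)
  have vW: "v \<in> W" using v YW by blast
  have nbW: "card (nbhd E x Z) \<le> card (nbhd E x W)" if "Z \<subseteq> W" for x Z
    using that finW by (intro card_mono) (auto simp: nbhd_def)
  have deg: "real (card (nbhd E x Z)) \<le> q ^ 2 * ?w" if "x \<in> W" "Z \<subseteq> W" for x Z
    using low that nbW[OF that(2), of x] unfolding low_degree_def by fastforce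
  have qq: "q ^ 2 * ?w \<le> q * ?w" using q w0 by (simp add: power2_eq_square)
  have BY: "B \<subseteq> Y" by (simp add: B_def nbhd_subset)
  have AY: "A \<subseteq> Y" by (auto simp: A_def)
  have AlY: "Al \<subseteq> Y" using AY by (auto simp: Al_def)
  have cB: "real (card B) \<le> q * ?w" using deg[OF vW YW] qq by (simp add: B_def)
  have swap: "{a \<in> Z. E a b} = nbhd E b Z" for b Z using sym by (auto simp: nbhd_def dest: sympD)
  have "(\<Sum>a\<in>A. real (card (nbhd E a B))) = real (\<Sum>b\<in>B. card (nbhd E b A))"
    using double_count[OF fin(2,1), of E] by (simp add: swap flip: of_nat_sum)
  also have "\<dots> = (\<Sum>b\<in>B. real (card (nbhd E b A)))" by simp
  also have "\<dots> \<le> (\<Sum>b\<in>B. q ^ 2 * ?w)"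
    using deg BY AY YW by (intro sum_mono) (meson subsetD subset_trans)
  finally have e1: "(\<Sum>a\<in>A. real (card (nbhd E a B))) \<le> real (card B) * (q ^ 2 * ?w)" by simp
  have "q * real (card B) * real (card {a \<in> A. \<not> real (card (nbhd E a B)) \<le> q * real (card B)})
      \<le> (\<Sum>a\<in>A. real (card (nbhd E a B)))"
    using fin q by (intro markov_count) auto
  with e1 have "(q * real (card B)) * real (card {a \<in> A. \<not> real (card (nbhd E a B)) \<le> q * real (card B)})
      \<le> (q * real (card B)) * (q * ?w)" by (simp add: power2_eq_square mult_ac)
  then have bad1: "real (card {a \<in> A. \<not> real (card (nbhd E a B)) \<le> q * real (card B)}) \<le> q * ?w"
    using q B0 by (subst (asm) mult_le_cancel_left_pos) auto
  have cAl: "real (card A) - q * ?w \<le> real (card Al)"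
    using bad1 card_filter_split[OF fin(2), of "\<lambda>a. real (card (nbhd E a B)) \<le> q * real (card B)"]
    by (simp add: Al_def)
  have vB: "v \<notin> B" using irr by (auto simp: B_def nbhd_def irreflp_def)
  have "real (card A) = real (card Y) - real (card B) - 1"
  proof -
    have "Y = insert v (A \<union> B)" using BY v(1) by (auto simp: A_def)
    moreover have "card (insert v (A \<union> B)) = Suc (card A + card B)"
      using fin vB by (subst card_insert_disjoint, (auto simp: A_def)[2], subst card_Un_disjoint) (auto simp: A_def)
    ultimately show ?thesis by simp
  qed
  \<comment> \<open>Three losses of at most \<open>q * card W\<close> each: the set
    \<open>B\<close>, the discarded part of \<open>A\<close>, and the vertex \<open>v\<close>, as
    \<open>1 \<le> q * card W\<close>. The fourth occurs in forming \<open>Q\<close>.\<close>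
  then have cAl': "real (card Y) - 3 * q * ?w \<le> real (card Al)" using cAl cB big by linarith
  \<comment> \<open>If the vertices of low degree into \<open>Al\<close> make up half of
    \<open>B\<close>, they form the block to be peeled off; otherwise those of high degree form the
    side of the bipartite graph in which a comb is found.\<close>
  define Bf where "Bf = {b \<in> B. real (card (nbhd E b Al)) \<le> \<rho> * real (card Al)}"
  define Bm where "Bm = {b \<in> B. \<not> real (card (nbhd E b Al)) \<le> \<rho> * real (card Al)}"
  have BfB: "Bf \<subseteq> B" "Bm \<subseteq> B" by (auto simp: Bf_def Bm_def)
  have finBf: "finite Bf" "finite Bm" using BfB fin finite_subset by auto
  have Bsplit: "real (card B) = real (card Bf) + real (card Bm)"
    unfolding Bf_def Bm_def by (rule card_filter_split[OF fin(1)])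
  show ?thesis
  proof (cases "real (card B) \<le> 2 * real (card Bf)")
    case True
    define Q where "Q = {a \<in> Al. real (card (nbhd E a Bf)) \<le> \<sigma> * real (card Bf)}"
    have Bf0: "0 < real (card Bf)" using True B0 by linarith
    have "(\<Sum>a\<in>Al. real (card (nbhd E a Bf))) = real (\<Sum>b\<in>Bf. card (nbhd E b Al))"
      using double_count[OF fin(3) finBf(1), of E] by (simp add: swap flip: of_nat_sum)
    also have "\<dots> = (\<Sum>b\<in>Bf. real (card (nbhd E b Al)))" by simp
    also have "\<dots> \<le> (\<Sum>b\<in>Bf. \<rho> * real (card Al))" by (intro sum_mono) (auto simp: Bf_def)
    finally have e2: "(\<Sum>a\<in>Al. real (card (nbhd E a Bf))) \<le> real (card Bf) * (\<rho> * real (card Al))" by simp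
    have "real (card Al) \<le> ?w" using AlY YW finW by (intro of_nat_mono card_mono) auto
    then have "\<rho> * real (card Al) \<le> (\<sigma> * q) * ?w"
      using sr by (intro mult_mono) auto
    then have e3: "real (card Bf) * (\<rho> * real (card Al)) \<le> real (card Bf) * ((\<sigma> * q) * ?w)"
      by (rule mult_left_mono) simp
    have "\<sigma> * real (card Bf) * real (card {a \<in> Al. \<not> real (card (nbhd E a Bf)) \<le> \<sigma> * real (card Bf)})
        \<le> (\<Sum>a\<in>Al. real (card (nbhd E a Bf)))"
      using fin sr by (intro markov_count) auto
    with e2 e3 have "(\<sigma> * real (card Bf)) * real (card {a \<in> Al. \<not> real (card (nbhd E a Bf)) \<le> \<sigma> * real (card Bf)})
        \<le> (\<sigma> * real (card Bf)) * (q * ?w)" by (simp add: mult_ac)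
    then have bad2: "real (card {a \<in> Al. \<not> real (card (nbhd E a Bf)) \<le> \<sigma> * real (card Bf)}) \<le> q * ?w"
      using sr Bf0 by (subst (asm) mult_le_cancel_left_pos) auto
    have cQ: "real (card Y) - 4 * q * ?w \<le> real (card Q)"
      using bad2 cAl' card_filter_split[OF fin(3), of "\<lambda>a. real (card (nbhd E a Bf)) \<le> \<sigma> * real (card Bf)"]
      by (simp add: Q_def)
    have QY: "Q \<subseteq> Y" "Bf \<subseteq> Y" "Bf \<inter> Q = {}" using AlY BfB BY by (auto simp: Q_def Al_def A_def)
    have sp: "sparse_from E \<sigma> Bf Q" by (auto simp: sparse_from_def Q_def)
    have "q ^ 4 / 4 * ?w \<le> real (card Bf)" using Bbig True by simp
    then show ?thesis using cQ QY sp by blast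
  next
    case False
    then have Bm: "real (card B) \<le> 2 * real (card Bm)" using Bsplit by linarith
    have ne2: "Bm \<noteq> {}" using Bm B0 by auto
    have ne1: "Al \<noteq> {}"
    proof
      assume "Al = {}"
      then have "real (card Y) \<le> 3 * q * ?w" using cAl' by simp
      also have "3 * q * ?w \<le> (3 / 10) * ?w" using q by (intro mult_right_mono) auto
      finally show False using half w0 by linarith
    qed
    have d1: "\<forall>a\<in>Al. 1 / (2 * q) * real (card (nbhd E a Bm)) \<le> real (card Bm)"
    proof
      fix a assume a: "a \<in> Al"
      have "card (nbhd E a Bm) \<le> card (nbhd E a B)"
        using BfB fin by (intro card_mono) (auto simp: nbhd_def)
      then have "real (card (nbhd E a Bm)) \<le> q * real (card B)" using a by (simp add: Al_def)
      also have "\<dots> \<le> q * (2 * real (card Bm))" using Bm q by (intro mult_left_mono) auto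
      finally show "1 / (2 * q) * real (card (nbhd E a Bm)) \<le> real (card Bm)" using q by (simp add: field_simps)
    qed
    have d2: "\<forall>b\<in>Bm. \<rho> * real (card Al) \<le> real (card {a \<in> Al. E a b})"
      by (auto simp: Bm_def swap)
    from comb_exists[OF fin(3) finBf(2) ne1 ne2 sr(2) d1 d2]
    obtain S a T w where c: "finite (S :: nat set)" "inj_on a S" "a ` S \<subseteq> Al"
      "\<forall>i\<in>S. T i \<subseteq> Bm \<and> w \<le> real (card (T i)) \<and> (\<forall>b\<in>T i. E (a i) b)"
      "\<forall>i\<in>S. \<forall>j\<in>S. i \<noteq> j \<longrightarrow> T i \<inter> T j = {} \<and> (\<forall>b\<in>T j. \<not> E (a i) b)"
      "1 / (2 * q) \<le> 30000 * real (card S) ^ 2" "\<rho> * real (card Bm) \<le> 4 * w"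
      "real (card Bm) \<le> 60000 * real (card S) ^ 2 * w"
      by (elim exE conjE) (rule that)
    have TB: "T i \<subseteq> B" if "i \<in> S" for i using c(4) that BfB by blast
    have aA: "a i \<in> A" if "i \<in> S" for i using c(3) that by (auto simp: Al_def)
    have f1: "apex_comb E W S w a T v"
      unfolding apex_comb_def
    proof (intro conjI ballI impI)
      show "finite S" "inj_on a S" "v \<in> W" by (fact c, fact c, fact vW)
      show "a ` S \<subseteq> W" using aA AY YW by blast
      fix i assume i: "i \<in> S"
      show "T i \<subseteq> W" using TB[OF i] BY YW by blast
      show "w \<le> real (card (T i))" using c(4) i by blast
      show "v \<notin> T i" using TB[OF i] vB by blast
      show "v \<noteq> a i" "\<not> E v (a i)" using aA[OF i] by (auto simp: A_def B_def nbhd_def)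
      fix b assume "b \<in> T i"
      then show "E (a i) b" "E v b" using c(4) i TB[OF i] by (auto simp: B_def nbhd_def)
    next
      fix i j assume ij: "i \<in> S" "j \<in> S"
      show "a i \<notin> T j" using aA[OF ij(1)] TB[OF ij(2)] by (auto simp: A_def)
      assume "i \<noteq> j"
      then show "T i \<inter> T j = {}" using c(5) ij by blast
      fix b assume "b \<in> T j"
      then show "\<not> E (a i) b" using c(5) ij \<open>i \<noteq> j\<close> by blast
    qed
    have f2: "\<rho> * q ^ 4 * ?w \<le> 16 * w"
    proof -
      have "\<rho> * (q ^ 4 * ?w) \<le> \<rho> * (4 * real (card Bm))" using Bbig Bm sr by (intro mult_left_mono) auto
      then show ?thesis using c(7) by simp
    qed
    have f3: "q ^ 4 * ?w \<le> 240000 * real (card S) ^ 2 * w" using Bbig Bm c(8) by linarith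
    show ?thesis
      by (intro disjI2 exI conjI, rule f1, rule c(6), rule f2, rule f3)
  qed
qed

text \<open>\<open>PH\<close> on \<open>VH\<close> is the complement of \<open>H\<close>, in which the leaf \<open>v0\<close> of \<open>H\<close> is adjacent to
  all vertices but its neighbour \<open>u0\<close> in \<open>H\<close>.\<close>

locale leaf_pattern =
  fixes VH :: "'b set" and PH :: "'b \<Rightarrow> 'b \<Rightarrow> bool" and v0 u0 :: 'b
  assumes finVH: "finite VH" and v0: "v0 \<in> VH" and u0: "u0 \<in> VH" and uv: "u0 \<noteq> v0"
    and PH_sym: "\<And>i j. PH i j \<longleftrightarrow> PH j i" and PH_leaf: "\<not> PH v0 u0"
    and PH_other: "\<And>i. i \<in> VH \<Longrightarrow> i \<noteq> v0 \<Longrightarrow> i \<noteq> u0 \<Longrightarrow> PH v0 i"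
begin

text \<open>With the relation \<open>PH\<close>, \<open>VJ\<close> carries the pattern
  \<open>J\<close> of the overview and \<open>VJ'\<close> the pattern \<open>J - u\<close>.\<close>

definition VJ where "VJ = VH - {v0}"
definition VJ' where "VJ' = VH - {v0, u0}"

lemma finVJ': "finite VJ'" using finVH by (simp add: VJ'_def)

lemma VJ_eq: "VJ = insert u0 VJ'" and u0_VJ': "u0 \<notin> VJ'" and v0_VJ': "v0 \<notin> VJ'"
  and VH_eq: "VH = insert v0 (insert u0 VJ')"
  using v0 u0 uv by (auto simp: VJ_def VJ'_def)

lemma card_VJ: "card VJ = Suc (card VJ')"
  using finVJ' u0_VJ' by (simp add: VJ_eq)

definition partial_copy :: "('a \<Rightarrow> 'a \<Rightarrow> bool) \<Rightarrow> 'a set \<Rightarrow> ('b \<Rightarrow> 'a) \<Rightarrow> bool" where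
  "partial_copy E X g \<longleftrightarrow> inj_on g VJ' \<and> g ` VJ' \<subseteq> X \<and>
     (\<forall>i\<in>VJ'. \<forall>j\<in>VJ'. i \<noteq> j \<longrightarrow> (E (g i) (g j) \<longleftrightarrow> PH i j))"

definition extensions :: "('a \<Rightarrow> 'a \<Rightarrow> bool) \<Rightarrow> 'a set \<Rightarrow> ('b \<Rightarrow> 'a) \<Rightarrow> 'a set" where
  "extensions E X g = {x \<in> X. x \<notin> g ` VJ' \<and> (\<forall>i\<in>VJ'. E x (g i) \<longleftrightarrow> PH u0 i)}"

text \<open>A copy of \<open>J\<close> is a partial copy together with one of its extensions. The
  number of partial copies is at most |X|^(|VJ| - 1), and each has at most |X| / N extensions. Only
  the vertex sets of the copies are recorded, as it is sets that the sampling avoids.\<close>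

lemma few_copies:
  fixes X :: "'a set" and N :: real
  assumes fin: "finite X"
    and few: "\<And>g. partial_copy E X g \<Longrightarrow> N * real (card (extensions E X g)) \<le> real (card X)" and N: "0 < N"
  defines "B \<equiv> {f ` VJ | f. inj_on f VJ \<and> f ` VJ \<subseteq> X \<and> (\<forall>i\<in>VJ. \<forall>j\<in>VJ. i \<noteq> j \<longrightarrow> (E (f i) (f j) \<longleftrightarrow> PH i j))}"
  shows "N * real (card B) \<le> real (card X) ^ card VJ"
proof -
  define G where "G = {g \<in> VJ' \<rightarrow>\<^sub>E X. partial_copy E X g}"
  have finG: "finite G" unfolding G_def using finVJ' fin by (simp add: finite_PiE)
  have finS: "finite (Sigma G (extensions E X))"
    using finG fin by (intro finite_SigmaI) (auto simp: extensions_def)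
  have "B \<subseteq> (\<lambda>(g, x). insert x (g ` VJ')) ` Sigma G (extensions E X)"
  proof
    fix M assume "M \<in> B"
    then obtain f where f: "M = f ` VJ" "inj_on f VJ" "f ` VJ \<subseteq> X"
      "\<forall>i\<in>VJ. \<forall>j\<in>VJ. i \<noteq> j \<longrightarrow> (E (f i) (f j) \<longleftrightarrow> PH i j)" unfolding B_def by blast
    define g where "g = restrict f VJ'"
    have im: "g ` VJ' = f ` VJ'" by (auto simp: g_def)
    have sub: "VJ' \<subseteq> VJ" by (auto simp: VJ_eq)
    have "inj_on g VJ'" using f(2) sub by (auto simp: g_def inj_on_def)
    moreover have "g ` VJ' \<subseteq> X" using im f(3) sub by blast
    moreover have "\<forall>i\<in>VJ'. \<forall>j\<in>VJ'. i \<noteq> j \<longrightarrow> (E (g i) (g j) \<longleftrightarrow> PH i j)"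
      using f(4) sub by (auto simp: g_def)
    ultimately have "partial_copy E X g" by (simp add: partial_copy_def)
    moreover have "g \<in> VJ' \<rightarrow>\<^sub>E X" using f(3) sub by (auto simp: g_def)
    ultimately have gG: "g \<in> G" by (simp add: G_def)
    have "f u0 \<notin> f ` VJ'" using f(2) u0_VJ' sub by (auto simp: VJ_eq inj_on_def)
    moreover have "f u0 \<in> X" using f(3) by (auto simp: VJ_eq)
    moreover have "\<forall>i\<in>VJ'. E (f u0) (g i) \<longleftrightarrow> PH u0 i"
      using f(4) u0_VJ' by (auto simp: g_def VJ_eq)
    ultimately have "f u0 \<in> extensions E X g" by (simp add: extensions_def im)
    moreover have "M = insert (f u0) (g ` VJ')" using f(1) im by (simp add: VJ_eq)
    ultimately show "M \<in> (\<lambda>(g, x). insert x (g ` VJ')) ` Sigma G (extensions E X)" using gG by force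
  qed
  then have "card B \<le> card (Sigma G (extensions E X))"
    using finS by (meson card_image_le card_mono finite_imageI order_trans)
  also have "\<dots> = (\<Sum>g\<in>G. card (extensions E X g))"
    using finG fin by (intro card_SigmaI) (auto simp: extensions_def)
  finally have "N * real (card B) \<le> N * real (\<Sum>g\<in>G. card (extensions E X g))"
    using N by (intro mult_left_mono) (simp_all only: of_nat_mono)
  also have "\<dots> = (\<Sum>g\<in>G. N * real (card (extensions E X g)))" by (simp add: sum_distrib_left)
  also have "\<dots> \<le> (\<Sum>g\<in>G. real (card X))" using few by (intro sum_mono) (auto simp: G_def)
  also have "\<dots> = real (card G) * real (card X)" by simp
  also have "\<dots> \<le> real (card X ^ card VJ') * real (card X)"
  proof (intro mult_right_mono of_nat_mono)
    have "card G \<le> card (VJ' \<rightarrow>\<^sub>E X)"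
      using finVJ' fin by (intro card_mono) (auto simp: G_def finite_PiE)
    then show "card G \<le> card X ^ card VJ'" using card_funcsetE[OF finVJ', of X] by simp
  qed simp
  finally show ?thesis by (simp add: card_VJ mult.commute)
qed

text \<open>Otherwise copies of \<open>J\<close> would be so rare that some \<open>m\<close>-subset
  contains neither a copy of \<open>J\<close> nor a homogeneous set of size \<open>s\<close>. This
  contradicts the Erdos-Hajnal property \<open>EH\<close>, because \<open>s\<close> is at most
  \<open>m powr c\<close>.\<close>

lemma many_extensions:
  fixes E :: "'a \<Rightarrow> 'a \<Rightarrow> bool" and b c :: real
  assumes fin: "finite X" and irr: "irreflp E" and m: "32 \<le> m" "card VJ \<le> m" and b: "0 < b" "b \<le> 1"
    and s: "12 * ln (real m) / b + 2 \<le> real s" "s \<le> m" "real s \<le> real m powr c"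
    and n: "2 * real m ^ 5 \<le> real (card X)"
    and nores: "\<And>W. W \<subseteq> X \<Longrightarrow> real (card X) / real m ^ 5 \<le> real (card W) \<Longrightarrow> \<not> restricted_rel E b W"
    and EH: "\<And>M. M \<subseteq> X \<Longrightarrow> \<not> embeds E PH VJ M \<Longrightarrow> \<exists>S\<subseteq>M. homogeneous E S \<and> real (card M) powr c \<le> real (card S)"
  shows "\<exists>g. partial_copy E X g \<and> real (card X) < 4 * (2 * real m) ^ card VJ * real (card (extensions E X g))"
proof (rule ccontr)
  assume no: "\<not> ?thesis"
  \<comment> \<open>The power offsets the factors m^h and 2^h (with \<open>h = card VJ\<close>) in
    the sampling condition; half of the 4 offsets the 2 there, and the other half makes the
    inequality strict.\<close>
  define N where "N = 4 * (2 * real m) ^ card VJ"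
  define B where "B = {f ` VJ | f. inj_on f VJ \<and> f ` VJ \<subseteq> X \<and> (\<forall>i\<in>VJ. \<forall>j\<in>VJ. i \<noteq> j \<longrightarrow> (E (f i) (f j) \<longleftrightarrow> PH i j))}"
  have N0: "0 < N" using m by (simp add: N_def)
  have X0: "0 < real (card X)"
  proof -
    have "0 < 2 * real m ^ 5" using m by simp
    then show ?thesis using n by linarith
  qed
  have "N * real (card B) \<le> real (card X) ^ card VJ"
    unfolding B_def using no N0 fin by (intro few_copies) (auto simp: N_def not_less)
  then have "2 * (2 * real (card B) * real m ^ card VJ) * 2 ^ card VJ \<le> real (card X) ^ card VJ"
    by (simp add: N_def power_mult_distrib mult_ac)
  then have "2 * (2 * real (card B) * real m ^ card VJ) \<le> (real (card X) / 2) ^ card VJ"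
    by (simp add: power_divide field_simps)
  moreover have "0 < (real (card X) / 2) ^ card VJ" using X0 by simp
  ultimately have few: "2 * real (card B) * real m ^ card VJ < (real (card X) / 2) ^ card VJ" by linarith
  have Bsub: "S \<subseteq> X \<and> card S = card VJ" if "S \<in> B" for S
    using that by (auto simp: B_def card_image)
  obtain M where M: "M \<subseteq> X" "card M = m" "\<forall>S\<subseteq>M. card S = s \<longrightarrow> \<not> homogeneous E S" "\<forall>S\<in>B. \<not> S \<subseteq> M"
    using sample_without_homogeneous[OF fin irr m(1) b s(1,2) n nores Bsub m(2) few] by blast
  have "\<not> embeds E PH VJ M"
  proof
    assume "embeds E PH VJ M"
    then obtain f where f: "inj_on f VJ" "f ` VJ \<subseteq> M" "\<forall>i\<in>VJ. \<forall>j\<in>VJ. i \<noteq> j \<longrightarrow> (E (f i) (f j) \<longleftrightarrow> PH i j)"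
      unfolding embeds_def by blast
    then have "f ` VJ \<in> B" unfolding B_def using M(1) by blast
    with f(2) M(4) show False by blast
  qed
  from EH[OF M(1) this] obtain S where S: "S \<subseteq> M" "homogeneous E S" "real m powr c \<le> real (card S)"
    using M(2) by auto
  then have "s \<le> card S" using s(3) by linarith
  then obtain T where T: "T \<subseteq> S" "card T = s" by (metis obtain_subset_with_card_n)
  have "T \<subseteq> M" using T(1) S(1) by simp
  moreover have "homogeneous E T" using homogeneous_mono[OF S(2) T(1)] .
  ultimately show False using M(3) T(2) by blast
qed

text \<open>Otherwise \<open>x\<close> in the role of \<open>u0\<close> and \<open>y\<close> in the role of \<open>v0\<close> would turn \<open>g\<close> into an excluded
  copy of the whole pattern.\<close>

lemma extension_complete:
  assumes sym: "symp E" and free: "\<not> embeds E PH VH V" and g: "partial_copy E V g"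
    and x: "x \<in> extensions E V g" and y: "y \<in> V" "y \<noteq> x" "y \<notin> g ` VJ'" "\<forall>i\<in>VJ'. E y (g i)"
  shows "E x y"
proof (rule ccontr)
  assume no: "\<not> E x y"
  define f where "f = g(u0 := x, v0 := y)"
  have fx: "f u0 = x" "f v0 = y" "\<And>i. i \<in> VJ' \<Longrightarrow> f i = g i"
    using uv u0_VJ' v0_VJ' by (auto simp: f_def)
  have im: "f ` VJ' = g ` VJ'" using fx(3) by (auto simp: image_iff)
  have xs: "x \<in> V" "x \<notin> g ` VJ'" "\<forall>i\<in>VJ'. E x (g i) \<longleftrightarrow> PH u0 i"
    using x by (auto simp: extensions_def)
  have gs: "inj_on g VJ'" "g ` VJ' \<subseteq> V" "\<forall>i\<in>VJ'. \<forall>j\<in>VJ'. i \<noteq> j \<longrightarrow> (E (g i) (g j) \<longleftrightarrow> PH i j)"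
    using g by (auto simp: partial_copy_def)
  have "inj_on f VJ'" using gs(1) fx(3) by (auto simp: inj_on_def)
  then have "inj_on f (insert v0 (insert u0 VJ'))"
    using im fx xs(2) y(2,3) u0_VJ' v0_VJ' uv by (auto simp: inj_on_insert)
  then have inj: "inj_on f VH" by (simp only: VH_eq[symmetric])
  have "f ` (insert v0 (insert u0 VJ')) \<subseteq> V" using im fx xs(1) y(1) gs(2) by auto
  then have sub: "f ` VH \<subseteq> V" by (simp only: VH_eq[symmetric])
  have symE: "E a b \<longleftrightarrow> E b a" for a b using sym by (auto dest: sympD)
  have PHv: "PH v0 i" if "i \<in> VJ'" for i using that PH_other[of i] by (auto simp: VJ'_def)
  have adj: "E (f i) (f j) \<longleftrightarrow> PH i j" if "i \<in> VH" "j \<in> VH" "i \<noteq> j" for i j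
  proof -
    have 1: "E (f u0) (f v0) \<longleftrightarrow> PH u0 v0" using no fx PH_leaf PH_sym by simp
    have 2: "E (f u0) (f k) \<longleftrightarrow> PH u0 k" if "k \<in> VJ'" for k using that fx xs(3) by simp
    have 3: "E (f v0) (f k) \<longleftrightarrow> PH v0 k" if "k \<in> VJ'" for k using that fx y(4) PHv by simp
    have 4: "E (f k) (f l) \<longleftrightarrow> PH k l" if "k \<in> VJ'" "l \<in> VJ'" "k \<noteq> l" for k l using that fx(3) gs(3) by simp
    have "i = v0 \<or> i = u0 \<or> i \<in> VJ'" "j = v0 \<or> j = u0 \<or> j \<in> VJ'"
      using that by (auto simp: VJ'_def)
    then show ?thesis using 1 2 3 4 that(3) symE PH_sym by metis
  qed
  have "embeds E PH VH V"
    unfolding embeds_def using inj sub adj by (intro exI[of _ f]) simp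
  with free show False by blast
qed

text \<open>All extensions of a partial copy are adjacent to every vertex outside that is complete
  to the copy, and in a set with sparse complement few vertices fail to be. The block is cut down to
  at most \<open>q * card W\<close> vertices because it is itself lost for the later rounds.\<close>

lemma cosparse_step:
  fixes E :: "'a \<Rightarrow> 'a \<Rightarrow> bool"
  assumes finW: "finite W" and sym: "symp E" and q: "0 < q" "q \<le> 1"
    and low: "low_degree (co E) (q ^ 2) W" and YW: "Y \<subseteq> W" and big: "1 \<le> q * real (card W)"
    and free: "\<not> embeds E PH VH W" and g: "partial_copy E Y g"
    and ext: "p \<le> real (card (extensions E Y g))" and p: "p \<le> q * real (card W) / 2"
  shows "\<exists>P\<subseteq>Y. \<exists>Q\<subseteq>Y. P \<inter> Q = {} \<and> p \<le> real (card P) \<and>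
      real (card Y) - (2 * real (card VJ) + 1) * q * real (card W) \<le> real (card Q) \<and> complete_pair E P Q"
proof -
  let ?w = "real (card W)" and ?U = "extensions E Y g"
  have finY: "finite Y" using finW YW finite_subset by blast
  have UY: "?U \<subseteq> Y" by (auto simp: extensions_def)
  have finU: "finite ?U" using UY finY finite_subset by blast
  obtain P where P: "P \<subseteq> ?U" "real (card P) \<le> q * ?w" "p \<le> real (card P)"
  proof (cases "real (card ?U) \<le> q * ?w")
    case True
    then show ?thesis using that[of ?U] ext by blast
  next
    case False
    \<comment> \<open>\<open>q * card W\<close> is at least 1, so rounding it down loses at most a
      factor 2; this is where the bound on \<open>p\<close> comes from.\<close>
    define k where "k = nat \<lfloor>q * ?w\<rfloor>"
    have k: "real k \<le> q * ?w" "q * ?w < real k + 1" unfolding k_def using big by linarith+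
    have "k \<le> card ?U" using k(1) False by linarith
    then obtain P where "P \<subseteq> ?U" "card P = k" by (metis obtain_subset_with_card_n)
    moreover have "p \<le> real k"
    proof -
      have "1 \<le> real k" using k big by (metis One_nat_def Suc_leI add.commute add_0 gr0I leD of_nat_0 of_nat_1 of_nat_le_iff)
      then show ?thesis using k p by linarith
    qed
    ultimately show ?thesis using that[of P] k by blast
  qed
  define Z where "Z = (\<Union>i\<in>VJ'. insert (g i) (nbhd (co E) (g i) W))"
  define Q where "Q = Y - P - Z"
  have gW: "g i \<in> W" if "i \<in> VJ'" for i using g that YW by (auto simp: partial_copy_def)
  have finZ: "finite Z" unfolding Z_def using finVJ' finW by (auto simp: finite_nbhd)
  have qq: "q ^ 2 * ?w \<le> q * ?w" using q by (simp add: power2_eq_square mult_right_mono)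
  have "real (card Z) \<le> (\<Sum>i\<in>VJ'. real (card (insert (g i) (nbhd (co E) (g i) W))))"
    unfolding Z_def using card_UN_le[OF finVJ'] by (simp flip: of_nat_sum)
  also have "\<dots> \<le> (\<Sum>i\<in>VJ'. 2 * q * ?w)"
  proof (rule sum_mono)
    fix i assume i: "i \<in> VJ'"
    have "real (card (insert (g i) (nbhd (co E) (g i) W))) \<le> 1 + real (card (nbhd (co E) (g i) W))"
      using card_insert_le_m1[of "Suc (card (nbhd (co E) (g i) W))"] by (simp add: card_insert_if finite_nbhd finW)
    also have "\<dots> \<le> q * ?w + q ^ 2 * ?w" using low gW[OF i] big by (auto simp: low_degree_def)
    also have "\<dots> \<le> 2 * q * ?w" using qq by simp
    finally show "real (card (insert (g i) (nbhd (co E) (g i) W))) \<le> 2 * q * ?w" .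
  qed
  also have "\<dots> = real (card VJ') * (2 * q * ?w)" by simp
  also have "\<dots> \<le> real (card VJ) * (2 * q * ?w)"
    using q by (intro mult_right_mono) (auto simp: card_VJ)
  finally have cZ: "real (card Z) \<le> real (card VJ) * (2 * q * ?w)" .
  have "card Y \<le> card (Q \<union> P \<union> Z)"
    using finY finZ P(1) finU by (intro card_mono) (auto simp: Q_def intro: finite_subset)
  also have "\<dots> \<le> card Q + card P + card Z" by (meson add_mono card_Un_le order_refl order_trans)
  finally have "real (card Y) \<le> real (card Q) + real (card P) + real (card Z)" by linarith
  then have cQ: "real (card Y) - (2 * real (card VJ) + 1) * q * ?w \<le> real (card Q)"
    using cZ P(2) by (simp add: algebra_simps)
  have gW': "partial_copy E W g" using g YW by (auto simp: partial_copy_def)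
  have "complete_pair E P Q"
    unfolding complete_pair_def
  proof (intro ballI)
    fix x y assume xy: "x \<in> P" "y \<in> Q"
    have "x \<in> extensions E W g" using xy(1) P(1) YW by (auto simp: extensions_def)
    moreover have "y \<in> W" "y \<noteq> x" "y \<notin> g ` VJ'" using xy YW by (auto simp: Q_def Z_def)
    moreover have "\<forall>i\<in>VJ'. E y (g i)"
    proof
      fix i assume i: "i \<in> VJ'"
      have "y \<noteq> g i" "y \<notin> nbhd (co E) (g i) W" using xy(2) i by (auto simp: Q_def Z_def)
      then have "E (g i) y" using \<open>y \<in> W\<close> by (auto simp: nbhd_def co_def)
      then show "E y (g i)" using sym by (auto dest: sympD)
    qed
    ultimately show "E x y" using extension_complete[OF sym free gW'] by blast
  qed
  moreover have "P \<subseteq> Y" "Q \<subseteq> Y" "P \<inter> Q = {}" using P(1) UY by (auto simp: Q_def)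
  ultimately show ?thesis using P(3) cQ by blast
qed

end

subsection \<open>Refining a short blockade\<close>

text \<open>An average condition that, unlike \<open>sparse_from\<close>, is not inherited by
  subsets on either side. It is claimed only for blocks that are not subdivided any further:
  \<open>step_rel\<close> relates the blocks of one subdivision, \<open>final_rel\<close> those of
  the result.\<close>

definition few_edges :: "('a \<Rightarrow> 'a \<Rightarrow> bool) \<Rightarrow> real \<Rightarrow> 'a set \<Rightarrow> 'a set \<Rightarrow> bool" where
  "few_edges E \<tau> P Q \<longleftrightarrow> (\<Sum>x\<in>P. real (card (nbhd E x Q))) \<le> \<tau> * real (card P) * real (card Q)"

definition step_rel :: "('a \<Rightarrow> 'a \<Rightarrow> bool) \<Rightarrow> real \<Rightarrow> 'a set \<Rightarrow> 'a set \<Rightarrow> bool" where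
  "step_rel E \<sigma> P Q \<longleftrightarrow> P \<inter> Q = {} \<and> (complete_pair E P Q \<or> sparse_from E \<sigma> P Q)"

definition final_rel :: "('a \<Rightarrow> 'a \<Rightarrow> bool) \<Rightarrow> real \<Rightarrow> 'a set \<Rightarrow> 'a set \<Rightarrow> bool" where
  "final_rel E \<tau> P Q \<longleftrightarrow> P \<inter> Q = {} \<and> (complete_pair E P Q \<or> few_edges E \<tau> P Q)"

text \<open>Counting from the side of \<open>Q'\<close> makes the bound valid however small
  \<open>Q'\<close> is in \<open>Q\<close>.\<close>

lemma sparse_from_edges:
  assumes "symp E" "finite P" "finite Q" "sparse_from E \<sigma> P Q" "Q' \<subseteq> Q"
  shows "(\<Sum>x\<in>P. real (card (nbhd E x Q'))) \<le> \<sigma> * real (card P) * real (card Q')"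
proof -
  have finQ': "finite Q'" using assms finite_subset by blast
  have swap: "{a \<in> P. E a b} = nbhd E b P" for b using assms(1) by (auto simp: nbhd_def dest: sympD)
  have "(\<Sum>x\<in>P. real (card (nbhd E x Q'))) = real (\<Sum>y\<in>Q'. card (nbhd E y P))"
    using double_count[OF assms(2) finQ', of E] by (simp add: swap flip: of_nat_sum)
  also have "\<dots> = (\<Sum>y\<in>Q'. real (card (nbhd E y P)))" by simp
  also have "\<dots> \<le> (\<Sum>y\<in>Q'. \<sigma> * real (card P))"
    using assms(4,5) by (intro sum_mono) (auto simp: sparse_from_def)
  finally show ?thesis by (simp add: mult_ac)
qed

text \<open>Before subdividing the block \<open>P\<close>, discard its vertices with too many neighbours in one of
  the final blocks that were already found inside later blocks.\<close>

lemma clean_block: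
  assumes sym: "symp E" and fin: "finite P" and tau: "0 < \<tau>"
    and later: "\<forall>Q\<in>set Qs. finite Q \<and> (complete_pair E P Q \<or> sparse_from E (\<tau> ^ 2) P Q)"
    and len: "2 * real (length Qs) * \<tau> \<le> 1"
  shows "\<exists>P'\<subseteq>P. real (card P) \<le> 2 * real (card P') \<and>
    (\<forall>Q\<in>set Qs. \<forall>P''\<subseteq>P'. complete_pair E P'' Q \<or> few_edges E \<tau> P'' Q)"
proof -
  define bad where "bad Q = {x \<in> P. \<not> real (card (nbhd E x Q)) \<le> \<tau> * real (card Q)}" for Q
  define N where "N = {Q \<in> set Qs. \<not> complete_pair E P Q}"
  define P' where "P' = P - (\<Union>Q\<in>N. bad Q)"
  have finN: "finite N" by (simp add: N_def)
  \<comment> \<open>Markov's inequality turns \<tau>^2 into \<tau>: at most a proportion \<tau> of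
    \<open>P\<close> is bad for \<open>Q\<close>. With at most 1 / (2 * \<tau>) sets
    \<open>Q\<close>, half of \<open>P\<close> is good for all of them.\<close>
  have cbad: "real (card (bad Q)) \<le> \<tau> * real (card P)" if Q: "Q \<in> N" for Q
  proof (cases "card Q = 0")
    case True
    have "finite Q" using later Q unfolding N_def by blast
    then have "Q = {}" using True by simp
    then have "bad Q = {}" by (auto simp: bad_def nbhd_def)
    then show ?thesis using tau by simp
  next
    case False
    have Q': "finite Q" "sparse_from E (\<tau> ^ 2) P Q" using later Q unfolding N_def by blast+
    have "\<tau> * real (card Q) * real (card (bad Q)) \<le> (\<Sum>x\<in>P. real (card (nbhd E x Q)))"
      unfolding bad_def using fin tau by (intro markov_count) auto
    also have "\<dots> \<le> \<tau> ^ 2 * real (card P) * real (card Q)"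
      by (rule sparse_from_edges[OF sym fin Q' subset_refl])
    finally have "(\<tau> * real (card Q)) * real (card (bad Q)) \<le> (\<tau> * real (card Q)) * (\<tau> * real (card P))"
      by (simp add: power2_eq_square mult_ac)
    then show ?thesis using tau False by (subst (asm) mult_le_cancel_left_pos) auto
  qed
  have "card (\<Union>Q\<in>N. bad Q) \<le> (\<Sum>Q\<in>N. card (bad Q))" by (rule card_UN_le[OF finN])
  then have "real (card (\<Union>Q\<in>N. bad Q)) \<le> (\<Sum>Q\<in>N. real (card (bad Q)))" by (simp flip: of_nat_sum)
  also have "\<dots> \<le> (\<Sum>Q\<in>N. \<tau> * real (card P))" using cbad by (rule sum_mono)
  also have "\<dots> = real (card N) * (\<tau> * real (card P))" by simp
  also have "\<dots> \<le> real (length Qs) * (\<tau> * real (card P))"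
  proof (intro mult_right_mono of_nat_mono)
    have "card N \<le> card (set Qs)" by (intro card_mono) (auto simp: N_def)
    then show "card N \<le> length Qs" using card_length[of Qs] by linarith
  qed (use tau in auto)
  also have "\<dots> \<le> (1 / 2) * real (card P)"
  proof -
    have "(real (length Qs) * \<tau>) * real (card P) \<le> (1 / 2) * real (card P)"
      using len by (intro mult_right_mono) auto
    then show ?thesis by (simp only: mult.assoc)
  qed
  finally have cU: "real (card (\<Union>Q\<in>N. bad Q)) \<le> real (card P) / 2" by simp
  have sub: "(\<Union>Q\<in>N. bad Q) \<subseteq> P" by (auto simp: bad_def)
  have "real (card P') = real (card P) - real (card (\<Union>Q\<in>N. bad Q))"
    unfolding P'_def using card_Diff_subset[OF finite_subset[OF sub fin] sub] card_mono[OF fin sub] by simp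
  then have "real (card P) \<le> 2 * real (card P')" using cU by linarith
  moreover have "complete_pair E P'' Q \<or> few_edges E \<tau> P'' Q" if "Q \<in> set Qs" "P'' \<subseteq> P'" for Q P''
  proof (cases "Q \<in> N")
    case False
    then have "complete_pair E P Q" using that(1) by (simp add: N_def)
    then show ?thesis using that(2) by (auto simp: complete_pair_def P'_def)
  next
    case True
    have "real (card (nbhd E x Q)) \<le> \<tau> * real (card Q)" if "x \<in> P''" for x
      using that \<open>P'' \<subseteq> P'\<close> True by (auto simp: P'_def bad_def)
    then have "(\<Sum>x\<in>P''. real (card (nbhd E x Q))) \<le> (\<Sum>x\<in>P''. \<tau> * real (card Q))"
      by (rule sum_mono)
    then show ?thesis by (simp add: few_edges_def mult_ac)
  qed
  moreover have "P' \<subseteq> P" by (auto simp: P'_def)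
  ultimately show ?thesis by blast
qed

text \<open>A subdivision into \<open>k\<close> blocks costs a factor k^D. As long as more blocks
  are wanted than it supplies, the numbers \<open>k\<close> along a branch have product at most
  \<open>K\<close>, so these steps cost at most K^D. The last subdivision may be longer than needed,
  which is paid for by M^D. The additional factor \<open>K\<close> covers the halving by cleaning at
  each level, as each \<open>k\<close> is at least 2. The number \<open>j\<close> bounds the
  depth.\<close>

lemma blockade_recursion:
  fixes E :: "'a \<Rightarrow> 'a \<Rightarrow> bool" and \<tau> x0 M :: real and D :: nat
  assumes sym: "symp E" and finV: "finite V" and tau: "0 < \<tau>" "\<tau> \<le> 1" and x0: "0 \<le> x0" and M: "1 \<le> M"
    and step: "\<And>X. X \<subseteq> V \<Longrightarrow> x0 \<le> real (card X) \<Longrightarrow>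
      \<exists>Ps. 2 \<le> length Ps \<and> real (length Ps) \<le> M \<and>
        (\<forall>P\<in>set Ps. P \<subseteq> X \<and> real (card X) \<le> real (length Ps) ^ D * real (card P)) \<and>
        sorted_wrt (step_rel E (\<tau> ^ 2)) Ps"
  shows "1 \<le> K \<Longrightarrow> K \<le> 2 ^ j \<Longrightarrow> 4 * K * \<tau> \<le> 1 \<Longrightarrow> X \<subseteq> V \<Longrightarrow> x0 * M ^ D * K ^ (D + 1) \<le> real (card X) \<Longrightarrow>
    \<exists>Qs. length Qs = nat \<lceil>K\<rceil> \<and> (\<forall>Q\<in>set Qs. Q \<subseteq> X \<and> real (card X) \<le> M ^ D * K ^ (D + 1) * real (card Q)) \<and>
      sorted_wrt (final_rel E \<tau>) Qs"
proof (induction j arbitrary: K X)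
  case 0
  then have K: "K = 1" by simp
  have "1 \<le> M ^ D" using M by simp
  then have "1 * real (card X) \<le> M ^ D * real (card X)" by (rule mult_right_mono) simp
  then show ?case using K by (intro exI[of _ "[X]"]) simp
next
  case (Suc j)
  have finX: "finite X" using Suc.prems(4) finV finite_subset by blast
  have MD: "1 \<le> M ^ D" using M by simp
  have KD: "1 \<le> K ^ (D + 1)" using Suc.prems(1) by (rule one_le_power)
  have MK: "1 \<le> M ^ D * K ^ (D + 1)" using mult_mono[OF MD KD] MD by simp
  have "x0 * 1 \<le> x0 * (M ^ D * K ^ (D + 1))" using MK x0 by (rule mult_left_mono)
  then have "x0 \<le> real (card X)" using Suc.prems(5) by (simp add: mult.assoc)
  from step[OF Suc.prems(4) this] obtain Ps where Ps: "2 \<le> length Ps" "real (length Ps) \<le> M"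
    "\<And>P. P \<in> set Ps \<Longrightarrow> P \<subseteq> X \<and> real (card X) \<le> real (length Ps) ^ D * real (card P)"
    "sorted_wrt (step_rel E (\<tau> ^ 2)) Ps" by blast
  define k where "k = length Ps"
  have kD: "real k ^ D \<le> M ^ D" unfolding k_def using Ps(2) by (intro power_mono) auto
  have k2: "2 \<le> real k" using Ps(1) by (simp add: k_def)
  show ?case
  proof (cases "K \<le> real k")
    case True
    define Qs where "Qs = take (nat \<lceil>K\<rceil>) Ps"
    have "nat \<lceil>K\<rceil> \<le> k" using True by (simp add: nat_le_iff ceiling_le_iff)
    then have "length Qs = nat \<lceil>K\<rceil>" by (simp add: Qs_def k_def)
    moreover have "Q \<subseteq> X \<and> real (card X) \<le> M ^ D * K ^ (D + 1) * real (card Q)" if "Q \<in> set Qs" for Q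
    proof -
      have Q: "Q \<subseteq> X" "real (card X) \<le> real k ^ D * real (card Q)"
        using Ps(3)[of Q] that by (auto simp: Qs_def k_def dest: in_set_takeD)
      have "real k ^ D * 1 \<le> M ^ D * K ^ (D + 1)" using kD KD MD by (intro mult_mono) auto
      then have "real k ^ D * real (card Q) \<le> M ^ D * K ^ (D + 1) * real (card Q)"
        by (intro mult_right_mono) auto
      with Q show ?thesis by linarith
    qed
    moreover have "sorted_wrt (final_rel E \<tau>) Qs"
    proof (rule sorted_wrt_mono_rel[of _ "step_rel E (\<tau> ^ 2)"])
      show "sorted_wrt (step_rel E (\<tau> ^ 2)) Qs" using Ps(4) by (simp add: Qs_def sorted_wrt_take)
      fix P Q assume PQ: "P \<in> set Qs" "Q \<in> set Qs" "step_rel E (\<tau> ^ 2) P Q"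
      have fin: "finite P" "finite Q"
        using PQ(1,2) Ps(3) finX by (auto simp: Qs_def dest!: in_set_takeD intro: finite_subset)
      have t2: "\<tau> ^ 2 \<le> \<tau>" using tau by (simp add: power2_eq_square mult_left_le)
      have "few_edges E \<tau> P Q" if "sparse_from E (\<tau> ^ 2) P Q"
      proof -
        have "(\<Sum>x\<in>P. real (card (nbhd E x Q))) \<le> \<tau> ^ 2 * real (card P) * real (card Q)"
          by (rule sparse_from_edges[OF sym fin that subset_refl])
        also have "\<dots> \<le> \<tau> * real (card P) * real (card Q)" using t2 by (intro mult_right_mono) auto
        finally show ?thesis by (simp add: few_edges_def)
      qed
      then show "final_rel E \<tau> P Q" using PQ(3) by (auto simp: step_rel_def final_rel_def)
    qed
    ultimately show ?thesis by blast
  next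
    case False
    define K' where "K' = K / real k"
    have K': "1 \<le> K'" "K' \<le> 2 ^ j" "4 * K' * \<tau> \<le> 1" "K = real k * K'"
    proof -
      show "1 \<le> K'" "K = real k * K'" using False k2 by (auto simp: K'_def)
      have "K' \<le> K / 2" unfolding K'_def using k2 Suc.prems(1) by (intro divide_left_mono) auto
      then show "K' \<le> 2 ^ j" using Suc.prems(2) by simp
      have "K' \<le> K" using \<open>K' \<le> K / 2\<close> Suc.prems(1) by linarith
      then have "4 * K' * \<tau> \<le> 4 * K * \<tau>" using tau by (intro mult_right_mono) auto
      then show "4 * K' * \<tau> \<le> 1" using Suc.prems(3) by linarith
    qed
    \<comment> \<open>Every block of the subdivision is to supply \<open>c\<close> blocks. Since
      \<open>1 \<le> K'\<close>, rounding up gives at most \<open>2 * K\<close> blocks in all, and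
      cleaning against that many is possible because \<open>4 * K * \<tau> \<le> 1\<close>.\<close>
    define c where "c = nat \<lceil>K'\<rceil>"
    have c: "K' \<le> real c" "real c \<le> K' + 1" unfolding c_def using K'(1) by linarith+
    have pw: "2 * real k ^ D * (M ^ D * K' ^ (D + 1)) \<le> M ^ D * K ^ (D + 1)"
    proof -
      have "2 * real k ^ D * (M ^ D * K' ^ (D + 1)) \<le> real k * real k ^ D * (M ^ D * K' ^ (D + 1))"
        using k2 K' M by (intro mult_right_mono) auto
      also have "\<dots> = M ^ D * K ^ (D + 1)" by (simp add: K'(4) power_mult_distrib mult_ac)
      finally show ?thesis .
    qed
    \<comment> \<open>The blocks are treated from the last to the first. \<open>P\<close> is still
      complete or sparse, in the one-sided sense, towards the final blocks inside later ones; it is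
      cleaned against them and only then subdivided.\<close>
    have "\<exists>Qs. length Qs = length Ps' * c \<and>
        (\<forall>Q\<in>set Qs. (\<exists>P\<in>set Ps'. Q \<subseteq> P) \<and> real (card X) \<le> M ^ D * K ^ (D + 1) * real (card Q)) \<and>
        sorted_wrt (final_rel E \<tau>) Qs"
      if "set Ps' \<subseteq> set Ps" "sorted_wrt (step_rel E (\<tau> ^ 2)) Ps'" "length Ps' \<le> k" for Ps'
      using that
    proof (induction Ps')
      case Nil
      show ?case by (intro exI[of _ "[]"]) simp
    next
      case (Cons P Ps')
      have "set Ps' \<subseteq> set Ps" "sorted_wrt (step_rel E (\<tau> ^ 2)) Ps'" "length Ps' \<le> k"
        using Cons.prems by simp_all
      from Cons.IH[OF this] obtain Qs where Qs: "length Qs = length Ps' * c" "sorted_wrt (final_rel E \<tau>) Qs"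
        and Qs': "\<forall>Q\<in>set Qs. (\<exists>P\<in>set Ps'. Q \<subseteq> P) \<and> real (card X) \<le> M ^ D * K ^ (D + 1) * real (card Q)"
        by blast
      have P: "P \<subseteq> X" "real (card X) \<le> real k ^ D * real (card P)"
        using Ps(3)[of P] Cons.prems(1) by (auto simp: k_def)
      have finP: "finite P" using P(1) finX finite_subset by blast
      have later: "P \<inter> Q = {}" "finite Q" "complete_pair E P Q \<or> sparse_from E (\<tau> ^ 2) P Q"
        if Q: "Q \<in> set Qs" for Q
      proof -
        obtain P2 where P2: "P2 \<in> set Ps'" "Q \<subseteq> P2" using Qs' Q by blast
        have "P2 \<subseteq> X" using Ps(3)[of P2] P2(1) Cons.prems(1) by auto
        then have "Q \<subseteq> X" using P2(2) by simp
        then show "finite Q" by (rule finite_subset[OF _ finX])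
        have "step_rel E (\<tau> ^ 2) P P2" using Cons.prems(2) P2(1) by simp
        then show "P \<inter> Q = {}" "complete_pair E P Q \<or> sparse_from E (\<tau> ^ 2) P Q"
          using P2(2) by (auto simp: step_rel_def complete_pair_def sparse_from_def)
      qed
      have len: "2 * real (length Qs) * \<tau> \<le> 1"
      proof -
        have "length Ps' \<le> k" using Cons.prems(3) by simp
        then have "length Qs \<le> k * c" unfolding Qs(1) by (rule mult_le_mono1)
        then have "real (length Qs) \<le> real k * real c" by (metis of_nat_le_iff of_nat_mult)
        also have "\<dots> \<le> real k * (K' + 1)" using c by (intro mult_left_mono) auto
        also have "\<dots> \<le> 2 * K" using K'(1,4) k2 by (simp add: distrib_left mult_le_cancel_left1)
        finally have "2 * real (length Qs) * \<tau> \<le> 2 * (2 * K) * \<tau>"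
          using tau by (intro mult_right_mono mult_left_mono) auto
        also have "2 * (2 * K) * \<tau> = 4 * K * \<tau>" by simp
        also note Suc.prems(3)
        finally show ?thesis .
      qed
      have later': "\<forall>Q\<in>set Qs. finite Q \<and> (complete_pair E P Q \<or> sparse_from E (\<tau> ^ 2) P Q)"
        by (intro ballI conjI later(2) later(3))
      from clean_block[OF sym finP tau(1) later' len]
      obtain P' where P': "P' \<subseteq> P" "real (card P) \<le> 2 * real (card P')"
        and P'3: "\<forall>Q\<in>set Qs. \<forall>P''\<subseteq>P'. complete_pair E P'' Q \<or> few_edges E \<tau> P'' Q" by blast
      have P'V: "P' \<subseteq> V" using P'(1) P(1) Suc.prems(4) by simp
      have XP': "real (card X) \<le> 2 * real k ^ D * real (card P')"
      proof -
        have "real k ^ D * real (card P) \<le> real k ^ D * (2 * real (card P'))"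
          using P'(2) by (intro mult_left_mono) auto
        then show ?thesis using P(2) by simp
      qed
      have "x0 * M ^ D * K' ^ (D + 1) \<le> real (card P')"
      proof -
        have "(2 * real k ^ D) * (x0 * (M ^ D * K' ^ (D + 1))) = x0 * (2 * real k ^ D * (M ^ D * K' ^ (D + 1)))"
          by simp
        also have "\<dots> \<le> x0 * (M ^ D * K ^ (D + 1))" using pw x0 by (rule mult_left_mono)
        also have "\<dots> \<le> (2 * real k ^ D) * real (card P')" using Suc.prems(5) XP' by (simp add: mult.assoc)
        finally have "x0 * (M ^ D * K' ^ (D + 1)) \<le> real (card P')"
          using k2 by (subst (asm) mult_le_cancel_left_pos) auto
        then show ?thesis by (simp add: mult.assoc)
      qed
      from Suc.IH[OF K'(1-3) P'V this] obtain Qs1 where Qs1: "length Qs1 = c" "sorted_wrt (final_rel E \<tau>) Qs1"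
        and Qs1': "\<forall>Q\<in>set Qs1. Q \<subseteq> P' \<and> real (card P') \<le> M ^ D * K' ^ (D + 1) * real (card Q)"
        unfolding c_def by blast
      have big1: "real (card X) \<le> M ^ D * K ^ (D + 1) * real (card Q)" if Q: "Q \<in> set Qs1" for Q
      proof -
        have "real (card P') \<le> M ^ D * K' ^ (D + 1) * real (card Q)" using Qs1' Q by blast
        then have "2 * real k ^ D * real (card P') \<le> 2 * real k ^ D * (M ^ D * K' ^ (D + 1) * real (card Q))"
          by (rule mult_left_mono) simp
        then have "real (card X) \<le> 2 * real k ^ D * (M ^ D * K' ^ (D + 1) * real (card Q))"
          using XP' by linarith
        also have "\<dots> = (2 * real k ^ D * (M ^ D * K' ^ (D + 1))) * real (card Q)" by (simp only: mult.assoc)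
        also have "\<dots> \<le> M ^ D * K ^ (D + 1) * real (card Q)" using pw by (rule mult_right_mono) simp
        finally show ?thesis .
      qed
      have cross: "final_rel E \<tau> Q1 Q" if "Q1 \<in> set Qs1" "Q \<in> set Qs" for Q1 Q
      proof -
        have "Q1 \<subseteq> P'" using Qs1' that(1) by blast
        then have "complete_pair E Q1 Q \<or> few_edges E \<tau> Q1 Q" using P'3 that(2) by blast
        moreover have "Q1 \<inter> Q = {}" using later(1)[OF that(2)] \<open>Q1 \<subseteq> P'\<close> P'(1) by blast
        ultimately show ?thesis by (simp add: final_rel_def)
      qed
      show ?case
      proof (intro exI[of _ "Qs1 @ Qs"] conjI ballI)
        show "length (Qs1 @ Qs) = length (P # Ps') * c" using Qs1(1) Qs(1) by simp
        show "sorted_wrt (final_rel E \<tau>) (Qs1 @ Qs)"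
          using Qs1(2) Qs(2) cross by (simp add: sorted_wrt_append)
        fix Q assume "Q \<in> set (Qs1 @ Qs)"
        then consider "Q \<in> set Qs1" | "Q \<in> set Qs" by auto
        then show "\<exists>P\<in>set (P # Ps'). Q \<subseteq> P"
        proof cases
          case 1 then show ?thesis using Qs1' P'(1) by auto
        next
          case 2 then show ?thesis using Qs' by auto
        qed
        show "real (card X) \<le> M ^ D * K ^ (D + 1) * real (card Q)"
          using \<open>Q \<in> set (Qs1 @ Qs)\<close> big1 Qs' by auto
      qed
    qed
    from this[OF subset_refl Ps(4)] obtain Qs where Qs: "length Qs = k * c" "sorted_wrt (final_rel E \<tau>) Qs"
      and Qs': "\<forall>Q\<in>set Qs. (\<exists>P\<in>set Ps. Q \<subseteq> P) \<and> real (card X) \<le> M ^ D * K ^ (D + 1) * real (card Q)"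
      unfolding k_def by blast
    have "K \<le> real (k * c)" using c(1) K'(4) by (simp add: mult_left_mono)
    then have "nat \<lceil>K\<rceil> \<le> k * c" by (metis ceiling_le_iff nat_le_iff of_int_of_nat_eq)
    then have "length (take (nat \<lceil>K\<rceil>) Qs) = nat \<lceil>K\<rceil>" using Qs(1) by simp
    moreover have "Q \<subseteq> X \<and> real (card X) \<le> M ^ D * K ^ (D + 1) * real (card Q)"
      if "Q \<in> set (take (nat \<lceil>K\<rceil>) Qs)" for Q
      using in_set_takeD[OF that] Qs' Ps(3) by (meson subset_trans)
    moreover have "sorted_wrt (final_rel E \<tau>) (take (nat \<lceil>K\<rceil>) Qs)"
      using Qs(2) by (rule sorted_wrt_take)
    ultimately show ?thesis by blast
  qed
qed

subsection \<open>Descent through restricted sets\<close>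

text \<open>\<open>m\<close> is about z^A with A = 32 / min c 1, so that \<open>s\<close>, about
  m^(min c 1), is about z^32 and dominates the term ln m * z^16. The minimum with 1 ensures
  \<open>s \<le> m\<close>, and \<open>C\<close> collects the exponents of the polynomial
  bounds.\<close>

lemma sampling_parameters:
  fixes c :: real and h :: nat
  assumes "0 < c"
  shows "\<exists>z1\<ge>1. \<exists>C::nat. \<forall>z\<ge>z1. \<exists>m s :: nat. 32 \<le> m \<and> h \<le> m \<and> 12 * ln (real m) / (1 / z ^ 16) + 2 \<le> real s \<and>
    s \<le> m \<and> real s \<le> real m powr c \<and> 2 * real m ^ 5 \<le> z ^ C \<and> 4 * (2 * real m) ^ h \<le> z ^ C"
proof -
  define c' where "c' = min c 1"
  have c': "0 < c'" "c' \<le> c" "c' \<le> 1" using assms by (auto simp: c'_def)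
  define A where "A = 32 / c'"
  have A: "32 \<le> A" "A * c' = 32" using c' by (auto simp: A_def field_simps)
  define a where "a = nat \<lceil>A\<rceil>"
  have a: "A \<le> real a" unfolding a_def by linarith
  have A0: "0 < A" using A by simp
  have "eventually (\<lambda>z::real. 12 * (ln 2 + A * ln z) * z ^ 16 + 3 \<le> z ^ 32) at_top"
    by real_asymp
  moreover have "eventually (\<lambda>z::real. 32 + real h \<le> z powr A) at_top"
    using A0 by real_asymp
  ultimately have "eventually (\<lambda>z::real. 12 * (ln 2 + A * ln z) * z ^ 16 + 3 \<le> z ^ 32 \<and> 32 + real h \<le> z powr A \<and> 2 \<le> z) at_top"
    using eventually_ge_at_top[of "2::real"] by eventually_elim simp
  then obtain z1 where z1: "\<And>z. z1 \<le> z \<Longrightarrow> 12 * (ln 2 + A * ln z) * z ^ 16 + 3 \<le> z ^ 32 \<and> 32 + real h \<le> z powr A \<and> 2 \<le> z"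
    unfolding eventually_at_top_linorder by blast
  define C where "C = 6 + 5 * a + (2 + 2 * h + a * h)"
  have "\<exists>m s :: nat. 32 \<le> m \<and> h \<le> m \<and> 12 * ln (real m) / (1 / z ^ 16) + 2 \<le> real s \<and>
    s \<le> m \<and> real s \<le> real m powr c \<and> 2 * real m ^ 5 \<le> z ^ C \<and> 4 * (2 * real m) ^ h \<le> z ^ C"
    if z: "max z1 1 \<le> z" for z
  proof -
    have z2: "2 \<le> z" and zA: "32 + real h \<le> z powr A"
      and zln: "12 * (ln 2 + A * ln z) * z ^ 16 + 3 \<le> z ^ 32" using z1[of z] z by auto
    define u where "u = z powr A"
    define m where "m = nat \<lceil>u\<rceil>"
    define s where "s = nat \<lfloor>real m powr c'\<rfloor>"
    have u: "32 + real h \<le> u" using zA by (simp add: u_def)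
    have m: "u \<le> real m" "real m \<le> 2 * u" unfolding m_def using u by linarith+
    have m32: "32 \<le> m" "h \<le> m" using u m(1) by linarith+
    have s: "real s \<le> real m powr c'" "real m powr c' - 1 \<le> real s"
      unfolding s_def using powr_ge_zero[of "real m" c'] by linarith+
    have "real m powr c' \<le> real m powr 1" using c' m32 by (intro powr_mono) auto
    then have "real s \<le> real m" using s(1) m32 by simp
    then have sm: "s \<le> m" by simp
    have "real m powr c' \<le> real m powr c" using c' m32 by (intro powr_mono) auto
    then have sc: "real s \<le> real m powr c" using s(1) by linarith
    have "u powr c' = z powr real 32" using A(2) by (simp add: u_def powr_powr)
    also have "\<dots> = z ^ 32" using z2 by (intro powr_realpow) simp
    finally have "z ^ 32 = u powr c'" ..
    also have "\<dots> \<le> real m powr c'" using m(1) u c' by (intro powr_mono2) auto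
    finally have s32: "z ^ 32 - 1 \<le> real s" using s(2) by linarith
    have "ln (real m) \<le> ln (2 * u)" using m m32 by (subst ln_le_cancel_iff) auto
    also have "\<dots> = ln 2 + A * ln z" using u z2 by (simp add: ln_mult u_def ln_powr)
    finally have "12 * ln (real m) * z ^ 16 \<le> 12 * (ln 2 + A * ln z) * z ^ 16"
      using z2 by (intro mult_right_mono) auto
    then have ln: "12 * ln (real m) / (1 / z ^ 16) + 2 \<le> real s" using zln s32 by simp
    have ua: "u \<le> z ^ a"
    proof -
      have "u \<le> z powr real a" unfolding u_def using a z2 by (intro powr_mono) auto
      then show ?thesis using z2 by (simp add: powr_realpow)
    qed
    have ma: "real m \<le> 2 * z ^ a" using m(2) ua by linarith
    have "2 * real m ^ 5 \<le> 2 * (2 * z ^ a) ^ 5" using ma by (intro mult_left_mono power_mono) auto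
    also have "\<dots> = 2 ^ 6 * z ^ (5 * a)" by (simp add: power_mult_distrib power_mult[symmetric] mult.commute)
    also have "\<dots> \<le> z ^ 6 * z ^ (5 * a)" using z2 by (intro mult_right_mono power_mono) auto
    also have "\<dots> \<le> z ^ C" using z2 by (simp only: power_add[symmetric]) (rule power_increasing, auto simp: C_def)
    finally have m5: "2 * real m ^ 5 \<le> z ^ C" .
    have "4 * (2 * real m) ^ h \<le> 4 * (2 * (2 * z ^ a)) ^ h" using ma by (intro mult_left_mono power_mono) auto
    also have "\<dots> = 2 ^ (2 + 2 * h) * z ^ (a * h)"
      by (simp add: power_mult_distrib power_mult power_add)
    also have "\<dots> \<le> z ^ (2 + 2 * h) * z ^ (a * h)" using z2 by (intro mult_right_mono power_mono) auto
    also have "\<dots> \<le> z ^ C" using z2 by (simp only: power_add[symmetric]) (rule power_increasing, auto simp: C_def)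
    finally have "4 * (2 * real m) ^ h \<le> z ^ C" .
    then show ?thesis using m32 sm sc ln m5 by blast
  qed
  then show ?thesis by (intro exI[of _ "max z1 1"] conjI exI[of _ C]) auto
qed

lemma low_degree_mono:
  assumes "low_degree E c W" "c \<le> c'"
  shows "low_degree E c' W"
  unfolding low_degree_def
proof
  fix x assume "x \<in> W"
  then have "real (card (nbhd E x W)) \<le> c * real (card W)" using assms(1) by (simp add: low_degree_def)
  also have "\<dots> \<le> c' * real (card W)" using assms(2) by (rule mult_right_mono) simp
  finally show "real (card (nbhd E x W)) \<le> c' * real (card W)" .
qed

lemma restricted_rel_mono: "restricted_rel E c W \<Longrightarrow> c \<le> c' \<Longrightarrow> restricted_rel E c' W"
  by (auto simp: restricted_rel_def low_degree_mono)

lemma apex_comb_mono: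
  assumes ac: "apex_comb E W S w a T v" and WX: "W \<subseteq> X"
  shows "apex_comb E X S w a T v"
proof -
  have "a ` S \<subseteq> W" "v \<in> W" "\<And>i. i \<in> S \<Longrightarrow> T i \<subseteq> W"
    using ac by (simp_all add: apex_comb_def)
  then have "a ` S \<subseteq> X" "v \<in> X" "\<And>i. i \<in> S \<Longrightarrow> T i \<subseteq> X"
    using WX by (blast, blast, meson subset_trans)
  then show ?thesis using ac by (simp add: apex_comb_def)
qed

lemma apex_comb_card:
  assumes "apex_comb E W S w a T v" "finite W"
  shows "real (card S) * w \<le> real (card W)"
proof -
  have T: "\<And>i. i \<in> S \<Longrightarrow> T i \<subseteq> W" "\<And>i. i \<in> S \<Longrightarrow> w \<le> real (card (T i))"
    "\<And>i j. i \<in> S \<Longrightarrow> j \<in> S \<Longrightarrow> i \<noteq> j \<Longrightarrow> T i \<inter> T j = {}" and finS: "finite S"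
    using assms(1) unfolding apex_comb_def by auto
  have "real (card S) * w = (\<Sum>i\<in>S. w)" by simp
  also have "\<dots> \<le> (\<Sum>i\<in>S. real (card (T i)))" using T(2) by (rule sum_mono)
  also have "\<dots> = real (\<Sum>i\<in>S. card (T i))" by simp
  also have "(\<Sum>i\<in>S. card (T i)) = card (\<Union>i\<in>S. T i)"
    using T finS finite_subset[OF T(1) assms(2)] by (intro card_UN_disjoint[symmetric]) auto
  also have "\<dots> \<le> card W" using T(1) assms(2) by (intro card_mono) auto
  finally show ?thesis by simp
qed

text \<open>Passing from \<open>z\<close> to \<open>z\<^sup>2\<close> loses a factor \<open>z ^ C\<close> in size, which keeps the size bound
  \<open>z ^ C\<close> valid; the last square may exceed \<open>Z\<close>, but not \<open>Z\<^sup>2\<close>, hence the exponent \<open>2 * C\<close>.\<close>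

lemma restricted_chain:
  fixes Z z0 :: real
  assumes z0: "2 \<le> z0" "z0 < Z"
    and base: "\<exists>W\<subseteq>X. real (card X) \<le> z0 ^ C * real (card W) \<and> restricted_rel E (1 / z0 ^ 8) W"
  shows "(\<exists>W\<subseteq>X. real (card X) \<le> Z ^ (2 * C) * real (card W) \<and> restricted_rel E (1 / Z ^ 8) W) \<or>
    (\<exists>z W. z0 \<le> z \<and> z < Z \<and> W \<subseteq> X \<and> real (card X) \<le> z ^ C * real (card W) \<and> restricted_rel E (1 / z ^ 8) W \<and>
      (\<forall>W2\<subseteq>W. real (card W) \<le> z ^ C * real (card W2) \<longrightarrow> \<not> restricted_rel E (1 / z ^ 16) W2))"
proof -
  define y where "y i = z0 ^ (2 ^ i)" for i :: nat
  define pr where "pr i \<longleftrightarrow> (\<exists>W\<subseteq>X. real (card X) \<le> y i ^ C * real (card W) \<and> restricted_rel E (1 / y i ^ 8) W)" for i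
  have ySuc: "y (Suc i) = y i ^ 2" for i by (simp add: y_def power_mult[symmetric] mult.commute)
  have yge: "z0 \<le> y i" for i
    using z0 power_increasing[of 1 "2 ^ i" z0] by (simp add: y_def)
  have "\<exists>n. Z \<le> y n"
  proof -
    obtain n where "Z < z0 ^ n" using real_arch_pow[of z0 Z] z0 by auto
    also have "z0 ^ n \<le> z0 ^ (2 ^ n)" using z0 by (intro power_increasing) (auto simp: less_imp_le)
    finally show ?thesis unfolding y_def by (meson less_imp_le)
  qed
  define n where "n = (LEAST n. Z \<le> y n)"
  have n: "Z \<le> y n" unfolding n_def using \<open>\<exists>n. Z \<le> y n\<close> by (rule LeastI_ex)
  have nmin: "y i < Z" if "i < n" for i
    using not_less_Least[of i "\<lambda>n. Z \<le> y n"] that unfolding n_def by auto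
  have "y 0 = z0" by (simp add: y_def)
  then obtain n' where n': "n = Suc n'" using n z0 by (cases n) auto
  have pr0: "pr 0" using base \<open>y 0 = z0\<close> by (simp add: pr_def)
  show ?thesis
  proof (cases "pr n")
    case True
    then obtain W where W: "W \<subseteq> X" "real (card X) \<le> y n ^ C * real (card W)" "restricted_rel E (1 / y n ^ 8) W"
      unfolding pr_def by blast
    have yn: "y n \<le> Z ^ 2"
      unfolding n' ySuc using nmin[of n'] yge[of n'] z0 n' by (intro power_mono) auto
    have "y n ^ C \<le> (Z ^ 2) ^ C" using yn yge[of n] z0 by (intro power_mono) auto
    then have "y n ^ C * real (card W) \<le> Z ^ (2 * C) * real (card W)"
      by (intro mult_right_mono) (auto simp: power_mult)
    then have "real (card X) \<le> Z ^ (2 * C) * real (card W)" using W(2) by linarith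
    moreover have "1 / y n ^ 8 \<le> 1 / Z ^ 8"
      using n z0 by (intro divide_left_mono power_mono mult_pos_pos zero_less_power) auto
    then have "restricted_rel E (1 / Z ^ 8) W" using W(3) restricted_rel_mono by blast
    ultimately show ?thesis using W(1) by blast
  next
    case False
    \<comment> \<open>\<open>pr\<close> holds at 0 and fails at \<open>n\<close>, so it gets lost
      between two consecutive scales; the set at the earlier one cannot be descended from.\<close>
    have "\<exists>i<n. pr i \<and> \<not> pr (Suc i)"
    proof (rule ccontr)
      assume "\<not> ?thesis"
      then have "i \<le> n \<Longrightarrow> pr i" for i by (induction i) (auto simp: pr0)
      then show False using False by blast
    qed
    then obtain i where i: "i < n" "pr i" "\<not> pr (Suc i)" by blast
    then obtain W where W: "W \<subseteq> X" "real (card X) \<le> y i ^ C * real (card W)" "restricted_rel E (1 / y i ^ 8) W"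
      unfolding pr_def by blast
    have "\<not> restricted_rel E (1 / y i ^ 16) W2" if "W2 \<subseteq> W" "real (card W) \<le> y i ^ C * real (card W2)" for W2
    proof
      assume r: "restricted_rel E (1 / y i ^ 16) W2"
      have "0 \<le> y i ^ C" using yge[of i] z0 by simp
      then have "y i ^ C * real (card W) \<le> y i ^ C * (y i ^ C * real (card W2))"
        by (rule mult_left_mono[OF that(2)])
      then have "real (card X) \<le> y i ^ C * (y i ^ C * real (card W2))" using W(2) by linarith
      also have "\<dots> = y (Suc i) ^ C * real (card W2)"
        by (simp add: ySuc power2_eq_square power_mult_distrib)
      finally have "real (card X) \<le> y (Suc i) ^ C * real (card W2)" .
      moreover have "y (Suc i) ^ 8 = y i ^ 16" by (simp add: ySuc flip: power_mult)
      ultimately have "pr (Suc i)" unfolding pr_def using r W(1) that(1) by (intro exI[of _ W2]) auto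
      with i(3) show False by blast
    qed
    then show ?thesis using W yge[of i] nmin[OF i(1)] by blast
  qed
qed

text \<open>A blockade as peeling yields it, with \<open>R\<close> required from earlier to later
  blocks only; for symmetric \<open>R\<close> this is the usual notion.\<close>

definition blocks ::
  "'a set \<Rightarrow> real \<Rightarrow> real \<Rightarrow> ('a set \<Rightarrow> 'a set \<Rightarrow> bool) \<Rightarrow> 'a set list \<Rightarrow> bool" where
  "blocks X l w R Bs \<longleftrightarrow> (\<forall>B\<in>set Bs. B \<subseteq> X \<and> w \<le> real (card B)) \<and> l \<le> real (length Bs) \<and>
     sorted_wrt (\<lambda>P Q. P \<inter> Q = {} \<and> R P Q) Bs"

lemma blocks_mono:
  assumes "blocks X l w R Bs" "X \<subseteq> X'" "w' \<le> w"
  shows "blocks X' l w' R Bs"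
proof -
  have "B \<subseteq> X' \<and> w' \<le> real (card B)" if "B \<in> set Bs" for B
  proof -
    have "B \<subseteq> X" "w \<le> real (card B)" using assms(1) that by (auto simp: blocks_def)
    then show ?thesis using assms(2,3) by (meson order_trans)
  qed
  then show ?thesis using assms(1) by (simp add: blocks_def)
qed

text \<open>The comb property of the class for a relation on a vertex set. All outcomes are required
  inside \<open>X\<close>, since it is applied to the subsets that occur in the recursion.\<close>

definition comb_property :: "real \<Rightarrow> real \<Rightarrow> real \<Rightarrow> ('a \<Rightarrow> 'a \<Rightarrow> bool) \<Rightarrow> 'a set \<Rightarrow> bool" where
  "comb_property s1 s2 s3 E X \<longleftrightarrow> (\<forall>S w a T v. apex_comb E X S w a T v \<and> 4 \<le> card S \<and> 4 \<le> w \<longrightarrow>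
     (\<exists>Y\<subseteq>X. homogeneous E Y \<and> w powr s1 \<le> real (card Y)) \<or>
     (\<exists>k Bs. real (card S) powr s3 \<le> k \<and> (blocks X k (w / k powr s2) (complete_pair E) Bs \<or>
        blocks X k (w / k powr s2) (anticomplete_pair E) Bs)) \<or>
     (\<exists>Bs. blocks X (real (card S)) (w / real (card S) ^ 2)
        (\<lambda>P Q. complete_pair E P Q \<or> anticomplete_pair E P Q) Bs))"

lemma pure_step_rel:
  assumes "symp E" "0 \<le> \<sigma>" "P \<inter> Q = {}" "complete_pair E P Q \<or> anticomplete_pair E P Q"
  shows "step_rel E \<sigma> P Q"
proof -
  have "sparse_from E \<sigma> P Q" if "anticomplete_pair E P Q"
  proof -
    have "nbhd E y P = {}" if "y \<in> Q" for y
      using \<open>anticomplete_pair E P Q\<close> that assms(1) by (auto simp: nbhd_def anticomplete_pair_def dest: sympD)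
    then show ?thesis using assms(2) by (simp add: sparse_from_def)
  qed
  then show ?thesis using assms(3,4) by (auto simp: step_rel_def)
qed

text \<open>Keep only \<open>\<lceil>k\<rceil>\<close> blocks, so that their number is controlled from above as well.\<close>

lemma truncate_blocks:
  assumes "symp E" "0 \<le> \<sigma>" "blocks X k w R Bs" "0 \<le> k"
    and R: "\<And>P Q. R P Q \<Longrightarrow> complete_pair E P Q \<or> anticomplete_pair E P Q"
  shows "\<exists>Ps. length Ps = nat \<lceil>k\<rceil> \<and> (\<forall>P\<in>set Ps. P \<subseteq> X \<and> w \<le> real (card P)) \<and> sorted_wrt (step_rel E \<sigma>) Ps"
proof (intro exI[of _ "take (nat \<lceil>k\<rceil>) Bs"] conjI ballI)
  have B: "k \<le> real (length Bs)" "\<And>B. B \<in> set Bs \<Longrightarrow> B \<subseteq> X \<and> w \<le> real (card B)"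
    "sorted_wrt (\<lambda>P Q. P \<inter> Q = {} \<and> R P Q) Bs" using assms(3) by (auto simp: blocks_def)
  have "nat \<lceil>k\<rceil> \<le> length Bs" using B(1) by (simp add: nat_le_iff ceiling_le_iff)
  then show "length (take (nat \<lceil>k\<rceil>) Bs) = nat \<lceil>k\<rceil>" by simp
  show "P \<subseteq> X" "w \<le> real (card P)" if "P \<in> set (take (nat \<lceil>k\<rceil>) Bs)" for P
    using B(2)[OF in_set_takeD[OF that]] by auto
  show "sorted_wrt (step_rel E \<sigma>) (take (nat \<lceil>k\<rceil>) Bs)"
    by (rule sorted_wrt_take, rule sorted_wrt_mono_rel[OF _ B(3)])
      (use pure_step_rel[OF assms(1,2)] R in blast)
qed

lemma le_mult_trans:
  fixes x y z a :: real
  shows "x \<le> a * y \<Longrightarrow> y \<le> z \<Longrightarrow> 0 \<le> a \<Longrightarrow> x \<le> a * z"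
  by (rule order_trans[OF _ mult_left_mono])

text \<open>Solving \<open>S powr s3 \<le> k\<close> for \<open>S\<close> bounds the loss S^n by
  k^(n / s3), so that it can be charged to the number \<open>k\<close> of blocks together with
  k^s2.\<close>

lemma powr_block_bound:
  fixes S k x w :: real and n :: nat
  assumes S: "1 \<le> S" and k: "S powr s3 \<le> k" and s3: "0 < s3" and w: "0 \<le> w"
    and x: "x \<le> S ^ n * w" and D: "real n / s3 + s2 \<le> D"
  shows "x / k powr D \<le> w / k powr s2"
proof -
  have "1 powr s3 \<le> S powr s3" using S s3 by (intro powr_mono2) auto
  then have k1: "1 \<le> k" using k by simp
  have "S = (S powr s3) powr (1 / s3)" using S s3 by (simp add: powr_powr)
  also have "\<dots> \<le> k powr (1 / s3)" using k s3 by (intro powr_mono2) auto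
  finally have "S \<le> k powr (1 / s3)" .
  then have "S ^ n \<le> (k powr (1 / s3)) ^ n" using S by (intro power_mono) auto
  also have "\<dots> = k powr (real n / s3)" using k1 by (simp add: powr_powr flip: powr_realpow)
  finally have "S ^ n * w \<le> k powr (real n / s3) * w" using w by (rule mult_right_mono)
  then have "x \<le> k powr (real n / s3) * w" using x by linarith
  then have "x / k powr D \<le> k powr (real n / s3) * w / k powr D" by (intro divide_right_mono) auto
  also have "\<dots> = w * k powr (real n / s3 - D)" by (simp add: powr_diff)
  also have "\<dots> \<le> w * k powr (- s2)" using D k1 w by (intro mult_left_mono powr_mono) auto
  also have "\<dots> = w / k powr s2" by (simp add: powr_minus_divide)
  finally show ?thesis .
qed

context leaf_pattern
begin

text \<open>What remains of the Erdos-Hajnal property of the modified class once its other members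
  are excluded. Quantifying over all subsets makes it hereditary.\<close>

definition EH_in :: "real \<Rightarrow> ('a \<Rightarrow> 'a \<Rightarrow> bool) \<Rightarrow> 'a set \<Rightarrow> bool" where
  "EH_in c E X \<longleftrightarrow> (\<forall>M\<subseteq>X. \<not> embeds E PH VJ M \<longrightarrow>
     (\<exists>S\<subseteq>M. homogeneous E S \<and> real (card M) powr c \<le> real (card S)))"

definition tame :: "real \<Rightarrow> ('a \<Rightarrow> 'a \<Rightarrow> bool) \<Rightarrow> 'a set \<Rightarrow> bool" where
  "tame c E X \<longleftrightarrow> finite X \<and> symp E \<and> irreflp E \<and> \<not> embeds E PH VH X \<and> EH_in c E X"

lemma tame_subset:
  assumes t: "tame c E X" and WX: "W \<subseteq> X"
  shows "tame c E W"
proof -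
  have "finite W" using t WX finite_subset by (auto simp: tame_def)
  moreover have "\<not> embeds E PH VH W" using t embeds_mono[OF _ WX] by (auto simp: tame_def)
  moreover have "EH_in c E W" using t WX by (auto simp: tame_def EH_in_def)
  ultimately show ?thesis using t by (simp add: tame_def)
qed

text \<open>The situation at a set where the descent stops at scale \<open>z\<close>. Both the
  number of blocks and the length of the comb are at least \<open>z\<close>, so the loss z^C is
  polynomial in them. The width \<open>w\<close> of the comb is bounded below in two ways: by means
  of its length, without reference to \<rho>, and by means of \<rho>, without reference to its
  length.\<close>

lemma restricted_step:
  assumes c: "0 < c"
  shows "\<exists>z2\<ge>1. \<exists>C::nat. \<forall>(E :: 'a \<Rightarrow> 'a \<Rightarrow> bool) W z \<sigma> \<rho>. tame c E W \<and> z2 \<le> z \<and> z ^ C \<le> real (card W) \<and>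
      restricted_rel E (1 / z ^ 8) W \<and>
      (\<forall>W2\<subseteq>W. real (card W) \<le> z ^ C * real (card W2) \<longrightarrow> \<not> restricted_rel E (1 / z ^ 16) W2) \<and>
      0 < \<sigma> \<and> 0 < \<rho> \<and> \<rho> * z ^ 4 \<le> \<sigma> \<longrightarrow>
    (\<exists>Ps. z \<le> real (length Ps) \<and> real (length Ps) \<le> 2 * z ^ 2 \<and>
      (\<forall>P\<in>set Ps. P \<subseteq> W \<and> real (card W) \<le> z ^ C * real (card P)) \<and> sorted_wrt (step_rel E \<sigma>) Ps) \<or>
    (\<exists>S w a T v. apex_comb E W S w a T v \<and> z \<le> real (card S) \<and>
      real (card W) \<le> z ^ C * real (card S) ^ 2 * w \<and> \<rho> * real (card W) \<le> z ^ C * w)"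
proof -
  define h where "h = card VJ"
  obtain z1 and C1 :: nat where z1: "1 \<le> z1" and par: "\<And>z. z1 \<le> z \<Longrightarrow> \<exists>m s :: nat. 32 \<le> m \<and> h \<le> m \<and>
    12 * ln (real m) / (1 / z ^ 16) + 2 \<le> real s \<and> s \<le> m \<and> real s \<le> real m powr c \<and>
    2 * real m ^ 5 \<le> z ^ C1 \<and> 4 * (2 * real m) ^ h \<le> z ^ C1"
    using sampling_parameters[OF c, of h] by metis
  \<comment> \<open>60000 is twice the 30000 of the comb construction: with 1 / (2 * q) = z^4 / 2
    the comb satisfies z^4 \<le> 60000 * (card S)^2, whence \<open>z \<le> card S\<close>. The other
    term bounds the loss of a peeling round by a quarter of \<open>z * q * card W\<close>.\<close>
  define z2 where "z2 = max z1 (60000 + 4 * (2 * real h + 1))"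
  define C where "C = C1 + 40"
  have main: "(\<exists>Ps. z \<le> real (length Ps) \<and> real (length Ps) \<le> 2 * z ^ 2 \<and>
      (\<forall>P\<in>set Ps. P \<subseteq> W \<and> real (card W) \<le> z ^ C * real (card P)) \<and> sorted_wrt (step_rel E \<sigma>) Ps) \<or>
    (\<exists>S w a T v. apex_comb E W S w a T v \<and> z \<le> real (card S) \<and>
      real (card W) \<le> z ^ C * real (card S) ^ 2 * w \<and> \<rho> * real (card W) \<le> z ^ C * w)"
    if tame: "tame c E W" and z: "z2 \<le> z" and big: "z ^ C \<le> real (card W)"
      and res: "restricted_rel E (1 / z ^ 8) W"
      and nores: "\<forall>W2\<subseteq>W. real (card W) \<le> z ^ C * real (card W2) \<longrightarrow> \<not> restricted_rel E (1 / z ^ 16) W2"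
      and sr: "0 < \<sigma>" "0 < \<rho>" "\<rho> * z ^ 4 \<le> \<sigma>"
    for E :: "'a \<Rightarrow> 'a \<Rightarrow> bool" and W z \<sigma> \<rho>
  proof -
    let ?w = "real (card W)"
    have finW: "finite W" and sym: "symp E" and irr: "irreflp E" and free: "\<not> embeds E PH VH W"
      and EH: "EH_in c E W" using tame by (auto simp: tame_def)
    have zz: "z1 \<le> z" "60000 \<le> z" "4 * (2 * real h + 1) \<le> z" using z by (auto simp: z2_def)
    \<comment> \<open>\<open>q ^ 2\<close> is the sparsity of \<open>W\<close> or of its complement,
      \<open>q ^ 4\<close> the one that no large subset attains.\<close>
    define q where "q = 1 / z ^ 4"
    have q2: "q ^ 2 = 1 / z ^ 8" and q4: "q ^ 4 = 1 / z ^ 16"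
      by (simp_all add: q_def power_divide flip: power_mult)
    have z1p: "1 \<le> z" and z0: "0 < z" using zz by auto
    have zpow: "z \<le> z ^ n" if "1 \<le> n" for n :: nat
      using power_increasing[OF that z1p] by simp
    have q0: "0 < q" "q \<le> 1 / 10"
    proof -
      show "0 < q" using z0 by (simp add: q_def)
      have "10 \<le> z ^ 4" using zpow[of 4] zz by simp
      then show "q \<le> 1 / 10" unfolding q_def using z0 by (intro divide_left_mono) auto
    qed
    have zC: "z ^ n \<le> z ^ C" if "n \<le> C" for n using that z1p by (rule power_increasing)
    have bigq: "1 \<le> q * ?w"
    proof -
      have "z ^ 4 \<le> ?w" using big zC[of 4] by (simp add: C_def)
      then show ?thesis using z0 by (simp add: q_def field_simps)
    qed
    have w0: "0 < ?w" using bigq q0 by (smt (verit) mult_nonneg_nonpos of_nat_0_le_iff)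
    have halfC: "?w \<le> z ^ C * real (card Y)" if "?w \<le> 2 * real (card Y)" for Y
    proof -
      have "2 \<le> z ^ C" using zpow[of C] zz by (simp add: C_def)
      then have "2 * real (card Y) \<le> z ^ C * real (card Y)" by (rule mult_right_mono) simp
      then show ?thesis using that by linarith
    qed
    \<comment> \<open>At most 2 * z^2 rounds, each losing at most a proportion (z / 4) * z^(-4), use
      up no more than half of \<open>W\<close>.\<close>
    define j where "j = nat \<lceil>z ^ 2\<rceil>"
    have z2_1: "1 \<le> z ^ 2" using z1p by (rule one_le_power)
    have j: "z ^ 2 \<le> real j" "real j \<le> 2 * z ^ 2" unfolding j_def using z2_1 by linarith+
    have jz: "z \<le> real j" using j(1) zpow[of 2] by simp
    have peel: "?w / 2 \<le> ?w - real j * (t * q * ?w)" if t: "0 \<le> t" "4 * t \<le> z" for t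
    proof -
      have "real j * (t * q * ?w) \<le> (2 * z ^ 2) * ((z / 4) * q * ?w)"
        using j(2) t q0 by (intro mult_mono mult_right_mono) auto
      also have "\<dots> = (1 / (2 * z)) * ?w" using z0 by (simp add: q_def field_simps power_numeral_reduce)
      also have "\<dots> \<le> (1 / 2) * ?w" using z1p by (intro mult_right_mono) (auto simp: field_simps)
      finally show ?thesis by simp
    qed
    have sw: "sorted_wrt (step_rel E \<sigma>) Ps" if "sorted_wrt (\<lambda>P Q. P \<inter> Q = {} \<and> R P Q) Ps"
      "\<And>P Q. R P Q \<Longrightarrow> complete_pair E P Q \<or> sparse_from E \<sigma> P Q" for Ps R
      using that(2) by (intro sorted_wrt_mono_rel[OF _ that(1)]) (auto simp: step_rel_def)
    show ?thesis
    proof (cases "low_degree E (1 / z ^ 8) W")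
      case True
      have low: "low_degree E (q ^ 2) W" using True q2 by simp
      have rq: "\<rho> \<le> \<sigma> * q" using sr(3) z0 by (simp add: q_def field_simps)
      have st: "(\<exists>P\<subseteq>Y. \<exists>Q\<subseteq>Y. P \<inter> Q = {} \<and> q ^ 4 / 4 * ?w \<le> real (card P) \<and>
          real (card Y) - 4 * q * ?w \<le> real (card Q) \<and> sparse_from E \<sigma> P Q) \<or>
        (\<exists>S w a T v. apex_comb E W S w a T v \<and> 1 / (2 * q) \<le> 30000 * real (card S) ^ 2 \<and>
          \<rho> * q ^ 4 * ?w \<le> 16 * w \<and> q ^ 4 * ?w \<le> 240000 * real (card S) ^ 2 * w)"
        if Y: "Y \<subseteq> W" "?w \<le> 2 * real (card Y)" for Y
      proof -
        have "\<not> low_degree E (q ^ 4) Y"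
          using nores Y(1) halfC[OF Y(2)] by (auto simp: restricted_rel_def q4)
        then show ?thesis by (intro sparse_step[OF finW sym irr q0 low Y _ bigq sr(1,2) rq])
      qed
      show ?thesis
      proof (cases "\<exists>S w a T v. apex_comb E W S w a T v \<and> 1 / (2 * q) \<le> 30000 * real (card S) ^ 2 \<and>
          \<rho> * q ^ 4 * ?w \<le> 16 * w \<and> q ^ 4 * ?w \<le> 240000 * real (card S) ^ 2 * w")
        case True
        then obtain S w a T v where comb: "apex_comb E W S w a T v" "1 / (2 * q) \<le> 30000 * real (card S) ^ 2"
          "\<rho> * q ^ 4 * ?w \<le> 16 * w" "q ^ 4 * ?w \<le> 240000 * real (card S) ^ 2 * w" by blast
        have w: "0 \<le> w"
        proof -
          have "0 \<le> \<rho> * q ^ 4 * ?w" using sr q0 by simp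
          then show ?thesis using comb(3) by linarith
        qed
        have "z \<le> real (card S)"
        proof (rule ccontr)
          assume "\<not> ?thesis"
          then have "real (card S) ^ 2 \<le> z ^ 2" by (intro power_mono) auto
          moreover have "z ^ 4 \<le> 60000 * real (card S) ^ 2" using comb(2) by (simp add: q_def)
          ultimately have "z ^ 4 \<le> 60000 * z ^ 2" by linarith
          moreover have "z ^ 4 = z ^ 2 * z ^ 2" by (simp flip: power_add)
          ultimately have "z ^ 2 * z ^ 2 \<le> 60000 * z ^ 2" by linarith
          then have "z ^ 2 \<le> 60000" by (rule mult_right_le_imp_le) (use z0 in simp)
          moreover have "z * z > 1 * z" using zz by (intro mult_strict_right_mono) auto
          ultimately show False using zz by (simp add: power2_eq_square)
        qed
        moreover have "?w \<le> z ^ C * real (card S) ^ 2 * w"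
        proof -
          have "?w \<le> z ^ 16 * (240000 * real (card S) ^ 2 * w)"
            using comb(4) z0 by (simp add: q4 field_simps)
          also have "\<dots> = (240000 * z ^ 16) * (real (card S) ^ 2 * w)" by simp
          also have "\<dots> \<le> z ^ C * (real (card S) ^ 2 * w)"
          proof (rule mult_right_mono)
            have "240000 * z ^ 16 \<le> (z * z) * z ^ 16"
              using zz mult_mono[of 60000 z 60000 z] by (intro mult_right_mono) auto
            also have "\<dots> = z ^ 18" by (simp add: power_numeral_reduce)
            also have "\<dots> \<le> z ^ C" by (rule zC) (simp add: C_def)
            finally show "240000 * z ^ 16 \<le> z ^ C" .
          qed (use w in simp)
          finally show ?thesis by (simp add: mult.assoc)
        qed
        moreover have "\<rho> * ?w \<le> z ^ C * w"
        proof -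
          have "\<rho> * ?w \<le> (16 * z ^ 16) * w" using comb(3) z0 by (simp add: q4 field_simps)
          also have "\<dots> \<le> z ^ C * w"
          proof (rule mult_right_mono)
            have "16 * z ^ 16 \<le> z * z ^ 16" using zz by (intro mult_right_mono) auto
            also have "\<dots> = z ^ 17" by (simp add: power_numeral_reduce)
            also have "\<dots> \<le> z ^ C" by (rule zC) (simp add: C_def)
            finally show "16 * z ^ 16 \<le> z ^ C" .
          qed (rule w)
          finally show ?thesis .
        qed
        ultimately show ?thesis using comb(1) by blast
      next
        case False
        have tau: "0 \<le> 4 * q * ?w" using q0 by simp
        have her: "sparse_from E \<sigma> P Q'" if "sparse_from E \<sigma> P Q" "Q' \<subseteq> Q" for P Q Q'
          using that by (auto simp: sparse_from_def)
        have "\<exists>Ps. length Ps = j \<and> (\<forall>P\<in>set Ps. P \<subseteq> W \<and> q ^ 4 / 4 * ?w \<le> real (card P)) \<and>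
            sorted_wrt (\<lambda>P Q. P \<inter> Q = {} \<and> sparse_from E \<sigma> P Q) Ps"
        proof (rule peeling[where \<tau> = "4 * q * ?w", OF her tau _ subset_refl])
          show "\<exists>P\<subseteq>Y. \<exists>Q\<subseteq>Y. P \<inter> Q = {} \<and> q ^ 4 / 4 * ?w \<le> real (card P) \<and>
              real (card Y) - 4 * q * ?w \<le> real (card Q) \<and> sparse_from E \<sigma> P Q"
            if "Y \<subseteq> W" "?w \<le> 2 * real (card Y)" for Y using st[OF that] False by blast
          show "?w / 2 \<le> ?w - real j * (4 * q * ?w)" using peel[of 4] zz by simp
        qed
        then obtain Ps where Ps: "length Ps = j" "\<forall>P\<in>set Ps. P \<subseteq> W \<and> q ^ 4 / 4 * ?w \<le> real (card P)"
          "sorted_wrt (\<lambda>P Q. P \<inter> Q = {} \<and> sparse_from E \<sigma> P Q) Ps" by blast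
        have "?w \<le> z ^ C * real (card P)" if "P \<in> set Ps" for P
        proof -
          have "q ^ 4 / 4 * ?w \<le> real (card P)" using Ps(2) that by blast
          then have "?w \<le> 4 * z ^ 16 * real (card P)" using z0 by (simp add: q4 field_simps)
          also have "\<dots> \<le> z ^ C * real (card P)"
          proof (rule mult_right_mono)
            have "4 * z ^ 16 \<le> z * z ^ 16" using zz by (intro mult_right_mono) auto
            also have "\<dots> = z ^ 17" by (simp add: power_numeral_reduce)
            also have "\<dots> \<le> z ^ C" by (rule zC) (simp add: C_def)
            finally show "4 * z ^ 16 \<le> z ^ C" .
          qed simp
          finally show ?thesis .
        qed
        moreover have "sorted_wrt (step_rel E \<sigma>) Ps" using Ps(3) by (rule sw) blast
        ultimately show ?thesis using Ps(1,2) j jz by blast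
      qed
    next
      case False
      then have low: "low_degree (co E) (q ^ 2) W" using res q2 by (simp add: restricted_rel_def)
      obtain m s :: nat where ms: "32 \<le> m" "h \<le> m" "12 * ln (real m) / (1 / z ^ 16) + 2 \<le> real s"
        "s \<le> m" "real s \<le> real m powr c" "2 * real m ^ 5 \<le> z ^ C1" "4 * (2 * real m) ^ h \<le> z ^ C1"
        using par[OF zz(1)] by blast
      \<comment> \<open>The extensions form at least a proportion z^(-C1) of \<open>Y\<close>, hence
        half of that of \<open>W\<close>; the additional z^4 makes \<open>p\<close> at most half of
        \<open>q * card W\<close>.\<close>
      define p where "p = ?w / (2 * z ^ (C1 + 4))"
      have zC1: "0 < z ^ C1" using z0 by simp
      have m0: "0 < real m" using ms(1) by simp
      have b: "0 < 1 / z ^ 16" "1 / z ^ 16 \<le> 1" using z0 z1p by (auto simp: divide_le_eq_1)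
      have st: "\<exists>P\<subseteq>Y. \<exists>Q\<subseteq>Y. P \<inter> Q = {} \<and> p \<le> real (card P) \<and>
          real (card Y) - (2 * real h + 1) * q * ?w \<le> real (card Q) \<and> complete_pair E P Q"
        if Y: "Y \<subseteq> W" "?w \<le> 2 * real (card Y)" for Y
      proof -
        have finY: "finite Y" using Y(1) finW finite_subset by blast
        have Ybig: "2 * real m ^ 5 \<le> real (card Y)"
        proof -
          have "2 * z ^ C1 \<le> z * z ^ C1" using zz zC1 by (intro mult_right_mono) auto
          also have "\<dots> = z ^ Suc C1" by simp
          also have "\<dots> \<le> z ^ C" by (rule zC) (simp add: C_def)
          finally show ?thesis using big Y(2) ms(6) by linarith
        qed
        have nr: "\<not> restricted_rel E (1 / z ^ 16) W2"
          if "W2 \<subseteq> Y" "real (card Y) / real m ^ 5 \<le> real (card W2)" for W2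
        proof -
          have "real (card Y) \<le> real m ^ 5 * real (card W2)" using that(2) m0 by (simp add: field_simps)
          then have "?w \<le> (2 * real m ^ 5) * real (card W2)" using Y(2) by simp
          also have "\<dots> \<le> z ^ C * real (card W2)"
            using ms(6) zC[of C1] by (intro mult_right_mono) (auto simp: C_def)
          finally show ?thesis using nores that(1) Y(1) by blast
        qed
        have EHY: "\<exists>S\<subseteq>M. homogeneous E S \<and> real (card M) powr c \<le> real (card S)"
          if "M \<subseteq> Y" "\<not> embeds E PH VJ M" for M
          using EH that Y(1) unfolding EH_in_def by (meson subset_trans)
        obtain g where g: "partial_copy E Y g"
          "real (card Y) < 4 * (2 * real m) ^ card VJ * real (card (extensions E Y g))"
          using many_extensions[OF finY irr ms(1) ms(2)[unfolded h_def] b ms(3,4,5) Ybig nr EHY] by blast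
        have "real (card Y) \<le> z ^ C1 * real (card (extensions E Y g))"
        proof -
          have "4 * (2 * real m) ^ card VJ * real (card (extensions E Y g)) \<le> z ^ C1 * real (card (extensions E Y g))"
            using ms(7) by (intro mult_right_mono) (auto simp: h_def)
          then show ?thesis using g(2) by linarith
        qed
        then have "?w \<le> 2 * z ^ C1 * real (card (extensions E Y g))" using Y(2) by simp
        also have "\<dots> \<le> 2 * z ^ (C1 + 4) * real (card (extensions E Y g))"
          using z1p by (intro mult_right_mono mult_left_mono power_increasing) auto
        finally have pe: "p \<le> real (card (extensions E Y g))" using z0 by (simp add: p_def field_simps)
        have pq: "p \<le> q * ?w / 2"
        proof -
          have "z ^ 4 \<le> z ^ (C1 + 4)" using z1p by (intro power_increasing) auto
          then have "?w / (2 * z ^ (C1 + 4)) \<le> ?w / (2 * z ^ 4)"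
            using z0 by (intro divide_left_mono) auto
          then show ?thesis by (simp add: p_def q_def)
        qed
        have "q \<le> 1" using q0 by simp
        from cosparse_step[OF finW sym q0(1) this low Y(1) bigq free g(1) pe pq]
        show ?thesis by (simp add: h_def)
      qed
      have tau: "0 \<le> (2 * real h + 1) * q * ?w" using q0 by simp
      have her: "complete_pair E P Q'" if "complete_pair E P Q" "Q' \<subseteq> Q" for P Q Q'
        using that by (auto simp: complete_pair_def)
      have "\<exists>Ps. length Ps = j \<and> (\<forall>P\<in>set Ps. P \<subseteq> W \<and> p \<le> real (card P)) \<and>
          sorted_wrt (\<lambda>P Q. P \<inter> Q = {} \<and> complete_pair E P Q) Ps"
      proof (rule peeling[where \<tau> = "(2 * real h + 1) * q * ?w", OF her tau st subset_refl])
        show "?w / 2 \<le> ?w - real j * ((2 * real h + 1) * q * ?w)" using peel[of "2 * real h + 1"] zz by simp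
      qed
      then obtain Ps where Ps: "length Ps = j" "\<forall>P\<in>set Ps. P \<subseteq> W \<and> p \<le> real (card P)"
        "sorted_wrt (\<lambda>P Q. P \<inter> Q = {} \<and> complete_pair E P Q) Ps" by blast
      have "?w \<le> z ^ C * real (card P)" if "P \<in> set Ps" for P
      proof -
        have "p \<le> real (card P)" using Ps(2) that by blast
        then have "?w \<le> 2 * z ^ (C1 + 4) * real (card P)" using z0 by (simp add: p_def field_simps)
        also have "\<dots> \<le> z ^ C * real (card P)"
        proof (rule mult_right_mono)
          have "2 * z ^ (C1 + 4) \<le> z * z ^ (C1 + 4)" using zz by (intro mult_right_mono) auto
          also have "\<dots> = z ^ Suc (C1 + 4)" by (rule power_Suc[symmetric])
          also have "\<dots> \<le> z ^ C" by (rule zC) (simp add: C_def)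
          finally show "2 * z ^ (C1 + 4) \<le> z ^ C" .
        qed simp
        finally show ?thesis .
      qed
      moreover have "sorted_wrt (step_rel E \<sigma>) Ps" using Ps(3) by (rule sw) blast
      ultimately show ?thesis using Ps(1,2) j jz by blast
    qed
  qed
  have "1 \<le> z2" using z1 by (simp add: z2_def)
  moreover have "\<forall>(E :: 'a \<Rightarrow> 'a \<Rightarrow> bool) W z \<sigma> \<rho>. tame c E W \<and> z2 \<le> z \<and> z ^ C \<le> real (card W) \<and>
      restricted_rel E (1 / z ^ 8) W \<and>
      (\<forall>W2\<subseteq>W. real (card W) \<le> z ^ C * real (card W2) \<longrightarrow> \<not> restricted_rel E (1 / z ^ 16) W2) \<and>
      0 < \<sigma> \<and> 0 < \<rho> \<and> \<rho> * z ^ 4 \<le> \<sigma> \<longrightarrow>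
    (\<exists>Ps. z \<le> real (length Ps) \<and> real (length Ps) \<le> 2 * z ^ 2 \<and>
      (\<forall>P\<in>set Ps. P \<subseteq> W \<and> real (card W) \<le> z ^ C * real (card P)) \<and> sorted_wrt (step_rel E \<sigma>) Ps) \<or>
    (\<exists>S w a T v. apex_comb E W S w a T v \<and> z \<le> real (card S) \<and>
      real (card W) \<le> z ^ C * real (card S) ^ 2 * w \<and> \<rho> * real (card W) \<le> z ^ C * w)"
    by (intro allI impI, elim conjE, rule main)
  ultimately show ?thesis by (intro exI conjI)
qed

text \<open>The first three outcomes end the argument at scale \<open>Z\<close>, the last one feeds
  the recursion. In the last, the exponent \<open>D\<close> of the loss in terms of the number of
  blocks does not depend on \<open>Z\<close>, and that number is at most polynomial in
  \<open>Z\<close>.\<close>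

lemma restricted_homogeneous_or_subdivision:
  fixes c s1 s2 s3 :: real
  assumes c: "0 < c" and s: "0 < s1" "0 < s2" "0 < s3"
  shows "\<exists>Z0\<ge>2. \<exists>C M0 D :: nat. \<forall>(E :: 'a \<Rightarrow> 'a \<Rightarrow> bool) X Z. tame c E X \<and> comb_property s1 s2 s3 E X \<and>
      Z0 \<le> Z \<and> Z ^ C \<le> real (card X) \<longrightarrow>
    (\<exists>W\<subseteq>X. real (card X) \<le> Z ^ C * real (card W) \<and> restricted_rel E (1 / Z ^ 8) W) \<or>
    (\<exists>Y\<subseteq>X. homogeneous E Y \<and> (real (card X) / Z ^ C) powr s1 \<le> real (card Y)) \<or>
    (\<exists>k Bs. Z ^ 2 \<le> k \<and> (blocks X k (real (card X) / k powr real D) (complete_pair E) Bs \<or>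
       blocks X k (real (card X) / k powr real D) (anticomplete_pair E) Bs)) \<or>
    (\<exists>Ps. 2 \<le> length Ps \<and> real (length Ps) \<le> Z ^ M0 \<and>
       (\<forall>P\<in>set Ps. P \<subseteq> X \<and> real (card X) \<le> real (length Ps) ^ D * real (card P)) \<and>
       sorted_wrt (step_rel E ((1 / Z ^ 16) ^ 2)) Ps)"
proof -
  obtain z2 and C2 :: nat where z2: "1 \<le> z2" and rstep: "\<And>(E :: 'a \<Rightarrow> 'a \<Rightarrow> bool) W z \<sigma> \<rho>.
      tame c E W \<and> z2 \<le> z \<and> z ^ C2 \<le> real (card W) \<and> restricted_rel E (1 / z ^ 8) W \<and>
      (\<forall>W2\<subseteq>W. real (card W) \<le> z ^ C2 * real (card W2) \<longrightarrow> \<not> restricted_rel E (1 / z ^ 16) W2) \<and>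
      0 < \<sigma> \<and> 0 < \<rho> \<and> \<rho> * z ^ 4 \<le> \<sigma> \<Longrightarrow>
    (\<exists>Ps. z \<le> real (length Ps) \<and> real (length Ps) \<le> 2 * z ^ 2 \<and>
      (\<forall>P\<in>set Ps. P \<subseteq> W \<and> real (card W) \<le> z ^ C2 * real (card P)) \<and> sorted_wrt (step_rel E \<sigma>) Ps) \<or>
    (\<exists>S w a T v. apex_comb E W S w a T v \<and> z \<le> real (card S) \<and>
      real (card W) \<le> z ^ C2 * real (card S) ^ 2 * w \<and> \<rho> * real (card W) \<le> z ^ C2 * w)"
    using restricted_step[OF c, where 'a = 'a] by blast
  \<comment> \<open>The last term guarantees at least two blocks where only
    \<open>k \<ge> l powr s3\<close> is known.\<close>
  define z0 where "z0 = max z2 (max 4 (2 powr (1 / s3)))"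
  have z0: "z2 \<le> z0" "4 \<le> z0" "2 powr (1 / s3) \<le> z0" by (auto simp: z0_def)
  obtain \<phi> where \<phi>: "bij_betw \<phi> {0..<card VH} VH" using ex_bij_betw_nat_finite[OF finVH] by blast
  have "card VH \<noteq> 0" using finVH v0 by auto
  then have t1: "1 \<le> card VH" by simp
  have b: "0 < 1 / z0 ^ 8" "1 / z0 ^ 8 \<le> 1" using z0 by (auto simp: divide_le_eq_1 intro: one_le_power)
  obtain c0 N0 where c0: "0 < c0" and roedl: "\<And>(E :: 'a \<Rightarrow> 'a \<Rightarrow> bool) X. finite X \<and> symp E \<and> irreflp E \<and>
      \<not> embeds E (\<lambda>i j. PH (\<phi> i) (\<phi> j)) {..<card VH} X \<and> N0 \<le> real (card X) \<Longrightarrow>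
      \<exists>W\<subseteq>X. c0 * real (card X) \<le> real (card W) \<and> restricted_rel E (1 / z0 ^ 8) W"
    using Roedl[where P = "\<lambda>i j. PH (\<phi> i) (\<phi> j)" and t = "card VH" and b = "1 / z0 ^ 8" and 'a = 'a, OF b PH_sym t1] by blast
  obtain C3' :: nat where C3': "1 / c0 < z0 ^ C3'" using real_arch_pow[of z0 "1 / c0"] z0 by auto
  obtain Cn :: nat where Cn: "N0 < 2 ^ Cn" using real_arch_pow[of 2 N0] by auto
  define C3 where "C3 = C2 + C3'"
  define C5 where "C5 = 36 + C2 + C3"
  define C6 where "C6 = C2 + C3 + 2"
  define C where "C = 2 * C3 + C5 + Cn + 2"
  define D where "D = nat \<lceil>real C6 / s3 + s2\<rceil> + C6 + 2"
  define M0 where "M0 = 36 + C2 + 3"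
  define Z0 where "Z0 = z0 + 1"
  have D1: "real C6 / s3 + s2 \<le> real D" unfolding D_def by linarith
  have main: "(\<exists>W\<subseteq>X. real (card X) \<le> Z ^ C * real (card W) \<and> restricted_rel E (1 / Z ^ 8) W) \<or>
    (\<exists>Y\<subseteq>X. homogeneous E Y \<and> (real (card X) / Z ^ C) powr s1 \<le> real (card Y)) \<or>
    (\<exists>k Bs. Z ^ 2 \<le> k \<and> (blocks X k (real (card X) / k powr real D) (complete_pair E) Bs \<or>
       blocks X k (real (card X) / k powr real D) (anticomplete_pair E) Bs)) \<or>
    (\<exists>Ps. 2 \<le> length Ps \<and> real (length Ps) \<le> Z ^ M0 \<and>
       (\<forall>P\<in>set Ps. P \<subseteq> X \<and> real (card X) \<le> real (length Ps) ^ D * real (card P)) \<and>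
       sorted_wrt (step_rel E ((1 / Z ^ 16) ^ 2)) Ps)" (is "?iv \<or> ?ii \<or> ?iii \<or> ?step")
    if tame: "tame c E X" and star: "comb_property s1 s2 s3 E X" and Z: "Z0 \<le> Z" and big: "Z ^ C \<le> real (card X)"
    for E :: "'a \<Rightarrow> 'a \<Rightarrow> bool" and X Z
  proof -
    let ?x = "real (card X)"
    have finX: "finite X" and sym: "symp E" and irr: "irreflp E" and free: "\<not> embeds E PH VH X"
      using tame by (auto simp: tame_def)
    have zZ: "z0 < Z" "5 \<le> Z" using Z z0 by (auto simp: Z0_def)
    have Z1: "1 \<le> Z" "0 < Z" using zZ by auto
    have Zpow: "Z ^ m \<le> Z ^ n" if "m \<le> n" for m n :: nat using that Z1(1) by (rule power_increasing)
    have free': "\<not> embeds E (\<lambda>i j. PH (\<phi> i) (\<phi> j)) {..<card VH} X"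
      using embeds_reindex[of \<phi> "{..<card VH}" VH E PH X] \<phi> free by (auto simp: atLeast0LessThan)
    have "N0 \<le> ?x"
    proof -
      have "(2::real) ^ Cn \<le> Z ^ Cn" using zZ by (intro power_mono) auto
      also have "\<dots> \<le> Z ^ C" by (rule Zpow) (simp add: C_def)
      finally show ?thesis using Cn big by linarith
    qed
    then obtain W0 where W0: "W0 \<subseteq> X" "c0 * ?x \<le> real (card W0)" "restricted_rel E (1 / z0 ^ 8) W0"
      using roedl[of X E] finX sym irr free' by blast
    have "?x \<le> z0 ^ C3 * real (card W0)"
    proof -
      have "?x \<le> (1 / c0) * real (card W0)" using W0(2) c0 by (simp add: field_simps)
      also have "\<dots> \<le> z0 ^ C3 * real (card W0)"
      proof (rule mult_right_mono)
        have "z0 ^ C3' \<le> z0 ^ C3" using z0 by (intro power_increasing) (auto simp: C3_def)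
        then show "1 / c0 \<le> z0 ^ C3" using C3' by linarith
      qed simp
      finally show ?thesis .
    qed
    then have base: "\<exists>W\<subseteq>X. ?x \<le> z0 ^ C3 * real (card W) \<and> restricted_rel E (1 / z0 ^ 8) W"
      using W0 by blast
    have "2 \<le> z0" using z0 by simp
    note chain = restricted_chain[OF this zZ(1) base]
    show ?thesis
    proof (cases "\<exists>W\<subseteq>X. ?x \<le> Z ^ (2 * C3) * real (card W) \<and> restricted_rel E (1 / Z ^ 8) W")
      case True
      then obtain W where W: "W \<subseteq> X" "?x \<le> Z ^ (2 * C3) * real (card W)" "restricted_rel E (1 / Z ^ 8) W" by blast
      have "Z ^ (2 * C3) * real (card W) \<le> Z ^ C * real (card W)"
        by (intro mult_right_mono Zpow) (auto simp: C_def)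
      then have "?x \<le> Z ^ C * real (card W)" using W(2) by linarith
      then have ?iv using W by blast
      then show ?thesis by (rule disjI1)
    next
      case False
      then obtain z W where zW: "z0 \<le> z" "z < Z" "W \<subseteq> X" "?x \<le> z ^ C3 * real (card W)"
        "restricted_rel E (1 / z ^ 8) W"
        and nores: "\<forall>W2\<subseteq>W. real (card W) \<le> z ^ C3 * real (card W2) \<longrightarrow> \<not> restricted_rel E (1 / z ^ 16) W2"
        using chain by blast
      let ?w = "real (card W)"
      have finW: "finite W" using zW(3) finX finite_subset by blast
      have z: "4 \<le> z" "1 \<le> z" "0 < z" "z2 \<le> z" using zW(1) z0 by auto
      have zZp: "z ^ n \<le> Z ^ n" for n :: nat using zW(2) z by (intro power_mono) auto
      have bigW: "z ^ C2 \<le> ?w"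
      proof -
        have "Z ^ C3 * Z ^ C2 \<le> Z ^ C" by (simp only: power_add[symmetric]) (rule Zpow, simp add: C_def C5_def)
        also have "\<dots> \<le> z ^ C3 * ?w" using big zW(4) by linarith
        also have "\<dots> \<le> Z ^ C3 * ?w" using zZp by (intro mult_right_mono) auto
        finally have "Z ^ C2 \<le> ?w" using Z1 by (subst (asm) mult_le_cancel_left_pos) auto
        then show ?thesis using zZp[of C2] by linarith
      qed
      have nores': "\<forall>W2\<subseteq>W. ?w \<le> z ^ C2 * real (card W2) \<longrightarrow> \<not> restricted_rel E (1 / z ^ 16) W2"
      proof (intro allI impI)
        fix W2 assume W2: "W2 \<subseteq> W" "?w \<le> z ^ C2 * real (card W2)"
        have "z ^ C2 * real (card W2) \<le> z ^ C3 * real (card W2)"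
          using z by (intro mult_right_mono power_increasing) (auto simp: C3_def)
        then show "\<not> restricted_rel E (1 / z ^ 16) W2" using nores W2 by (meson order_trans)
      qed
      \<comment> \<open>\<sigma> is the square of the parameter \<tau> = Z^(-16) of the recursion,
        and \<rho> is smaller by Z^4 as the sparse case demands. Both refer to the final scale
        \<open>Z\<close>, although the set stops at scale \<open>z\<close>.\<close>
      define \<sigma> where "\<sigma> = (1 / Z ^ 16) ^ 2"
      define \<rho> where "\<rho> = 1 / Z ^ 36"
      have sg: "\<sigma> = 1 / Z ^ 32" by (simp add: \<sigma>_def power_divide flip: power_mult)
      have sr: "0 < \<sigma>" "0 < \<rho>" using Z1 by (auto simp: sg \<rho>_def)
      have rs: "\<rho> * z ^ 4 \<le> \<sigma>"
      proof -
        have "\<rho> * z ^ 4 \<le> \<rho> * Z ^ 4" using zZp sr by (intro mult_left_mono) auto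
        also have "\<dots> = \<sigma>" using Z1 by (simp add: sg \<rho>_def field_simps flip: power_add)
        finally show ?thesis .
      qed
      note res = rstep[of E W z \<sigma> \<rho>]
      have tameW: "tame c E W" by (rule tame_subset[OF tame zW(3)])
      from res tameW z(4) bigW zW(5) nores' sr rs
      have cases: "(\<exists>Ps. z \<le> real (length Ps) \<and> real (length Ps) \<le> 2 * z ^ 2 \<and>
          (\<forall>P\<in>set Ps. P \<subseteq> W \<and> ?w \<le> z ^ C2 * real (card P)) \<and> sorted_wrt (step_rel E \<sigma>) Ps) \<or>
        (\<exists>S w a T v. apex_comb E W S w a T v \<and> z \<le> real (card S) \<and>
          ?w \<le> z ^ C2 * real (card S) ^ 2 * w \<and> \<rho> * ?w \<le> z ^ C2 * w)" by simp
      show ?thesis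
      proof (cases "\<exists>Ps. z \<le> real (length Ps) \<and> real (length Ps) \<le> 2 * z ^ 2 \<and>
          (\<forall>P\<in>set Ps. P \<subseteq> W \<and> ?w \<le> z ^ C2 * real (card P)) \<and> sorted_wrt (step_rel E \<sigma>) Ps")
        case True
        then obtain Ps where Ps: "z \<le> real (length Ps)" "real (length Ps) \<le> 2 * z ^ 2"
          "\<And>P. P \<in> set Ps \<Longrightarrow> P \<subseteq> W \<and> ?w \<le> z ^ C2 * real (card P)" "sorted_wrt (step_rel E \<sigma>) Ps" by blast
        have "2 \<le> length Ps" using Ps(1) z(1) by linarith
        moreover have "real (length Ps) \<le> Z ^ M0"
        proof -
          have "2 * z ^ 2 \<le> Z * Z ^ 2" using zZp[of 2] zZ z by (intro mult_mono) auto
          also have "\<dots> = Z ^ 3" by (simp add: power_numeral_reduce)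
          also have "\<dots> \<le> Z ^ M0" by (rule Zpow) (simp add: M0_def)
          finally show ?thesis using Ps(2) by linarith
        qed
        moreover have "P \<subseteq> X \<and> ?x \<le> real (length Ps) ^ D * real (card P)" if P: "P \<in> set Ps" for P
        proof
          show "P \<subseteq> X" using Ps(3)[OF P] zW(3) by blast
          have "?x \<le> z ^ C3 * (z ^ C2 * real (card P))"
            using z by (intro le_mult_trans[OF zW(4) conjunct2[OF Ps(3)[OF P]]]) simp
          also have "\<dots> = z ^ (C3 + C2) * real (card P)" by (simp add: power_add)
          also have "\<dots> \<le> real (length Ps) ^ D * real (card P)"
          proof (rule mult_right_mono)
            have "z ^ (C3 + C2) \<le> z ^ D" using z by (intro power_increasing) (auto simp: D_def C6_def)
            also have "\<dots> \<le> real (length Ps) ^ D" using Ps(1) z by (intro power_mono) auto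
            finally show "z ^ (C3 + C2) \<le> real (length Ps) ^ D" .
          qed simp
          finally show "?x \<le> real (length Ps) ^ D * real (card P)" .
        qed
        ultimately have ?step using Ps(4) by (intro exI[of _ Ps]) (simp add: \<sigma>_def)
        then show ?thesis by (intro disjI2)
      next
        case False
        then obtain S w a T v where comb: "apex_comb E W S w a T v" "z \<le> real (card S)"
          "?w \<le> z ^ C2 * real (card S) ^ 2 * w" "\<rho> * ?w \<le> z ^ C2 * w" using cases by blast
        define l where "l = real (card S)"
        have l: "z \<le> l" "1 \<le> l" "4 \<le> l" using comb(2) z by (auto simp: l_def)
        \<comment> \<open>The bound on \<open>w\<close> in terms of \<open>Z\<close> yields a large
          homogeneous set, \<open>4 \<le> w\<close> and, because the teeth are disjoint, an upper
          bound on \<open>l\<close>. The bound \<open>xl\<close>, which is free of \<open>Z\<close>,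
          is the one that makes the loss of a subdivision polynomial in its length.\<close>
        have wZ: "?w \<le> Z ^ (36 + C2) * w"
        proof -
          have w0: "0 \<le> w"
          proof -
            have "0 \<le> \<rho> * ?w" using sr by simp
            then have "0 \<le> z ^ C2 * w" using comb(4) by linarith
            moreover have "0 < z ^ C2" using z by simp
            then have "\<not> z ^ C2 \<le> 0" by simp
            ultimately show ?thesis by (simp add: zero_le_mult_iff)
          qed
          have "?w \<le> Z ^ 36 * (z ^ C2 * w)" using comb(4) Z1 by (simp add: \<rho>_def field_simps)
          also have "\<dots> \<le> Z ^ 36 * (Z ^ C2 * w)"
            using zZp[of C2] w0 Z1 by (intro mult_left_mono mult_right_mono) auto
          finally show ?thesis by (simp add: power_add)
        qed
        have xw: "?x \<le> Z ^ C5 * w"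
        proof -
          have "?x \<le> z ^ C3 * ?w" by (rule zW(4))
          also have "\<dots> \<le> Z ^ C3 * (Z ^ (36 + C2) * w)" using zZp wZ Z1 by (intro mult_mono) auto
          finally show ?thesis by (simp add: C5_def power_add mult_ac)
        qed
        have w4: "4 \<le> w"
        proof -
          have "Z ^ C5 * Z ^ 2 \<le> Z ^ C" by (simp only: power_add[symmetric]) (rule Zpow, simp add: C_def)
          also have "\<dots> \<le> Z ^ C5 * w" using big xw by linarith
          finally have "Z ^ 2 \<le> w" using Z1 by (subst (asm) mult_le_cancel_left_pos) auto
          moreover have "4 \<le> Z ^ 2" using power_mono[of 2 Z 2] zZ by simp
          ultimately show ?thesis by linarith
        qed
        have xl: "?x \<le> l ^ C6 * w"
        proof -
          have "?x \<le> z ^ C3 * (z ^ C2 * l ^ 2 * w)"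
            unfolding l_def using z by (intro le_mult_trans[OF zW(4) comb(3)]) simp
          also have "\<dots> = z ^ (C3 + C2) * (l ^ 2 * w)" by (simp add: power_add)
          also have "\<dots> \<le> l ^ (C3 + C2) * (l ^ 2 * w)"
            using l z w4 by (intro mult_right_mono power_mono) auto
          also have "\<dots> = l ^ C6 * w" by (simp only: C6_def power_add mult_ac)
          finally show ?thesis .
        qed
        have lZ: "l \<le> Z ^ (36 + C2)"
        proof -
          have "l * w \<le> Z ^ (36 + C2) * w" using apex_comb_card[OF comb(1) finW] wZ by (simp add: l_def)
          then show ?thesis using w4 by simp
        qed
        have "4 \<le> card S" using l(3) by (simp add: l_def)
        then have "(\<exists>Y\<subseteq>X. homogeneous E Y \<and> w powr s1 \<le> real (card Y)) \<or>
           (\<exists>k Bs. l powr s3 \<le> k \<and> (blocks X k (w / k powr s2) (complete_pair E) Bs \<or>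
              blocks X k (w / k powr s2) (anticomplete_pair E) Bs)) \<or>
           (\<exists>Bs. blocks X l (w / l ^ 2) (\<lambda>P Q. complete_pair E P Q \<or> anticomplete_pair E P Q) Bs)"
          using star apex_comb_mono[OF comb(1) zW(3)] w4 unfolding comb_property_def l_def by blast
        then consider (hom) Y where "Y \<subseteq> X" "homogeneous E Y" "w powr s1 \<le> real (card Y)"
          | (cb) k Bs R where "l powr s3 \<le> k" "blocks X k (w / k powr s2) R Bs" "R = complete_pair E \<or> R = anticomplete_pair E"
          | (pure) Bs where "blocks X l (w / l ^ 2) (\<lambda>P Q. complete_pair E P Q \<or> anticomplete_pair E P Q) Bs"
          by blast
        then show ?thesis
        proof cases
          case hom
          have "?x / Z ^ C \<le> ?x / Z ^ C5"
            using Z1 by (intro divide_left_mono Zpow) (auto simp: C_def)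
          also have "\<dots> \<le> w" using xw Z1 by (simp add: field_simps)
          finally have "(?x / Z ^ C) powr s1 \<le> w powr s1" using s Z1 by (intro powr_mono2) auto
          then have "(?x / Z ^ C) powr s1 \<le> real (card Y)" using hom(3) by linarith
          then have ?ii using hom by blast
          then show ?thesis by (intro disjI2 disjI1)
        next
          case cb
          have le: "?x / k powr real D \<le> w / k powr s2"
            by (rule powr_block_bound[OF l(2) cb(1) s(3) _ xl D1]) (use w4 in simp)
          have "(2 powr (1 / s3)) powr s3 \<le> l powr s3" using z0 zW(1) l s by (intro powr_mono2) auto
          then have k2: "2 \<le> k" using cb(1) s by (simp add: powr_powr)
          show ?thesis
          \<comment> \<open>A short complete or anti-complete blockade misses the bound on
            \<open>k\<close> in the third outcome, but it is a legitimate subdivision.\<close>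
          proof (cases "Z ^ 2 \<le> k")
            case True
            have "blocks X k (?x / k powr real D) R Bs"
              by (rule blocks_mono[OF cb(2) subset_refl le])
            then have ?iii using True cb(3) by blast
            then show ?thesis by (intro disjI2 disjI1)
          next
            case False
            have k0: "0 \<le> k" using k2 by simp
            obtain Ps where Ps: "length Ps = nat \<lceil>k\<rceil>" "\<And>P. P \<in> set Ps \<Longrightarrow> P \<subseteq> X \<and> w / k powr s2 \<le> real (card P)"
              "sorted_wrt (step_rel E \<sigma>) Ps"
              using truncate_blocks[OF sym less_imp_le[OF sr(1)] cb(2) k0] cb(3) by blast
            have lenk: "k \<le> real (length Ps)" "real (length Ps) \<le> k + 1" unfolding Ps(1) using k0 by linarith+
            have "2 \<le> length Ps" using lenk(1) k2 by linarith
            moreover have "real (length Ps) \<le> Z ^ M0"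
            proof -
              have "real (length Ps) \<le> Z ^ 2 + Z ^ 2" using lenk(2) False k2 by linarith
              also have "\<dots> \<le> Z * Z ^ 2" using zZ by (simp add: mult_right_mono)
              also have "\<dots> = Z ^ 3" by (simp add: power_numeral_reduce)
              also have "\<dots> \<le> Z ^ M0" by (rule Zpow) (simp add: M0_def)
              finally show ?thesis .
            qed
            moreover have "P \<subseteq> X \<and> ?x \<le> real (length Ps) ^ D * real (card P)" if P: "P \<in> set Ps" for P
            proof
              show "P \<subseteq> X" using Ps(2)[OF P] by blast
              have kp: "k powr real D = k ^ D" using k2 by (simp add: powr_realpow)
              have "?x / k ^ D \<le> real (card P)" using order_trans[OF le conjunct2[OF Ps(2)[OF P]]] unfolding kp .
              then have "?x \<le> k ^ D * real (card P)" using k2 by (simp add: field_simps)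
              also have "\<dots> \<le> real (length Ps) ^ D * real (card P)"
                using lenk k0 by (intro mult_right_mono power_mono) auto
              finally show "?x \<le> real (length Ps) ^ D * real (card P)" .
            qed
            ultimately have ?step using Ps(3) by (intro exI[of _ Ps]) (simp add: \<sigma>_def)
            then show ?thesis by (intro disjI2)
          qed
        next
          case pure
          have l0: "0 \<le> l" using l by simp
          obtain Ps where Ps: "length Ps = nat \<lceil>l\<rceil>" "\<And>P. P \<in> set Ps \<Longrightarrow> P \<subseteq> X \<and> w / l ^ 2 \<le> real (card P)"
            "sorted_wrt (step_rel E \<sigma>) Ps"
            using truncate_blocks[OF sym less_imp_le[OF sr(1)] pure l0] by blast
          have len: "real (length Ps) = l" unfolding Ps(1) by (simp add: l_def)
          have "2 \<le> length Ps" using len l by linarith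
          moreover have "real (length Ps) \<le> Z ^ M0"
          proof -
            have "Z ^ (36 + C2) \<le> Z ^ M0" by (rule Zpow) (simp add: M0_def)
            then show ?thesis using len lZ by linarith
          qed
          moreover have "P \<subseteq> X \<and> ?x \<le> real (length Ps) ^ D * real (card P)" if P: "P \<in> set Ps" for P
          proof
            show "P \<subseteq> X" using Ps(2)[OF P] by blast
            have "w \<le> l ^ 2 * real (card P)" using Ps(2)[OF P] l by (simp add: field_simps)
            then have "?x \<le> l ^ C6 * (l ^ 2 * real (card P))"
              using l by (intro le_mult_trans[OF xl]) simp_all
            also have "\<dots> = l ^ (C6 + 2) * real (card P)" by (simp only: power_add mult_ac)
            also have "\<dots> \<le> l ^ D * real (card P)"
              using l by (intro mult_right_mono power_increasing) (auto simp: D_def)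
            finally show "?x \<le> real (length Ps) ^ D * real (card P)" using len by simp
          qed
          ultimately have ?step using Ps(3) by (intro exI[of _ Ps]) (simp add: \<sigma>_def)
          then show ?thesis by (intro disjI2)
        qed
      qed
    qed
  qed
  have "2 \<le> Z0" using z0 by (simp add: Z0_def)
  moreover have "\<forall>(E :: 'a \<Rightarrow> 'a \<Rightarrow> bool) X Z. tame c E X \<and> comb_property s1 s2 s3 E X \<and>
      Z0 \<le> Z \<and> Z ^ C \<le> real (card X) \<longrightarrow>
    (\<exists>W\<subseteq>X. real (card X) \<le> Z ^ C * real (card W) \<and> restricted_rel E (1 / Z ^ 8) W) \<or>
    (\<exists>Y\<subseteq>X. homogeneous E Y \<and> (real (card X) / Z ^ C) powr s1 \<le> real (card Y)) \<or>
    (\<exists>k Bs. Z ^ 2 \<le> k \<and> (blocks X k (real (card X) / k powr real D) (complete_pair E) Bs \<or>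
       blocks X k (real (card X) / k powr real D) (anticomplete_pair E) Bs)) \<or>
    (\<exists>Ps. 2 \<le> length Ps \<and> real (length Ps) \<le> Z ^ M0 \<and>
       (\<forall>P\<in>set Ps. P \<subseteq> X \<and> real (card X) \<le> real (length Ps) ^ D * real (card P)) \<and>
       sorted_wrt (step_rel E ((1 / Z ^ 16) ^ 2)) Ps)"
    by (intro allI impI, elim conjE, rule main)
  ultimately show ?thesis by (intro exI conjI)
qed

text \<open>\<open>Z\<close> is a fixed power of 1/\<epsilon>. If the last three outcomes fail in
  \<open>V\<close>, then, sizes being relative to \<open>V\<close>, they fail in every subset with
  at least \<open>x0\<close> vertices; so each such subset can be subdivided, and the recursion
  yields the blockade.\<close>

lemma restricted_or_blockade:
  fixes c s1 s2 s3 :: real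
  assumes c: "0 < c" and s: "0 < s1" "0 < s2" "0 < s3"
  shows "\<exists>a D :: nat. 3 \<le> a \<and> 0 < D \<and> (\<forall>(E :: 'a \<Rightarrow> 'a \<Rightarrow> bool) V \<epsilon>. tame c E V \<and> (\<forall>X\<subseteq>V. comb_property s1 s2 s3 E X) \<and>
      0 < \<epsilon> \<and> \<epsilon> < 1 / 2 \<longrightarrow>
    (\<exists>Bs. (\<forall>B\<in>set Bs. B \<subseteq> V \<and> \<epsilon> ^ a * real (card V) \<le> real (card B)) \<and> 1 / \<epsilon> \<le> real (length Bs) \<and>
       sorted_wrt (final_rel E (\<epsilon> ^ 8)) Bs) \<or>
    (\<exists>Y\<subseteq>V. homogeneous E Y \<and> (\<epsilon> ^ a * real (card V)) powr s1 \<le> real (card Y)) \<or>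
    (\<exists>k Bs. 1 / \<epsilon> \<le> k \<and> (blocks V k (real (card V) / k powr real D) (complete_pair E) Bs \<or>
       blocks V k (real (card V) / k powr real D) (anticomplete_pair E) Bs)) \<or>
    (\<exists>W\<subseteq>V. restricted_rel E (\<epsilon> ^ 4) W \<and> \<epsilon> ^ a * real (card V) \<le> real (card W)))"
proof -
  obtain Z0 and C M0 D :: nat where Z0: "2 \<le> Z0" and mstep: "\<forall>(E :: 'a \<Rightarrow> 'a \<Rightarrow> bool) X Z.
      tame c E X \<and> comb_property s1 s2 s3 E X \<and> Z0 \<le> Z \<and> Z ^ C \<le> real (card X) \<longrightarrow>
    (\<exists>W\<subseteq>X. real (card X) \<le> Z ^ C * real (card W) \<and> restricted_rel E (1 / Z ^ 8) W) \<or>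
    (\<exists>Y\<subseteq>X. homogeneous E Y \<and> (real (card X) / Z ^ C) powr s1 \<le> real (card Y)) \<or>
    (\<exists>k Bs. Z ^ 2 \<le> k \<and> (blocks X k (real (card X) / k powr real D) (complete_pair E) Bs \<or>
       blocks X k (real (card X) / k powr real D) (anticomplete_pair E) Bs)) \<or>
    (\<exists>Ps. 2 \<le> length Ps \<and> real (length Ps) \<le> Z ^ M0 \<and>
       (\<forall>P\<in>set Ps. P \<subseteq> X \<and> real (card X) \<le> real (length Ps) ^ D * real (card P)) \<and>
       sorted_wrt (step_rel E ((1 / Z ^ 16) ^ 2)) Ps)"
    using restricted_homogeneous_or_subdivision[OF c s, where 'a = 'a] by (elim exE conjE) (rule that)
  \<comment> \<open>Since 1/\<epsilon> is larger than 2, taking this power puts \<open>Z\<close>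
    above the threshold \<open>Z0\<close> for every \<epsilon>, so values near 1/2 need no separate
    argument.\<close>
  obtain r' :: nat where r': "Z0 < 2 ^ r'" using real_arch_pow[of 2 Z0] by auto
  define r where "r = Suc r'"
  \<comment> \<open>The exponent of \<open>Z\<close> lost in the recursion run with
    \<open>M = Z ^ M0\<close> and \<open>K = Z ^ 2\<close>. In \<open>D'\<close> it can be charged
    to \<open>k\<close>, which is at least \<open>Z\<close>; the \<open>Suc\<close> keeps
    \<open>D'\<close> positive.\<close>
  define c1 where "c1 = M0 * D + 2 * (D + 1)"
  define a where "a = r * (C + c1) + 3"
  define D' where "D' = Suc (D + c1)"
  have main: "(\<exists>Bs. (\<forall>B\<in>set Bs. B \<subseteq> V \<and> \<epsilon> ^ a * real (card V) \<le> real (card B)) \<and> 1 / \<epsilon> \<le> real (length Bs) \<and>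
       sorted_wrt (final_rel E (\<epsilon> ^ 8)) Bs) \<or>
    (\<exists>Y\<subseteq>V. homogeneous E Y \<and> (\<epsilon> ^ a * real (card V)) powr s1 \<le> real (card Y)) \<or>
    (\<exists>k Bs. 1 / \<epsilon> \<le> k \<and> (blocks V k (real (card V) / k powr real D') (complete_pair E) Bs \<or>
       blocks V k (real (card V) / k powr real D') (anticomplete_pair E) Bs)) \<or>
    (\<exists>W\<subseteq>V. restricted_rel E (\<epsilon> ^ 4) W \<and> \<epsilon> ^ a * real (card V) \<le> real (card W))"
    (is "?i \<or> ?ii \<or> ?iii \<or> ?iv")
    if tame: "tame c E V" and star: "\<forall>X\<subseteq>V. comb_property s1 s2 s3 E X" and eps: "0 < \<epsilon>" "\<epsilon> < 1 / 2"
    for E :: "'a \<Rightarrow> 'a \<Rightarrow> bool" and V \<epsilon>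
  proof (rule ccontr)
    assume no: "\<not> ?thesis"
    let ?n = "real (card V)"
    have finV: "finite V" and sym: "symp E" and irr: "irreflp E" using tame by (auto simp: tame_def)
    define Z where "Z = (1 / \<epsilon>) ^ r"
    have ie: "2 \<le> 1 / \<epsilon>" using eps by (simp add: field_simps)
    have "2 ^ r' \<le> (1 / \<epsilon>) ^ r'" using ie by (intro power_mono) auto
    also have "\<dots> \<le> Z" unfolding Z_def r_def using ie by (intro power_increasing) auto
    finally have Z: "Z0 \<le> Z" "2 \<le> Z" using r' Z0 by linarith+
    have Z1: "1 \<le> Z" "0 < Z" using Z by auto
    have Zpow: "Z ^ m \<le> Z ^ n" if "m \<le> n" for m n :: nat using that Z1(1) by (rule power_increasing)
    have eZ: "1 / Z ^ m = \<epsilon> ^ (r * m)" for m by (simp add: Z_def power_divide flip: power_mult)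
    have eps_pow: "\<epsilon> ^ m \<le> \<epsilon> ^ n" if "n \<le> m" for m n :: nat
      using that eps by (intro power_decreasing) auto
    have Ze: "1 / \<epsilon> \<le> Z"
      unfolding Z_def r_def using power_increasing[of 1 "Suc r'" "1 / \<epsilon>"] ie by simp
    have ea: "\<epsilon> ^ a \<le> 1 / Z ^ (C + c1)" unfolding eZ a_def by (rule eps_pow) simp
    have e4: "1 / Z ^ 8 \<le> \<epsilon> ^ 4" unfolding eZ by (rule eps_pow) (simp add: r_def)
    have e8: "1 / Z ^ 16 \<le> \<epsilon> ^ 8" unfolding eZ by (rule eps_pow) (simp add: r_def)
    have small: "\<epsilon> ^ a * ?n \<le> ?n / Z ^ (C + c1)" using mult_right_mono[OF ea, of ?n] by simp
    \<comment> \<open>In a small set the required size of a homogeneous set is at most 1, and a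
      single vertex will do. In the empty set the empty set serves, as \<open>0 powr s1\<close> is
      0.\<close>
    have big: "Z ^ (C + c1) \<le> ?n"
    proof (rule ccontr)
      assume "\<not> ?thesis"
      then have "?n / Z ^ (C + c1) \<le> 1" using Z1 by (simp add: divide_le_eq)
      then have le1: "\<epsilon> ^ a * ?n \<le> 1" using small by linarith
      have ?ii
      proof (cases "V = {}")
        case True
        then show ?thesis by (intro exI[of _ "{}"]) (auto simp: homogeneous_def edgeless_def)
      next
        case False
        then obtain x where x: "x \<in> V" by blast
        have "(\<epsilon> ^ a * ?n) powr s1 \<le> 1 powr s1" using le1 eps s by (intro powr_mono2) auto
        then show ?thesis
          using x irr by (intro exI[of _ "{x}"]) (auto simp: homogeneous_def edgeless_def irreflp_def)
      qed
      with no show False by blast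
    qed
    \<comment> \<open>A lower bound for the sets that the recursion subdivides: they have lost at
      most Z^c1 and still have Z^C vertices.\<close>
    define x0 where "x0 = ?n / Z ^ c1"
    have x0C: "Z ^ C \<le> x0" using big Z1 by (simp add: x0_def power_add field_simps)
    define \<tau> where "\<tau> = 1 / Z ^ 16"
    have step: "\<exists>Ps. 2 \<le> length Ps \<and> real (length Ps) \<le> Z ^ M0 \<and>
       (\<forall>P\<in>set Ps. P \<subseteq> X \<and> real (card X) \<le> real (length Ps) ^ D * real (card P)) \<and>
       sorted_wrt (step_rel E (\<tau> ^ 2)) Ps"
      if X: "X \<subseteq> V" "x0 \<le> real (card X)" for X
    proof -
      let ?x = "real (card X)"
      have xn: "?n / Z ^ (C + c1) \<le> ?x / Z ^ C"
        using X(2) Z1 by (simp add: x0_def power_add field_simps)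
      have "Z ^ C \<le> ?x" using X(2) x0C by linarith
      then have "tame c E X \<and> comb_property s1 s2 s3 E X \<and> Z0 \<le> Z \<and> Z ^ C \<le> ?x"
        using tame_subset[OF tame X(1)] star X(1) Z(1) by simp
      from mstep[THEN spec, THEN spec, THEN spec, THEN mp, OF this]
      consider (iv) W where "W \<subseteq> X" "?x \<le> Z ^ C * real (card W)" "restricted_rel E (1 / Z ^ 8) W"
        | (ii) Y where "Y \<subseteq> X" "homogeneous E Y" "(?x / Z ^ C) powr s1 \<le> real (card Y)"
        | (iii) k Bs R where "Z ^ 2 \<le> k" "blocks X k (?x / k powr real D) R Bs" "R = complete_pair E \<or> R = anticomplete_pair E"
        | (st) "\<exists>Ps. 2 \<le> length Ps \<and> real (length Ps) \<le> Z ^ M0 \<and>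
            (\<forall>P\<in>set Ps. P \<subseteq> X \<and> ?x \<le> real (length Ps) ^ D * real (card P)) \<and>
            sorted_wrt (step_rel E ((1 / Z ^ 16) ^ 2)) Ps"
        by blast
      then show ?thesis
      proof cases
        case st
        then show ?thesis by (simp only: \<tau>_def)
      next
        case iv
        have "?x / Z ^ C \<le> real (card W)" using iv(2) Z1 by (simp add: field_simps)
        then have "\<epsilon> ^ a * ?n \<le> real (card W)" using small xn by linarith
        moreover have "restricted_rel E (\<epsilon> ^ 4) W" using iv(3) e4 restricted_rel_mono by blast
        ultimately have ?iv using iv(1) X(1) by blast
        with no show ?thesis by blast
      next
        case ii
        have "\<epsilon> ^ a * ?n \<le> ?x / Z ^ C" using small xn by linarith
        then have "(\<epsilon> ^ a * ?n) powr s1 \<le> (?x / Z ^ C) powr s1" using s eps by (intro powr_mono2) auto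
        then have "(\<epsilon> ^ a * ?n) powr s1 \<le> real (card Y)" using ii(3) by linarith
        then have ?ii using ii(1,2) X(1) by blast
        with no show ?thesis by blast
      next
        case iii
        have kZ: "Z \<le> k" using iii(1) Zpow[of 1 2] by simp
        have k1: "1 \<le> k" "1 / \<epsilon> \<le> k" using kZ Z1 Ze by linarith+
        have "?n / k powr real D' \<le> ?x / k powr real D"
        proof -
          have kp: "k powr real m = k ^ m" for m using k1 by (simp add: powr_realpow)
          have "?n \<le> ?x * Z ^ c1" using X(2) Z1 by (simp add: x0_def field_simps)
          also have "\<dots> \<le> ?x * k ^ Suc c1"
          proof (rule mult_left_mono)
            have "Z ^ c1 \<le> k ^ c1" using kZ Z1 by (intro power_mono) auto
            also have "\<dots> \<le> k ^ Suc c1" using k1 by (intro power_increasing) auto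
            finally show "Z ^ c1 \<le> k ^ Suc c1" .
          qed simp
          finally have "?n / (k ^ Suc c1 * k ^ D) \<le> ?x / k ^ D"
            using k1 by (simp add: field_simps)
          then show ?thesis unfolding kp by (simp add: D'_def power_add mult_ac)
        qed
        then have "blocks V k (?n / k powr real D') R Bs"
          by (rule blocks_mono[OF iii(2) X(1)])
        then have ?iii using iii(3) k1(2) by blast
        with no show ?thesis by blast
      qed
    qed
    have tau: "0 < \<tau>" "\<tau> \<le> 1" using Z1 by (auto simp: \<tau>_def divide_le_eq_1 intro: one_le_power)
    have x0': "0 \<le> x0" using Z1 by (simp add: x0_def)
    have M: "1 \<le> Z ^ M0" using Z1 by (intro one_le_power)
    have K: "1 \<le> Z ^ 2" using Z1 by (intro one_le_power)
    obtain j :: nat where j: "Z ^ 2 \<le> 2 ^ j" using real_arch_pow[of 2 "Z ^ 2"] by (auto intro: less_imp_le)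
    have small4: "4 * Z ^ 2 * \<tau> \<le> 1"
    proof -
      have "4 * Z ^ 2 \<le> Z ^ 2 * Z ^ 2" using power_mono[of 2 Z 2] Z by (intro mult_right_mono) auto
      also have "\<dots> = Z ^ 4" by (simp flip: power_add)
      also have "\<dots> \<le> Z ^ 16" by (rule Zpow) simp
      finally show ?thesis using Z1 by (simp add: \<tau>_def)
    qed
    have pw: "(Z ^ M0) ^ D * (Z ^ 2) ^ (D + 1) = Z ^ c1"
      by (simp only: c1_def power_add power_mult)
    have "x0 * (Z ^ M0) ^ D * (Z ^ 2) ^ (D + 1) = x0 * Z ^ c1" by (simp only: mult.assoc pw)
    also have "\<dots> = ?n" using Z1 by (simp add: x0_def)
    finally have sz: "x0 * (Z ^ M0) ^ D * (Z ^ 2) ^ (D + 1) \<le> ?n" by simp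
    obtain Qs where Qs: "length Qs = nat \<lceil>Z ^ 2\<rceil>"
      "\<And>Q. Q \<in> set Qs \<Longrightarrow> Q \<subseteq> V \<and> ?n \<le> (Z ^ M0) ^ D * (Z ^ 2) ^ (D + 1) * real (card Q)"
      "sorted_wrt (final_rel E \<tau>) Qs"
      using blockade_recursion[OF sym finV tau x0' M step K j small4 subset_refl sz] by blast
    have ?i
    proof (intro exI[of _ Qs] conjI ballI)
      fix Q assume Q: "Q \<in> set Qs"
      show "Q \<subseteq> V" using Qs(2)[OF Q] by blast
      have "?n \<le> Z ^ c1 * real (card Q)" using Qs(2)[OF Q] pw by simp
      then have "?n / Z ^ c1 \<le> real (card Q)" using Z1 by (simp add: field_simps)
      moreover have "?n / Z ^ (C + c1) \<le> ?n / Z ^ c1"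
        using Z1 by (intro divide_left_mono Zpow) auto
      ultimately show "\<epsilon> ^ a * ?n \<le> real (card Q)" using small by linarith
    next
      have "Z \<le> Z ^ 2" using Zpow[of 1 2] by simp
      then show "1 / \<epsilon> \<le> real (length Qs)" using Ze unfolding Qs(1) by linarith
      show "sorted_wrt (final_rel E (\<epsilon> ^ 8)) Qs"
      proof (rule sorted_wrt_mono_rel[OF _ Qs(3)])
        fix P Q assume "final_rel E \<tau> P Q"
        moreover have "few_edges E (\<epsilon> ^ 8) P Q" if "few_edges E \<tau> P Q"
        proof -
          have "\<tau> * real (card P) * real (card Q) \<le> \<epsilon> ^ 8 * real (card P) * real (card Q)"
            using e8 unfolding \<tau>_def by (intro mult_right_mono) auto
          then show ?thesis using that unfolding few_edges_def by linarith
        qed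
        ultimately show "final_rel E (\<epsilon> ^ 8) P Q" by (auto simp: final_rel_def)
      qed
    qed
    with no show False by blast
  qed
  have "3 \<le> a" "0 < D'" by (auto simp: a_def D'_def)
  moreover have "\<forall>(E :: 'a \<Rightarrow> 'a \<Rightarrow> bool) V \<epsilon>. tame c E V \<and> (\<forall>X\<subseteq>V. comb_property s1 s2 s3 E X) \<and>
      0 < \<epsilon> \<and> \<epsilon> < 1 / 2 \<longrightarrow>
    (\<exists>Bs. (\<forall>B\<in>set Bs. B \<subseteq> V \<and> \<epsilon> ^ a * real (card V) \<le> real (card B)) \<and> 1 / \<epsilon> \<le> real (length Bs) \<and>
       sorted_wrt (final_rel E (\<epsilon> ^ 8)) Bs) \<or>
    (\<exists>Y\<subseteq>V. homogeneous E Y \<and> (\<epsilon> ^ a * real (card V)) powr s1 \<le> real (card Y)) \<or>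
    (\<exists>k Bs. 1 / \<epsilon> \<le> k \<and> (blocks V k (real (card V) / k powr real D') (complete_pair E) Bs \<or>
       blocks V k (real (card V) / k powr real D') (anticomplete_pair E) Bs)) \<or>
    (\<exists>W\<subseteq>V. restricted_rel E (\<epsilon> ^ 4) W \<and> \<epsilon> ^ a * real (card V) \<le> real (card W))"
    by (intro allI impI, elim conjE, rule main)
  ultimately show ?thesis by (intro exI conjI)
qed

end

subsection \<open>Transfer to graphs\<close>

definition adj :: "graph \<Rightarrow> nat \<Rightarrow> nat \<Rightarrow> bool" where
  "adj G x y \<longleftrightarrow> {x, y} \<in> edges G"

lemma symp_adj: "symp (adj G)"
  by (auto simp: symp_def adj_def insert_commute)

lemma irreflp_adj: "simple_graph G \<Longrightarrow> irreflp (adj G)"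
  by (auto simp: irreflp_def adj_def simple_graph_def nsets_def)

lemma verts_induced: "X \<subseteq> verts G \<Longrightarrow> verts (induced G X) = X"
  by (auto simp: induced_def)

lemma adj_induced: "adj (induced G X) x y \<longleftrightarrow> adj G x y \<and> x \<in> X \<and> y \<in> X"
  by (auto simp: adj_def induced_def)

lemma simple_induced: "simple_graph G \<Longrightarrow> simple_graph (induced G X)"
  by (auto simp: simple_graph_def induced_def nsets_def)

lemma induced_induced: "Y \<subseteq> X \<Longrightarrow> induced (induced G X) Y = induced G Y"
  by (auto simp: induced_def)

lemma free_induced:
  assumes "free \<F> G" and X: "X \<subseteq> verts G"
  shows "free \<F> (induced G X)"
  unfolding free_def verts_induced[OF X]
proof
  assume "\<exists>Y\<subseteq>X. \<exists>F\<in>\<F>. isomorphic (induced (induced G X) Y) F"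
  then obtain Y F where Y: "Y \<subseteq> X" "F \<in> \<F>" "isomorphic (induced (induced G X) Y) F" by blast
  then have "isomorphic (induced G Y) F" "Y \<subseteq> verts G" using X by (simp_all add: induced_induced)
  with assms(1) Y(2) show False by (auto simp: free_def)
qed

lemma verts_complement: "verts (complement G) = verts G"
  by (simp add: complement_def)

lemma simple_complement: "simple_graph G \<Longrightarrow> simple_graph (complement G)"
  by (auto simp: simple_graph_def complement_def)

lemma adj_complement:
  "x \<in> verts G \<Longrightarrow> y \<in> verts G \<Longrightarrow> adj (complement G) x y \<longleftrightarrow> x \<noteq> y \<and> \<not> adj G x y"
  by (auto simp: adj_def complement_def nsets_def card_2_iff)

lemma isomorphic_adj:
  "isomorphic G H \<longleftrightarrow> (\<exists>f. bij_betw f (verts G) (verts H) \<and>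
     (\<forall>u\<in>verts G. \<forall>v\<in>verts G. adj G u v \<longleftrightarrow> adj H (f u) (f v)))"
  by (simp add: isomorphic_def adj_def)

section \<open>Induced copies as embeddings\<close>

lemma embeds_imp_isomorphic:
  assumes G: "simple_graph G" and F: "simple_graph F" and X: "X \<subseteq> verts G"
    and P: "\<And>i j. i \<in> verts F \<Longrightarrow> j \<in> verts F \<Longrightarrow> i \<noteq> j \<Longrightarrow> P i j \<longleftrightarrow> adj F i j"
    and emb: "embeds (adj G) P (verts F) X"
  shows "\<exists>Y\<subseteq>X. isomorphic (induced G Y) F"
proof -
  obtain f where f: "inj_on f (verts F)" "f ` verts F \<subseteq> X"
    "\<forall>i\<in>verts F. \<forall>j\<in>verts F. i \<noteq> j \<longrightarrow> (adj G (f i) (f j) \<longleftrightarrow> P i j)"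
    using emb unfolding embeds_def by auto
  define Y where "Y = f ` verts F"
  define g where "g = the_inv_into (verts F) f"
  have YG: "Y \<subseteq> verts G" using f(2) X by (auto simp: Y_def)
  have g: "bij_betw g Y (verts F)"
    unfolding g_def Y_def using f(1) by (intro bij_betw_the_inv_into) (simp add: bij_betw_def)
  have gf: "g (f i) = i" if "i \<in> verts F" for i using that f(1) by (simp add: g_def the_inv_into_f_f)
  have "adj (induced G Y) u v \<longleftrightarrow> adj F (g u) (g v)" if uv: "u \<in> Y" "v \<in> Y" for u v
  proof -
    obtain i j where ij: "i \<in> verts F" "j \<in> verts F" "u = f i" "v = f j" using uv by (auto simp: Y_def)
    have ir: "\<not> adj G u u" "\<not> adj F i i" using irreflp_adj[OF G] irreflp_adj[OF F] by (auto simp: irreflp_def)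
    show ?thesis
    proof (cases "i = j")
      case True
      then show ?thesis using ij ir gf by (simp add: adj_induced)
    next
      case False
      then show ?thesis using ij gf f(3) P uv by (simp add: adj_induced)
    qed
  qed
  then have "isomorphic (induced G Y) F"
    unfolding isomorphic_adj verts_induced[OF YG] using g by blast
  then show ?thesis using f(2) by (auto simp: Y_def)
qed

lemma isomorphic_imp_embeds:
  assumes "Y \<subseteq> verts G" "isomorphic (induced G Y) F"
  shows "embeds (adj G) (adj F) (verts F) Y"
proof -
  obtain f where f: "bij_betw f Y (verts F)"
    "\<forall>u\<in>Y. \<forall>v\<in>Y. adj (induced G Y) u v \<longleftrightarrow> adj F (f u) (f v)"
    using assms(2) unfolding isomorphic_adj verts_induced[OF assms(1)] by blast
  define g where "g = the_inv_into Y f"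
  have inj: "inj_on f Y" and im: "f ` Y = verts F" using f(1) by (auto simp: bij_betw_def)
  have g: "bij_betw g (verts F) Y" unfolding g_def by (rule bij_betw_the_inv_into[OF f(1)])
  have fg: "g i \<in> Y" "f (g i) = i" if "i \<in> verts F" for i
    using that inj im by (auto simp: g_def the_inv_into_into f_the_inv_into_f)
  have "adj G (g i) (g j) \<longleftrightarrow> adj F i j" if "i \<in> verts F" "j \<in> verts F" for i j
    using f(2) fg[OF that(1)] fg[OF that(2)] by (simp add: adj_induced)
  then show ?thesis
    unfolding embeds_def using g by (intro exI[of _ g]) (auto simp: bij_betw_def)
qed

lemma homogeneous_clique_or_indep:
  assumes "simple_graph G"
  shows "homogeneous (adj G) X \<longleftrightarrow> clique X (edges G) \<or> indep X (edges G)"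
proof -
  have irr: "\<not> adj G x x" for x using irreflp_adj[OF assms] by (auto simp: irreflp_def)
  have "edgeless (adj G) X \<longleftrightarrow> (\<forall>x\<in>X. \<forall>y\<in>X. x \<noteq> y \<longrightarrow> \<not> adj G x y)"
  proof
    assume "\<forall>x\<in>X. \<forall>y\<in>X. x \<noteq> y \<longrightarrow> \<not> adj G x y"
    then have "\<not> adj G x y" if "x \<in> X" "y \<in> X" for x y using that irr by (cases "x = y") simp_all
    then show "edgeless (adj G) X" by (simp add: edgeless_def)
  qed (simp add: edgeless_def)
  then have "edgeless (adj G) X \<longleftrightarrow> indep X (edges G)" by (simp only: indep_def adj_def)
  moreover have "edgeless (co (adj G)) X \<longleftrightarrow> (\<forall>x\<in>X. \<forall>y\<in>X. x \<noteq> y \<longrightarrow> adj G x y)"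
    unfolding edgeless_def co_def by blast
  then have "edgeless (co (adj G)) X \<longleftrightarrow> clique X (edges G)" by (simp only: clique_def adj_def)
  ultimately show ?thesis by (simp only: homogeneous_def disj_commute)
qed

lemma complete_to_pair: "complete_to G X Y \<longleftrightarrow> complete_pair (adj G) X Y"
  by (simp add: complete_to_def complete_pair_def adj_def)

lemma anticomplete_to_pair: "anticomplete_to G X Y \<longleftrightarrow> anticomplete_pair (adj G) X Y"
  by (simp add: anticomplete_to_def anticomplete_pair_def adj_def)

section \<open>Blockades and ordered lists of blocks\<close>

lemma pairwise_blocks_sorted:
  assumes "\<And>P Q. R P Q \<Longrightarrow> R Q P"
  shows "pairwise_blocks R Bs \<longleftrightarrow> sorted_wrt R Bs"
proof
  assume "pairwise_blocks R Bs"
  then show "sorted_wrt R Bs" by (simp add: pairwise_blocks_def sorted_wrt_iff_nth_less)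
next
  assume s: "sorted_wrt R Bs"
  have "R (Bs ! i) (Bs ! j)" if "i < length Bs" "j < length Bs" "i \<noteq> j" for i j
  proof (cases "i < j")
    case True
    then show ?thesis using s that by (simp add: sorted_wrt_iff_nth_less)
  next
    case False
    then have "R (Bs ! j) (Bs ! i)" using s that by (simp add: sorted_wrt_iff_nth_less)
    then show ?thesis by (rule assms)
  qed
  then show "pairwise_blocks R Bs" by (simp add: pairwise_blocks_def)
qed

lemma complete_pair_sym: "complete_pair (adj G) P Q \<Longrightarrow> complete_pair (adj G) Q P"
  using symp_adj by (auto simp: complete_pair_def dest: sympD)

lemma anticomplete_pair_sym: "anticomplete_pair (adj G) P Q \<Longrightarrow> anticomplete_pair (adj G) Q P"
  using symp_adj by (auto simp: anticomplete_pair_def dest: sympD)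

lemma blocks_iff_blockade:
  assumes sym: "\<And>P Q. R P Q \<Longrightarrow> R Q P"
  shows "blocks (verts G) l w R Bs \<longleftrightarrow> blockade G l w Bs \<and> pairwise_blocks R Bs"
proof -
  have "sorted_wrt (\<lambda>P Q. P \<inter> Q = {} \<and> R P Q) Bs \<longleftrightarrow> pairwise_blocks (\<lambda>P Q. P \<inter> Q = {} \<and> R P Q) Bs"
    using sym by (intro pairwise_blocks_sorted[symmetric]) auto
  also have "\<dots> \<longleftrightarrow> pairwise_blocks disjnt Bs \<and> pairwise_blocks R Bs"
    by (auto simp: pairwise_blocks_def disjnt_def)
  finally show ?thesis by (auto simp: blocks_def blockade_def)
qed

lemma homogeneous_cong:
  assumes "\<And>x y. x \<in> Y \<Longrightarrow> y \<in> Y \<Longrightarrow> E x y \<longleftrightarrow> E' x y"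
  shows "homogeneous E Y \<longleftrightarrow> homogeneous E' Y"
  using assms by (auto simp: homogeneous_def edgeless_def co_def)

lemma blocks_cong:
  assumes R: "\<And>P Q. P \<subseteq> X \<Longrightarrow> Q \<subseteq> X \<Longrightarrow> R P Q \<Longrightarrow> R' P Q" and b: "blocks X l w R Bs"
  shows "blocks X l w R' Bs"
proof -
  have sub: "B \<subseteq> X" if "B \<in> set Bs" for B using b that by (simp add: blocks_def)
  have "sorted_wrt (\<lambda>P Q. P \<inter> Q = {} \<and> R P Q) Bs" using b by (simp add: blocks_def)
  then have "sorted_wrt (\<lambda>P Q. P \<inter> Q = {} \<and> R' P Q) Bs"
    by (rule sorted_wrt_mono_rel[rotated]) (use R sub in blast)
  then show ?thesis using b by (simp add: blocks_def)
qed

text \<open>The hypothesis is applied to the subgraph induced by \<open>X\<close>, which is again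
  free of the complements; this places the outcomes inside \<open>X\<close>. On \<open>X\<close> the
  two adjacency relations agree, so combs and outcomes can be carried over.\<close>

lemma comb_property_induced:
  assumes G: "simple_graph G" and free: "free (complement ` \<F>) G" and X: "X \<subseteq> verts G"
    and star: "\<And>G l w as Bs v. simple_graph G \<Longrightarrow> free (complement ` \<F>) G \<Longrightarrow>
      comb G l w as Bs \<and> 4 \<le> l \<and> 4 \<le> w \<and>
           v \<in> verts G - (set as \<union> \<Union>(set Bs)) \<and>
           complete_to G {v} (\<Union>(set Bs)) \<and> anticomplete_to G {v} (set as) \<Longrightarrow>
             has_clique_or_stable G (w powr s1) \<or>
             (\<exists>k\<ge>real l powr s3. has_complete_or_anticomplete_blockade G k (w / k powr s2)) \<or>
             has_pure_blockade G (real l) (w / (real l)^2)"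
  shows "comb_property s1 s2 s3 (adj G) X"
  unfolding comb_property_def
proof (intro allI impI, elim conjE)
  fix S :: "nat set" and w a T v
  assume ac: "apex_comb (adj G) X S w a T v" and S4: "4 \<le> card S" and w4: "4 \<le> w"
  define G' where "G' = induced G X"
  have G': "simple_graph G'" "free (complement ` \<F>) G'" "verts G' = X"
    using simple_induced[OF G] free_induced[OF free X] verts_induced[OF X] by (auto simp: G'_def)
  have adj': "adj G' x y \<longleftrightarrow> adj G x y" if "x \<in> X" "y \<in> X" for x y
    using that by (simp add: G'_def adj_induced)
  \<comment> \<open>Listing the index set in increasing order produces the lists that
    \<open>comb\<close> expects; distinct positions stand for distinct teeth.\<close>
  define xs where "xs = sorted_list_of_set S"
  have finS: "finite S" using ac by (simp add: apex_comb_def)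
  have xs: "set xs = S" "distinct xs" "length xs = card S" using finS by (auto simp: xs_def)
  have xsS: "xs ! i \<in> S" if "i < card S" for i using that xs by (metis nth_mem)
  have xne: "xs ! i \<noteq> xs ! j" if "i < card S" "j < card S" "i \<noteq> j" for i j
    using that xs by (simp add: nth_eq_iff_index_eq)
  have T: "\<And>i. i \<in> S \<Longrightarrow> T i \<subseteq> X" "\<And>i. i \<in> S \<Longrightarrow> w \<le> real (card (T i))" "\<And>i. i \<in> S \<Longrightarrow> v \<notin> T i"
    "\<And>i. i \<in> S \<Longrightarrow> v \<noteq> a i" "\<And>i. i \<in> S \<Longrightarrow> \<not> adj G v (a i)"
    "\<And>i b. i \<in> S \<Longrightarrow> b \<in> T i \<Longrightarrow> adj G (a i) b" "\<And>i b. i \<in> S \<Longrightarrow> b \<in> T i \<Longrightarrow> adj G v b"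
    "\<And>i j. i \<in> S \<Longrightarrow> j \<in> S \<Longrightarrow> a i \<notin> T j"
    "\<And>i j. i \<in> S \<Longrightarrow> j \<in> S \<Longrightarrow> i \<noteq> j \<Longrightarrow> T i \<inter> T j = {}"
    "\<And>i j b. i \<in> S \<Longrightarrow> j \<in> S \<Longrightarrow> i \<noteq> j \<Longrightarrow> b \<in> T j \<Longrightarrow> \<not> adj G (a i) b"
    and aX: "a ` S \<subseteq> X" and inj: "inj_on a S" and vX: "v \<in> X"
    using ac by (simp_all add: apex_comb_def)
  define as where "as = map a xs"
  define Bs where "Bs = map T xs"
  have sets: "set as = a ` S" "\<Union>(set Bs) = (\<Union>i\<in>S. T i)" by (auto simp: as_def Bs_def xs)
  have "comb G' (card S) w as Bs"
    unfolding comb_def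
  proof (intro conjI allI impI)
    show "0 < card S" using S4 by simp
    show "length as = card S" "length Bs = card S" by (simp_all add: as_def Bs_def xs)
    show "blockade G' (real (card S)) w Bs"
      unfolding blockade_def
    proof (intro conjI ballI)
      show "B \<subseteq> verts G'" "w \<le> real (card B)" if "B \<in> set Bs" for B
        using that T(1,2) G'(3) by (auto simp: Bs_def xs)
      show "pairwise_blocks disjnt Bs"
        using T(9) xsS xne by (auto simp: pairwise_blocks_def Bs_def xs disjnt_def)
      show "real (card S) \<le> real (length Bs)" by (simp add: Bs_def xs)
    qed
    show "distinct as" using xs inj by (simp add: as_def distinct_map)
    show "set as \<subseteq> verts G'" using aX sets G'(3) by simp
    show "disjnt (set as) (\<Union>(set Bs))" using T(8) by (auto simp: sets disjnt_def)
    fix i assume i: "i < card S"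
    have asi: "as ! i = a (xs ! i)" and Bsj: "Bs ! j = T (xs ! j)" if "j < card S" for j
      using i that by (simp_all add: as_def Bs_def xs)
    have aiX: "a (xs ! i) \<in> X" using aX xsS[OF i] by blast
    show "complete_to G' {as ! i} (Bs ! i)"
      unfolding complete_to_pair complete_pair_def asi[OF i] Bsj[OF i]
    proof (intro ballI)
      fix x y assume "x \<in> {a (xs ! i)}" and y: "y \<in> T (xs ! i)"
      then have x: "x = a (xs ! i)" by simp
      have "y \<in> X" using T(1)[OF xsS[OF i]] y by blast
      then show "adj G' x y" unfolding x using adj'[OF aiX] T(6)[OF xsS[OF i] y] by simp
    qed
    fix j assume j: "j < card S" "i \<noteq> j"
    show "anticomplete_to G' {as ! i} (Bs ! j)"
      unfolding anticomplete_to_pair anticomplete_pair_def asi[OF i] Bsj[OF j(1)]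
    proof (intro ballI)
      fix x y assume "x \<in> {a (xs ! i)}" and y: "y \<in> T (xs ! j)"
      then have x: "x = a (xs ! i)" by simp
      have "y \<in> X" using T(1)[OF xsS[OF j(1)]] y by blast
      then show "\<not> adj G' x y"
        unfolding x using adj'[OF aiX] T(10)[OF xsS[OF i] xsS[OF j(1)] xne[OF i j] y] by simp
    qed
  qed
  moreover have "v \<in> verts G' - (set as \<union> \<Union>(set Bs))" using vX T(3,4) G'(3) by (auto simp: sets)
  moreover have "complete_to G' {v} (\<Union>(set Bs))"
    unfolding complete_to_pair complete_pair_def sets(2)
  proof (intro ballI)
    fix x y assume "x \<in> {v}" "y \<in> (\<Union>i\<in>S. T i)"
    then obtain i where i: "x = v" "i \<in> S" "y \<in> T i" by blast
    then have "y \<in> X" using T(1) by blast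
    then show "adj G' x y" using adj'[OF vX] T(7)[OF i(2,3)] i(1) by simp
  qed
  moreover have "anticomplete_to G' {v} (set as)"
    unfolding anticomplete_to_pair anticomplete_pair_def sets(1)
  proof (intro ballI)
    fix x y assume "x \<in> {v}" "y \<in> a ` S"
    then obtain i where i: "x = v" "i \<in> S" "y = a i" by blast
    then have "y \<in> X" using aX by blast
    then show "\<not> adj G' x y" using adj'[OF vX] T(5)[OF i(2)] i(1,3) by simp
  qed
  ultimately have out: "has_clique_or_stable G' (w powr s1) \<or>
      (\<exists>k\<ge>real (card S) powr s3. has_complete_or_anticomplete_blockade G' k (w / k powr s2)) \<or>
      has_pure_blockade G' (real (card S)) (w / (real (card S))^2)"
    using star[OF G'(1,2)] S4 w4 by blast
  have cp: "complete_pair (adj G) P Q" if "P \<subseteq> X" "Q \<subseteq> X" "complete_pair (adj G') P Q" for P Q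
    using that adj' unfolding complete_pair_def by blast
  have ap: "anticomplete_pair (adj G) P Q" if "P \<subseteq> X" "Q \<subseteq> X" "anticomplete_pair (adj G') P Q" for P Q
    using that adj' unfolding anticomplete_pair_def by blast
  have symc: "complete_to G' Q P" if "complete_to G' P Q" for P Q
    using that complete_pair_sym by (simp add: complete_to_pair)
  have syma: "anticomplete_to G' Q P" if "anticomplete_to G' P Q" for P Q
    using that anticomplete_pair_sym by (simp add: anticomplete_to_pair)
  from out consider (hom) "has_clique_or_stable G' (w powr s1)"
    | (cb) k where "real (card S) powr s3 \<le> k" "has_complete_or_anticomplete_blockade G' k (w / k powr s2)"
    | (pure) "has_pure_blockade G' (real (card S)) (w / (real (card S))^2)" by blast
  then show "(\<exists>Y\<subseteq>X. homogeneous (adj G) Y \<and> w powr s1 \<le> real (card Y)) \<or>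
     (\<exists>k Bs. real (card S) powr s3 \<le> k \<and> (blocks X k (w / k powr s2) (complete_pair (adj G)) Bs \<or>
        blocks X k (w / k powr s2) (anticomplete_pair (adj G)) Bs)) \<or>
     (\<exists>Bs. blocks X (real (card S)) (w / real (card S) ^ 2)
        (\<lambda>P Q. complete_pair (adj G) P Q \<or> anticomplete_pair (adj G) P Q) Bs)"
  proof cases
    case hom
    then obtain Y where Y: "Y \<subseteq> X" "homogeneous (adj G') Y" "w powr s1 \<le> real (card Y)"
      unfolding has_clique_or_stable_def G'(3) homogeneous_clique_or_indep[OF G'(1)] by blast
    then have "homogeneous (adj G) Y" using adj' homogeneous_cong[of Y "adj G'" "adj G"] by blast
    with Y show ?thesis by blast
  next
    case cb
    from cb(2) obtain Bs where Bs: "blockade G' k (w / k powr s2) Bs"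
      "pairwise_blocks (complete_to G') Bs \<or> pairwise_blocks (anticomplete_to G') Bs"
      unfolding has_complete_or_anticomplete_blockade_def by blast
    from Bs(2) show ?thesis
    proof
      assume "pairwise_blocks (complete_to G') Bs"
      then have "blocks X k (w / k powr s2) (complete_to G') Bs"
        using blocks_iff_blockade[of "complete_to G'" G', OF symc] Bs(1) G'(3) by simp
      then have "blocks X k (w / k powr s2) (complete_pair (adj G)) Bs"
        by (rule blocks_cong[rotated]) (simp add: cp complete_to_pair)
      then show ?thesis using cb(1) by blast
    next
      assume "pairwise_blocks (anticomplete_to G') Bs"
      then have "blocks X k (w / k powr s2) (anticomplete_to G') Bs"
        using blocks_iff_blockade[of "anticomplete_to G'" G', OF syma] Bs(1) G'(3) by simp
      then have "blocks X k (w / k powr s2) (anticomplete_pair (adj G)) Bs"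
        by (rule blocks_cong[rotated]) (simp add: ap anticomplete_to_pair)
      then show ?thesis using cb(1) by blast
    qed
  next
    case pure
    then obtain Bs where Bs: "blockade G' (real (card S)) (w / (real (card S))^2) Bs" "pairwise_blocks (pure_to G') Bs"
      unfolding has_pure_blockade_def by blast
    have symp: "pure_to G' Q P" if "pure_to G' P Q" for P Q
      using that symc syma by (auto simp: pure_to_def)
    have "blocks X (real (card S)) (w / (real (card S))^2) (pure_to G') Bs"
      using blocks_iff_blockade[of "pure_to G'" G', OF symp] Bs G'(3) by simp
    then have "blocks X (real (card S)) (w / (real (card S))^2)
        (\<lambda>P Q. complete_pair (adj G) P Q \<or> anticomplete_pair (adj G) P Q) Bs"
      by (rule blocks_cong[rotated])
        (use cp ap in \<open>auto simp: pure_to_def complete_to_pair anticomplete_to_pair\<close>)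
    then show ?thesis by blast
  qed
qed

section \<open>Sparsity and restriction in graphs\<close>

lemma low_degree_adj:
  assumes "X \<subseteq> verts G"
  shows "low_degree (adj G) c X \<longleftrightarrow> sparse G c X"
proof -
  have "nbhd (adj G) x X = neighbours G x \<inter> X" for x
    using assms by (auto simp: nbhd_def neighbours_def adj_def)
  then show ?thesis by (simp add: low_degree_def sparse_def)
qed

lemma low_degree_co_adj: "X \<subseteq> verts G \<Longrightarrow> low_degree (co (adj G)) c X \<longleftrightarrow> sparse (complement G) c X"
proof -
  assume X: "X \<subseteq> verts G"
  have "nbhd (co (adj G)) x X = nbhd (adj (complement G)) x X" if "x \<in> X" for x
    using that X by (auto simp: nbhd_def co_def adj_complement subset_iff)
  then have "low_degree (co (adj G)) c X \<longleftrightarrow> low_degree (adj (complement G)) c X"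
    by (simp add: low_degree_def)
  also have "\<dots> \<longleftrightarrow> sparse (complement G) c X"
    using X by (intro low_degree_adj) (simp add: verts_complement)
  finally show ?thesis .
qed

lemma restricted_adj: "X \<subseteq> verts G \<Longrightarrow> restricted_rel (adj G) c X \<longleftrightarrow> restricted G c X"
  by (simp add: restricted_rel_def restricted_def low_degree_adj low_degree_co_adj)

text \<open>Every edge between \<open>X\<close> and \<open>Y\<close> is reached from an end in
  \<open>X\<close>, so the number of edges, taken as sets, is at most the sum of the
  degrees.\<close>

lemma few_edges_weakly_sparse:
  assumes "finite X" "finite Y" "few_edges (adj G) c X Y"
  shows "weakly_sparse G c X Y"
proof -
  have "{e \<in> edges G. \<exists>x\<in>X. \<exists>y\<in>Y. e = {x, y}} \<subseteq> (\<Union>x\<in>X. (\<lambda>y. {x, y}) ` nbhd (adj G) x Y)"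
    by (auto simp: nbhd_def adj_def)
  then have "card {e \<in> edges G. \<exists>x\<in>X. \<exists>y\<in>Y. e = {x, y}} \<le> card (\<Union>x\<in>X. (\<lambda>y. {x, y}) ` nbhd (adj G) x Y)"
    using assms(1,2) by (intro card_mono) (auto simp: finite_nbhd)
  also have "\<dots> \<le> (\<Sum>x\<in>X. card ((\<lambda>y. {x, y}) ` nbhd (adj G) x Y))" using assms(1) by (rule card_UN_le)
  also have "\<dots> \<le> (\<Sum>x\<in>X. card (nbhd (adj G) x Y))"
    using assms(2) by (intro sum_mono card_image_le finite_nbhd)
  finally have "real (card {e \<in> edges G. \<exists>x\<in>X. \<exists>y\<in>Y. e = {x, y}}) \<le> (\<Sum>x\<in>X. real (card (nbhd (adj G) x Y)))"
    by (simp flip: of_nat_sum)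
  then show ?thesis using assms(3) unfolding few_edges_def weakly_sparse_def by linarith
qed

lemma weakly_sparse_sym: "weakly_sparse G c X Y \<Longrightarrow> weakly_sparse G c Y X"
proof -
  assume w: "weakly_sparse G c X Y"
  have "{e \<in> edges G. \<exists>x\<in>Y. \<exists>y\<in>X. e = {x, y}} = {e \<in> edges G. \<exists>x\<in>X. \<exists>y\<in>Y. e = {x, y}}"
    by (auto simp: insert_commute)
  then show ?thesis using w by (simp add: weakly_sparse_def mult_ac)
qed

text \<open>A copy of \<open>F\<close> in the complement of an induced subgraph of \<open>G\<close>
  is, on the same vertices, a copy of \<open>complement F\<close> in \<open>G\<close>.\<close>

lemma free_complement_induced:
  assumes G: "simple_graph G" and M: "M \<subseteq> verts G" and F: "F \<in> \<F>" and free: "free (complement ` \<F>) G"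
    and Y: "Y \<subseteq> M"
  shows "\<not> isomorphic (induced (complement (induced G M)) Y) F"
proof
  define K where "K = complement (induced G M)"
  have vK: "verts K = M" by (simp add: K_def verts_complement verts_induced[OF M])
  assume "isomorphic (induced (complement (induced G M)) Y) F"
  then obtain f where f: "bij_betw f Y (verts F)"
    "\<forall>u\<in>Y. \<forall>v\<in>Y. adj (induced K Y) u v \<longleftrightarrow> adj F (f u) (f v)"
    unfolding isomorphic_adj K_def[symmetric] using verts_induced[of Y K] Y vK by auto
  have YG: "Y \<subseteq> verts G" using Y M by blast
  have irr: "\<not> adj G u u" for u using irreflp_adj[OF G] by (auto simp: irreflp_def)
  have "adj (induced G Y) u v \<longleftrightarrow> adj (complement F) (f u) (f v)" if uv: "u \<in> Y" "v \<in> Y" for u v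
  proof -
    have fF: "f u \<in> verts F" "f v \<in> verts F" and ff: "f u = f v \<longleftrightarrow> u = v"
      using f(1) uv by (auto simp: bij_betw_def inj_on_def)
    have "adj K u v \<longleftrightarrow> u \<noteq> v \<and> \<not> adj G u v"
      unfolding K_def using uv Y by (subst adj_complement) (auto simp: verts_induced[OF M] adj_induced)
    moreover have "adj K u v \<longleftrightarrow> adj F (f u) (f v)" using f(2) uv by (simp add: adj_induced)
    ultimately show ?thesis
      unfolding adj_complement[OF fF] ff using uv irr by (auto simp: adj_induced)
  qed
  then have "isomorphic (induced G Y) (complement F)"
    unfolding isomorphic_adj verts_induced[OF YG] verts_complement using f(1) by blast
  then show False using free F YG unfolding free_def by blast
qed

theorem lemma1p13:
  fixes \<F> :: "graph set"
  assumes "finite \<F>" and "\<forall>F\<in>\<F>. simple_graph F"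
    and "leaf_reducible \<F>"
    and "property_star \<F>"
  shows "generalized_nice \<F>"
proof -
  obtain H v where H: "H \<in> \<F>" and v: "v \<in> verts H" and deg: "degree H v = 1"
    and EH: "erdos_hajnal ((\<F> - {H}) \<union> {delete_vertex H v})"
    using assms(3) unfolding leaf_reducible_def by blast
  have sH: "simple_graph H" using assms(2) H by blast
  obtain u where nb: "neighbours H v = {u}" using deg unfolding degree_def by (metis card_1_singletonE)
  define PH where "PH i j \<longleftrightarrow> \<not> adj H i j" for i j
  have irrH: "\<not> adj H x x" for x using irreflp_adj[OF sH] by (auto simp: irreflp_def)
  have nbH: "x \<in> verts H \<and> adj H v x \<longleftrightarrow> x = u" for x
    using nb by (auto simp: neighbours_def adj_def set_eq_iff)
  interpret leaf_pattern "verts H" PH v u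
  proof
    show "finite (verts H)" using sH by (simp add: simple_graph_def)
    show "v \<in> verts H" by (rule v)
    show "u \<in> verts H" "u \<noteq> v" "\<not> PH v u" using nbH[of u] irrH by (auto simp: PH_def)
    show "PH i j \<longleftrightarrow> PH j i" for i j using symp_adj by (auto simp: PH_def dest: sympD)
    show "PH v i" if "i \<in> verts H" "i \<noteq> v" "i \<noteq> u" for i using nbH[of i] that by (auto simp: PH_def)
  qed
  obtain c where c: "0 < c" and EHc: "\<forall>G. simple_graph G \<and> free ((\<F> - {H}) \<union> {delete_vertex H v}) G \<longrightarrow>
      has_clique_or_stable G (real (card (verts G)) powr c)"
    using EH unfolding erdos_hajnal_def by (elim exE conjE) (rule that)
  obtain s1 s2 s3 where s: "0 < s1" "0 < s2" "0 < s3" and star0: "\<forall>G. simple_graph G \<and> free (complement ` \<F>) G \<longrightarrow>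
        (\<forall>l w as Bs v.
           comb G l w as Bs \<and> 4 \<le> l \<and> 4 \<le> w \<and>
           v \<in> verts G - (set as \<union> \<Union>(set Bs)) \<and>
           complete_to G {v} (\<Union>(set Bs)) \<and> anticomplete_to G {v} (set as) \<longrightarrow>
             has_clique_or_stable G (w powr s1) \<or>
             (\<exists>k\<ge>real l powr s3. has_complete_or_anticomplete_blockade G k (w / k powr s2)) \<or>
             has_pure_blockade G (real l) (w / (real l)^2))"
    using assms(4) unfolding property_star_def by (elim exE conjE) (rule that)
  have star: "has_clique_or_stable G (w powr s1) \<or>
             (\<exists>k\<ge>real l powr s3. has_complete_or_anticomplete_blockade G k (w / k powr s2)) \<or>
             has_pure_blockade G (real l) (w / (real l)^2)"
    if "simple_graph G" "free (complement ` \<F>) G" "comb G l w as Bs \<and> 4 \<le> l \<and> 4 \<le> w \<and>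
           v \<in> verts G - (set as \<union> \<Union>(set Bs)) \<and>
           complete_to G {v} (\<Union>(set Bs)) \<and> anticomplete_to G {v} (set as)" for G l w as Bs v
    by (rule star0[THEN spec, THEN mp, OF conjI[OF that(1,2)], THEN spec, THEN spec, THEN spec, THEN spec, THEN spec,
          THEN mp, OF that(3)])
  have tame: "tame c (adj G) (verts G)" if G: "simple_graph G" and free: "free (complement ` \<F>) G" for G
    unfolding tame_def
  proof (intro conjI)
    show "finite (verts G)" using G by (simp add: simple_graph_def)
    show "symp (adj G)" "irreflp (adj G)" by (rule symp_adj, rule irreflp_adj[OF G])
    show "\<not> embeds (adj G) PH (verts H) (verts G)"
    proof
      assume emb: "embeds (adj G) PH (verts H) (verts G)"
      have "\<exists>Y\<subseteq>verts G. isomorphic (induced G Y) (complement H)"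
        using emb by (intro embeds_imp_isomorphic[OF G simple_complement[OF sH] subset_refl, of PH])
          (auto simp: verts_complement adj_complement PH_def)
      then show False using free H unfolding free_def by blast
    qed
    show "EH_in c (adj G) (verts G)"
      unfolding EH_in_def
    proof (intro allI impI)
      fix M assume M: "M \<subseteq> verts G" and nemb: "\<not> embeds (adj G) PH VJ M"
      \<comment> \<open>The Erdos-Hajnal property concerns \<open>H - v\<close>, so it is applied to
        the complement of the graph on \<open>M\<close>. The remaining members of the class are
        excluded there because \<open>G\<close> excludes their complements, and \<open>H - v\<close>
        because \<open>M\<close> contains no copy of \<open>PH\<close> on \<open>VJ\<close>. Cliques
        and stable sets merely change places.\<close>
      define K where "K = complement (induced G M)"
      have K: "simple_graph K" "verts K = M"
        using simple_complement[OF simple_induced[OF G]] by (simp_all add: K_def verts_complement verts_induced[OF M])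
      have adjK: "adj K x y \<longleftrightarrow> x \<noteq> y \<and> \<not> adj G x y" if "x \<in> M" "y \<in> M" for x y
        unfolding K_def using that by (subst adj_complement) (auto simp: verts_induced[OF M] adj_induced)
      have "free ((\<F> - {H}) \<union> {delete_vertex H v}) K"
        unfolding free_def K(2)
      proof clarify
        fix Y F assume Y: "Y \<subseteq> M" and F: "F \<in> (\<F> - {H}) \<union> {delete_vertex H v}"
          and iso: "isomorphic (induced K Y) F"
        show False
        proof (cases "F \<in> \<F>")
          case True
          then show False using free_complement_induced[OF G M True free Y] iso by (simp add: K_def)
        next
          case False
          then have Fd: "F = delete_vertex H v" using F by blast
          have vF: "verts F = VJ" by (auto simp: Fd delete_vertex_def induced_def VJ_def)
          have aF: "adj F i j \<longleftrightarrow> \<not> PH i j" if "i \<in> VJ" "j \<in> VJ" for i j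
            using that by (auto simp: Fd delete_vertex_def adj_induced PH_def VJ_def)
          have "embeds (adj K) (adj F) VJ Y"
            using isomorphic_imp_embeds[of Y K F] iso Y K(2) vF by simp
          then obtain f where f: "inj_on f VJ" "f ` VJ \<subseteq> Y"
            "\<forall>i\<in>VJ. \<forall>j\<in>VJ. i \<noteq> j \<longrightarrow> (adj K (f i) (f j) \<longleftrightarrow> adj F i j)" unfolding embeds_def by auto
          have "adj G (f i) (f j) \<longleftrightarrow> PH i j" if ij: "i \<in> VJ" "j \<in> VJ" "i \<noteq> j" for i j
          proof -
            have "f i \<in> M" "f j \<in> M" "f i \<noteq> f j" using f(1,2) ij Y by (auto dest: inj_onD)
            then show ?thesis using adjK[of "f i" "f j"] f(3) aF[of i j] ij by auto
          qed
          moreover have "f ` VJ \<subseteq> M" using f(2) Y by (rule subset_trans)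
          ultimately have "embeds (adj G) PH VJ M" unfolding embeds_def using f(1) by (intro exI[of _ f]) simp
          with nemb show False by blast
        qed
      qed
      from EHc[THEN spec, THEN mp, OF conjI[OF K(1) this]] obtain S where S: "S \<subseteq> M" "homogeneous (adj K) S" "real (card M) powr c \<le> real (card S)"
        unfolding has_clique_or_stable_def K(2) homogeneous_clique_or_indep[OF K(1)] by blast
      have "adj K x y \<longleftrightarrow> co (adj G) x y" if "x \<in> S" "y \<in> S" for x y
        using adjK[of x y] that S(1) by (auto simp: co_def)
      then have "homogeneous (co (adj G)) S" using S(2) homogeneous_cong[of S "adj K"] by blast
      then have "homogeneous (adj G) S" by (auto simp: homogeneous_def co_co[OF irreflp_adj[OF G]])
      with S show "\<exists>S\<subseteq>M. homogeneous (adj G) S \<and> real (card M) powr c \<le> real (card S)" by blast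
    qed
  qed
  obtain a D :: nat where aD: "3 \<le> a" "0 < D" and main: "\<forall>(E :: nat \<Rightarrow> nat \<Rightarrow> bool) V \<epsilon>. tame c E V \<and>
      (\<forall>X\<subseteq>V. comb_property s1 s2 s3 E X) \<and> 0 < \<epsilon> \<and> \<epsilon> < 1 / 2 \<longrightarrow>
    (\<exists>Bs. (\<forall>B\<in>set Bs. B \<subseteq> V \<and> \<epsilon> ^ a * real (card V) \<le> real (card B)) \<and> 1 / \<epsilon> \<le> real (length Bs) \<and>
       sorted_wrt (final_rel E (\<epsilon> ^ 8)) Bs) \<or>
    (\<exists>Y\<subseteq>V. homogeneous E Y \<and> (\<epsilon> ^ a * real (card V)) powr s1 \<le> real (card Y)) \<or>
    (\<exists>k Bs. 1 / \<epsilon> \<le> k \<and> (blocks V k (real (card V) / k powr real D) (complete_pair E) Bs \<or>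
       blocks V k (real (card V) / k powr real D) (anticomplete_pair E) Bs)) \<or>
    (\<exists>W\<subseteq>V. restricted_rel E (\<epsilon> ^ 4) W \<and> \<epsilon> ^ a * real (card V) \<le> real (card W))"
    using restricted_or_blockade[OF c s, where 'a = nat] by (elim exE conjE) (rule that)
  have final: "(\<exists>Bs. blockade G (1/\<epsilon>) (\<epsilon> powr real a * real (card (verts G))) Bs \<and>
        pairwise_blocks (\<lambda>X Y. complete_to G X Y \<or> weakly_sparse G (\<epsilon> powr 8) X Y) Bs) \<or>
      has_clique_or_stable G ((\<epsilon> powr real a * real (card (verts G))) powr s1) \<or>
      (\<exists>k\<ge>\<epsilon> powr (-1). has_complete_or_anticomplete_blockade G k (real (card (verts G)) / k powr real D)) \<or>
      (\<exists>X\<subseteq>verts G. restricted G (\<epsilon> powr 4) X \<and> \<epsilon> powr real a * real (card (verts G)) \<le> real (card X))"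
    if G: "simple_graph G" and free: "free (complement ` \<F>) G" and eps: "0 < \<epsilon>" "\<epsilon> < 1 / 2" for G and \<epsilon> :: real
  proof -
    have finG: "finite (verts G)" using G by (simp add: simple_graph_def)
    have pw: "\<epsilon> powr real m = \<epsilon> ^ m" for m using eps by (simp add: powr_realpow)
    have pw8: "\<epsilon> powr 8 = \<epsilon> ^ 8" "\<epsilon> powr 4 = \<epsilon> ^ 4" using pw[of 8] pw[of 4] by simp_all
    have pwm: "\<epsilon> powr (-1) = 1 / \<epsilon>" using eps by (simp add: powr_minus_divide)
    have "\<forall>X\<subseteq>verts G. comb_property s1 s2 s3 (adj G) X"
    proof (intro allI impI)
      fix X assume "X \<subseteq> verts G"
      then show "comb_property s1 s2 s3 (adj G) X" by (rule comb_property_induced[OF G free _ star])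
    qed
    then have "tame c (adj G) (verts G) \<and> (\<forall>X\<subseteq>verts G. comb_property s1 s2 s3 (adj G) X) \<and> 0 < \<epsilon> \<and> \<epsilon> < 1 / 2"
      using tame[OF G free] eps by simp
    from main[THEN spec, THEN spec, THEN spec, THEN mp, OF this]
    consider (i) Bs where "\<forall>B\<in>set Bs. B \<subseteq> verts G \<and> \<epsilon> ^ a * real (card (verts G)) \<le> real (card B)"
        "1 / \<epsilon> \<le> real (length Bs)" "sorted_wrt (final_rel (adj G) (\<epsilon> ^ 8)) Bs"
      | (ii) Y where "Y \<subseteq> verts G" "homogeneous (adj G) Y" "(\<epsilon> ^ a * real (card (verts G))) powr s1 \<le> real (card Y)"
      | (iii) k Bs where "1 / \<epsilon> \<le> k" "blocks (verts G) k (real (card (verts G)) / k powr real D) (complete_pair (adj G)) Bs \<or>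
          blocks (verts G) k (real (card (verts G)) / k powr real D) (anticomplete_pair (adj G)) Bs"
      | (iv) W where "W \<subseteq> verts G" "restricted_rel (adj G) (\<epsilon> ^ 4) W" "\<epsilon> ^ a * real (card (verts G)) \<le> real (card W)"
      by blast
    then show ?thesis
    proof cases
      case i
      have "sorted_wrt (\<lambda>P Q. P \<inter> Q = {} \<and> (complete_to G P Q \<or> weakly_sparse G (\<epsilon> ^ 8) P Q)) Bs"
      proof (rule sorted_wrt_mono_rel[OF _ i(3)])
        fix P Q assume PQ: "P \<in> set Bs" "Q \<in> set Bs" "final_rel (adj G) (\<epsilon> ^ 8) P Q"
        then have "finite P" "finite Q" using i(1) finG finite_subset by blast+
        then show "P \<inter> Q = {} \<and> (complete_to G P Q \<or> weakly_sparse G (\<epsilon> ^ 8) P Q)"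
          using PQ(3) few_edges_weakly_sparse by (auto simp: final_rel_def complete_to_pair)
      qed
      then have "blocks (verts G) (1 / \<epsilon>) (\<epsilon> ^ a * real (card (verts G)))
          (\<lambda>P Q. complete_to G P Q \<or> weakly_sparse G (\<epsilon> ^ 8) P Q) Bs"
        using i(1,2) by (simp add: blocks_def)
      moreover have "complete_to G Q P \<or> weakly_sparse G (\<epsilon> ^ 8) Q P"
        if "complete_to G P Q \<or> weakly_sparse G (\<epsilon> ^ 8) P Q" for P Q
        using that complete_pair_sym weakly_sparse_sym by (auto simp: complete_to_pair)
      ultimately have "blockade G (1 / \<epsilon>) (\<epsilon> ^ a * real (card (verts G))) Bs \<and>
          pairwise_blocks (\<lambda>P Q. complete_to G P Q \<or> weakly_sparse G (\<epsilon> ^ 8) P Q) Bs"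
        by (subst (asm) blocks_iff_blockade) auto
      then show ?thesis unfolding pw pw8 by (intro disjI1) blast
    next
      case ii
      then have "has_clique_or_stable G ((\<epsilon> ^ a * real (card (verts G))) powr s1)"
        unfolding has_clique_or_stable_def homogeneous_clique_or_indep[OF G] by blast
      then show ?thesis unfolding pw by (intro disjI2 disjI1)
    next
      case iii
      have "has_complete_or_anticomplete_blockade G k (real (card (verts G)) / k powr real D)"
        using iii(2) blocks_iff_blockade[of "complete_pair (adj G)" G, OF complete_pair_sym]
          blocks_iff_blockade[of "anticomplete_pair (adj G)" G, OF anticomplete_pair_sym]
        unfolding has_complete_or_anticomplete_blockade_def complete_to_pair[abs_def] anticomplete_to_pair[abs_def]
        by auto
      then show ?thesis using iii(1) pwm by (intro disjI2 disjI1) auto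
    next
      case iv
      then have "restricted G (\<epsilon> ^ 4) W" using restricted_adj by blast
      then show ?thesis unfolding pw pw8 using iv by blast
    qed
  qed
  have a: "(3::real) \<le> real a" "(0::real) < real a" and D: "(0::real) < real D" using aD by simp_all
  show ?thesis
    unfolding generalized_nice_def Let_def
    by (rule exI[of _ "real a"], rule conjI, rule a(1), rule exI[of _ "8::real"], rule conjI, simp,
        rule exI[of _ "real a"], rule conjI, rule a(2), rule exI[of _ s1], rule conjI, rule s(1),
        rule exI[of _ "real D"], rule conjI, rule D, rule exI[of _ "1::real"], rule conjI, simp,
        rule exI[of _ "4::real"], rule conjI, simp, rule exI[of _ "real a"], rule conjI, rule a(2),
        intro allI impI, elim conjE, rule final; assumption)
qed

end
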